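(* In the setting described in the context (a real analytic electromagnetic Lagrangian system on the ball $E=B(0,r_E)\subset\mathbb{R}^n$ with critical point $p=0$ of the potential $U$, weak magnetism hypothesis, McGehee manifold $M=[0,r_E)\times S^{n-1}\times\mathbb{R}^n$ and map $\pi:M\to TE$), suppose that the critical point $p$ is not a strict minimum of $U$ and $U(p)=0$. Then the restriction of $\pi$ to the critical and subcritical energy regions $$\pi_{\le0}:\ \tilde H^{-1}(-\infty,0]\to H^{-1}(-\infty,0]$$ is a (well-defined) surjective continuous proper map with the following properties, where $\mathbf{0}=(p,0)$: 1. $\pi_{\le0}^{-1}(\mathbf{0})=\partial M_{\le0}\ne\emptyset$. 2. The restriction $\pi_{\le0}:\tilde H^{-1}(-\infty,0]-\partial M_{\le0}\to H^{-1}(-\infty,0]-\{\mathbf{0}\}$ is a homeomorphism. 3. The restriction $\pi_{<0}:\tilde H^{-1}(-\infty,0)-\partial M_{<0}\to H^{-1}(-\infty,0)$ is a real analytic diffeomorphism. 4. $\pi_{\le0}$ maps each orbit (of the McGehee flow) to an orbit (of the Euler–Lagrange flow) preserving orientations, and the resulting map on orbits is surjective. In particular, the map in item 2 is a topological equivalence of flows.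
   Context: **System.** $E=B(0,r_E)\subset\mathbb{R}^n$ is a ball centered at $p=0$, with a real analytic Riemannian metric $g$ with $g_{ij}(0)=\delta_{ij}$, a real analytic function $U$ with $U(0)=0$, $d_0U=0$ and non-zero germ at $0$, and a real analytic one-form $\mu$. The Euler–Lagrange vector field $X$ on $TE=E\times\mathbb{R}^n$ of $L(x,v)=\tfrac12g_x(v,v)+\mu_x(v)-U(x)$ is given by $\dot x=v$, $\nabla_{\dot x}v=-\mathrm{grad}_gU(x)-\mathcal{R}_x(\iota_vd\mu(x))$ ($\nabla$ the Levi-Civita connection, $\mathcal{R}$ Riesz duality). The energy is $H(x,v)=\tfrac12g_x(v,v)+U(x)$ on $TE$. $U_l$, of degree $l\ge2$, is the first non-zero homogeneous Taylor term of $U$ at $0$ ($U$ and all Taylor expansions of $U$, $g_{ij}$ and the coefficients of $\mu$ may be assumed to be as regular on $E$ as needed by shrinking $r_E$). Weak magnetism hypothesis: $d-l/2\ge1$, where $d$ is the smallest degree of a non-zero homogeneous Taylor term at $0$ of the coefficients of $\mu$ (satisfied by convention if $\mu=0$). **McGehee coordinates.** $M=[0,r_E)\times S^{n-1}\times\mathbb{R}^n$, $\pi:M\to TE$, $\pi(r,q,y)=(rq,\,r^{l/2}y)$; $\partial M=\{r=0\}=\pi^{-1}(\mathbf{0})$. On $M-\partial M$ put $\tilde X=r^{1-l/2}(\pi^{-1})_*X$ and $\tilde H=r^{-l}\,H\circ\pi$. The vector field $\tilde X$ extends to a $C^1$ vector field on $M$ tangent to $\partial M$, and $\tilde H$ extends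 real analytically to $M$, with $\tilde H(0,q,y)=\tfrac12\|y\|^2+U_l(q)$; the extensions are denoted the same way. The McGehee flow is the (local) flow of $\tilde X$ on $M$. Put $\partial M_0=\partial M\cap\tilde H^{-1}(0)$, $\partial M_{\le0}=\partial M\cap\tilde H^{-1}(-\infty,0]$, $\partial M_{<0}=\partial M_{\le0}-\partial M_0$. A topological equivalence of flows is a homeomorphism mapping orbits onto orbits preserving orientation. *)

theory Defs
  imports "HOL-Analysis.Analysis"
begin

text \<open>
  Exponents are extensional functions on \<^term>\<open>Basis\<close>, i.e. multi-indices. For open \<open>S\<close> this is
  ordinary real analyticity; for general \<open>S\<close> it says that \<open>f\<close> is locally the restriction of a real
  analytic map of the ambient space, which is the intrinsic notion when \<open>S\<close> is an embedded real
  analytic submanifold such as an open piece of \<open>(0,r_E) \<times> sphere \<times> R^n\<close>.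
\<close>

definition real_analytic_on :: "('a::euclidean_space \<Rightarrow> 'b::euclidean_space) \<Rightarrow> 'a set \<Rightarrow> bool" where
  "real_analytic_on f S \<longleftrightarrow>
     (\<forall>a\<in>S. \<exists>\<epsilon>>0. \<exists>c :: ('a \<Rightarrow> nat) \<Rightarrow> 'b. \<exists>h.
        (\<forall>x\<in>ball a \<epsilon>.
           ((\<lambda>\<alpha>. (\<Prod>b\<in>Basis. ((x - a) \<bullet> b) ^ \<alpha> b) *\<^sub>R c \<alpha>) has_sum h x) (Basis \<rightarrow>\<^sub>E UNIV)) \<and>
        (\<forall>x\<in>S \<inter> ball a \<epsilon>. f x = h x))"

definition real_analytic_diffeo ::
  "'a::euclidean_space set \<Rightarrow> 'b::euclidean_space set \<Rightarrow> ('a \<Rightarrow> 'b) \<Rightarrow> bool" where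
  "real_analytic_diffeo S T f \<longleftrightarrow>
     bij_betw f S T \<and> real_analytic_on f S \<and> real_analytic_on (the_inv_into S f) T"

text \<open>The homogeneous Taylor term of degree \<open>k\<close> at the origin, \<open>x \<mapsto> D\<^sup>kf(0)(x,\<dots>,x) / k!\<close>.\<close>

definition taylor_term :: "('a::real_normed_vector \<Rightarrow> real) \<Rightarrow> nat \<Rightarrow> 'a \<Rightarrow> real" where
  "taylor_term f k x = (deriv ^^ k) (\<lambda>t. f (t *\<^sub>R x)) 0 / fact k"

text \<open>
  A vector field on \<open>S\<close> is given by its values in the ambient vector space. Since the time interval is
  open, on a manifold with boundary these are the integral curves of a field tangent to the boundary.
\<close>

definition integral_curve ::
  "('a::real_normed_vector \<Rightarrow> 'a) \<Rightarrow> 'a set \<Rightarrow> real set \<Rightarrow> (real \<Rightarrow> 'a) \<Rightarrow> bool" where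
  "integral_curve X S I \<gamma> \<longleftrightarrow>
     open I \<and> is_interval I \<and> I \<noteq> {} \<and> \<gamma> ` I \<subseteq> S \<and>
     (\<forall>t\<in>I. (\<gamma> has_vector_derivative X (\<gamma> t)) (at t))"

definition maximal_integral_curve ::
  "('a::real_normed_vector \<Rightarrow> 'a) \<Rightarrow> 'a set \<Rightarrow> real set \<Rightarrow> (real \<Rightarrow> 'a) \<Rightarrow> bool" where
  "maximal_integral_curve X S I \<gamma> \<longleftrightarrow>
     integral_curve X S I \<gamma> \<and>
     (\<forall>J \<delta>. integral_curve X S J \<delta> \<and> I \<subseteq> J \<and> (\<forall>t\<in>I. \<delta> t = \<gamma> t) \<longrightarrow> J = I)"

definition flow_invariant :: "('a::real_normed_vector \<Rightarrow> 'a) \<Rightarrow> 'a set \<Rightarrow> 'a set \<Rightarrow> bool" where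
  "flow_invariant X S A \<longleftrightarrow>
     A \<subseteq> S \<and> (\<forall>I \<gamma>. maximal_integral_curve X S I \<gamma> \<and> \<gamma> ` I \<inter> A \<noteq> {} \<longrightarrow> \<gamma> ` I \<subseteq> A)"

definition orbits :: "('a::real_normed_vector \<Rightarrow> 'a) \<Rightarrow> 'a set \<Rightarrow> 'a set \<Rightarrow> 'a set set" where
  "orbits X S A = {\<gamma> ` I | I \<gamma>. maximal_integral_curve X S I \<gamma> \<and> \<gamma> ` I \<subseteq> A}"

text \<open>
  \<open>f\<close> maps every orbit in \<open>A\<close> of the flow of \<open>X\<close> on \<open>S\<close> onto an orbit of the flow of \<open>Y\<close> on \<open>T\<close>,
  up to an increasing (hence continuous) change of time. If the image is an equilibrium, then
  \<open>J = UNIV\<close>, \<open>\<delta>\<close> is constant, and orientation is no restriction.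
\<close>

definition maps_orbits_oriented ::
  "('a::real_normed_vector \<Rightarrow> 'a) \<Rightarrow> 'a set \<Rightarrow> 'a set \<Rightarrow>
   ('b::real_normed_vector \<Rightarrow> 'b) \<Rightarrow> 'b set \<Rightarrow> ('a \<Rightarrow> 'b) \<Rightarrow> bool" where
  "maps_orbits_oriented X S A Y T f \<longleftrightarrow>
     (\<forall>I \<gamma>. maximal_integral_curve X S I \<gamma> \<and> \<gamma> ` I \<subseteq> A \<longrightarrow>
        (\<exists>J \<delta> s. maximal_integral_curve Y T J \<delta> \<and>
           strict_mono_on I s \<and> s ` I = J \<and> (\<forall>t\<in>I. f (\<gamma> t) = \<delta> (s t))))"

definition topological_equivalence ::
  "('a::real_normed_vector \<Rightarrow> 'a) \<Rightarrow> 'a set \<Rightarrow> 'a set \<Rightarrow>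
   ('b::real_normed_vector \<Rightarrow> 'b) \<Rightarrow> 'b set \<Rightarrow> 'b set \<Rightarrow> ('a \<Rightarrow> 'b) \<Rightarrow> bool" where
  "topological_equivalence X S A Y T B f \<longleftrightarrow>
     flow_invariant X S A \<and> flow_invariant Y T B \<and>
     (\<exists>f'. homeomorphism A B f f') \<and>
     maps_orbits_oriented X S A Y T f \<and>
     (\<lambda>C. f ` C) ` orbits X S A = orbits Y T B"

definition partial :: "'n \<Rightarrow> (real^'n \<Rightarrow> real) \<Rightarrow> real^'n \<Rightarrow> real" where
  "partial i f x = frechet_derivative f (at x) (axis i 1)"

definition christoffel :: "(real^'n \<Rightarrow> real^'n^'n) \<Rightarrow> real^'n \<Rightarrow> 'n \<Rightarrow> 'n \<Rightarrow> 'n \<Rightarrow> real" where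
  "christoffel g x k i j =
     1/2 * (\<Sum>m\<in>UNIV. matrix_inv (g x) $ k $ m *
        (partial i (\<lambda>y. g y $ m $ j) x + partial j (\<lambda>y. g y $ m $ i) x
          - partial m (\<lambda>y. g y $ i $ j) x))"

definition riesz :: "(real^'n \<Rightarrow> real^'n^'n) \<Rightarrow> real^'n \<Rightarrow> real^'n \<Rightarrow> real^'n" where
  "riesz g x \<omega> = matrix_inv (g x) *v \<omega>"

definition grad :: "(real^'n \<Rightarrow> real^'n^'n) \<Rightarrow> (real^'n \<Rightarrow> real) \<Rightarrow> real^'n \<Rightarrow> real^'n" where
  "grad g U x = riesz g x (\<chi> i. partial i U x)"

text \<open>\<open>\<iota>\<^sub>v d\<mu>\<close> at \<open>x\<close>, for the one-form with coefficients \<open>\<mu> x $ i\<close>, where \<open>(d\<mu>)\<^sub>i\<^sub>j = \<partial>\<^sub>i \<mu>\<^sub>j - \<partial>\<^sub>j \<mu>\<^sub>i\<close>.\<close>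

definition contract_d :: "(real^'n \<Rightarrow> real^'n) \<Rightarrow> real^'n \<Rightarrow> real^'n \<Rightarrow> real^'n" where
  "contract_d \<mu> x v =
     (\<chi> j. \<Sum>i\<in>UNIV. v $ i * (partial i (\<lambda>y. \<mu> y $ j) x - partial j (\<lambda>y. \<mu> y $ i) x))"

text \<open>
  The Euler-Lagrange field of \<open>L(x,v) = g\<^sub>x(v,v)/2 + \<mu>\<^sub>x(v) - U(x)\<close>, written out from
  \<open>\<nabla>\<^sub>v v = - grad U - riesz (\<iota>\<^sub>v d\<mu>)\<close>.
\<close>

definition EL_field ::
  "(real^'n \<Rightarrow> real^'n^'n) \<Rightarrow> (real^'n \<Rightarrow> real) \<Rightarrow> (real^'n \<Rightarrow> real^'n) \<Rightarrow>
   (real^'n) \<times> (real^'n) \<Rightarrow> (real^'n) \<times> (real^'n)" where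
  "EL_field g U \<mu> = (\<lambda>(x, v).
     (v, - (\<chi> k. \<Sum>i\<in>UNIV. \<Sum>j\<in>UNIV. christoffel g x k i j * v $ i * v $ j)
         - grad g U x - riesz g x (contract_d \<mu> x v)))"

definition energy ::
  "(real^'n \<Rightarrow> real^'n^'n) \<Rightarrow> (real^'n \<Rightarrow> real) \<Rightarrow> (real^'n) \<times> (real^'n) \<Rightarrow> real" where
  "energy g U = (\<lambda>(x, v). 1/2 * (v \<bullet> (g x *v v)) + U x)"

definition mcgehee_space :: "real \<Rightarrow> (real \<times> (real^'n) \<times> (real^'n)) set" where
  "mcgehee_space r\<^sub>E = {0..<r\<^sub>E} \<times> sphere 0 1 \<times> UNIV"

definition mcgehee_boundary :: "(real \<times> (real^'n) \<times> (real^'n)) set" where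
  "mcgehee_boundary = {0} \<times> sphere 0 1 \<times> UNIV"

definition mcgehee_map :: "nat \<Rightarrow> real \<times> (real^'n) \<times> (real^'n) \<Rightarrow> (real^'n) \<times> (real^'n)" where
  "mcgehee_map l = (\<lambda>(r, q, y). (r *\<^sub>R q, (r powr (real l / 2)) *\<^sub>R y))"

text \<open>The continuous extension of \<open>f\<close> from \<open>M - \<partial>M\<close> to \<open>M\<close>; it is unique because \<open>M - \<partial>M\<close> is dense.\<close>

definition mcgehee_extend ::
  "real \<Rightarrow> (real \<times> (real^'n) \<times> (real^'n) \<Rightarrow> 'b::t2_space) \<Rightarrow>
   real \<times> (real^'n) \<times> (real^'n) \<Rightarrow> 'b" where
  "mcgehee_extend r\<^sub>E f z =
     (if z \<in> mcgehee_boundary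
      then Lim (at z within (mcgehee_space r\<^sub>E - mcgehee_boundary)) f
      else f z)"

definition mcgehee_energy ::
  "real \<Rightarrow> nat \<Rightarrow> (real^'n \<Rightarrow> real^'n^'n) \<Rightarrow> (real^'n \<Rightarrow> real) \<Rightarrow>
   real \<times> (real^'n) \<times> (real^'n) \<Rightarrow> real" where
  "mcgehee_energy r\<^sub>E l g U =
     mcgehee_extend r\<^sub>E (\<lambda>z. energy g U (mcgehee_map l z) / fst z ^ l)"

text \<open>
  \<open>r\<^bsup>1-l/2\<^esup> (\<pi>\<^sup>-\<^sup>1)\<^sub>* X\<close>. The inverse of \<open>\<pi>\<close> restricted to \<open>M - \<partial>M\<close> is smooth on the open set
  \<open>{(x,v). x \<in> E - {0}}\<close>, with values in the ambient space of \<open>M\<close>.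
\<close>

definition mcgehee_field ::
  "real \<Rightarrow> nat \<Rightarrow> (real^'n \<Rightarrow> real^'n^'n) \<Rightarrow> (real^'n \<Rightarrow> real) \<Rightarrow> (real^'n \<Rightarrow> real^'n) \<Rightarrow>
   real \<times> (real^'n) \<times> (real^'n) \<Rightarrow> real \<times> (real^'n) \<times> (real^'n)" where
  "mcgehee_field r\<^sub>E l g U \<mu> =
     mcgehee_extend r\<^sub>E (\<lambda>z. fst z powr (1 - real l / 2) *\<^sub>R
       frechet_derivative
         (the_inv_into (mcgehee_space r\<^sub>E - mcgehee_boundary) (mcgehee_map l))
         (at (mcgehee_map l z)) (EL_field g U \<mu> (mcgehee_map l z)))"

end

theory Submission
  imports Defs
begin

text \<open>
  On the interior of \<open>M\<close> the map \<open>\<pi>\<close> is a diffeomorphism onto its image that carries the field \<open>Xt\<close> to the positive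
  multiple \<open>r\<^bsup>1-l/2\<^esup> X\<close> of the Euler-Lagrange field, so it matches maximal integral curves after a change of time;
  no existence theorem for integral curves is needed. Since \<open>r' = r (q \<bullet> y)\<close> along the McGehee flow, the boundary is
  invariant, and so is the sign of the energy, which satisfies \<open>Ht' = - l (q \<bullet> y) Ht\<close> on the boundary. Over the origin the
  only point of non-positive energy is the equilibrium \<open>(0, 0)\<close>, which no other curve reaches because \<open>X\<close> grows at most
  linearly there; it is the image of an equilibrium on the boundary, built from a minimiser of the leading term of \<open>U\<close>
  on the sphere. Properness holds because \<open>Ht \<le> 0\<close> bounds \<open>y\<close> as long as \<open>r\<close> stays away from \<open>r\<^sub>E\<close>.
\<close>

subsection \<open>Power series in several variables\<close>

text \<open>The exponent \<open>l / 2\<close> makes kinetic and potential energy scale alike, both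
  like \<open>r ^ l\<close>. Multiplied by \<open>r powr (1 - real l)\<close>, the acceleration then
  keeps only the gradient of the leading term of \<open>U\<close>: the Christoffel term and the
  remainder of \<open>U\<close> are O(r), and so is the magnetic term, since weak magnetism bounds
  the derivatives of \<open>\<mu>\<close> by O(r^(l/2)). The boundary values of \<open>Xt\<close>
  and \<open>Ht\<close> are given through \<open>Lim\<close>, so each has to be identified by an
  actual limit, and for this analyticity provides Taylor estimates of functions and first
  derivatives. Its second use is for \<open>\<pi>\<close> and its inverse: they contain real powers,
  which forces power series to be closed under products and binomial series. For
  \<open>l > 2\<close> the time density is unbounded at \<open>r = 0\<close>, and boundary orbits
  collapse to a point, so the conjugacy of flows is set up on the punctured regions only and the
  origin is treated apart. Uniqueness of integral curves is needed for zero solutions only; there a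
  linear growth bound along the given curve replaces regularity of the fields.\<close>

abbreviation multi_indices :: "('a::euclidean_space \<Rightarrow> nat) set" where
  "multi_indices \<equiv> Basis \<rightarrow>\<^sub>E UNIV"

definition monomial :: "'a::euclidean_space \<Rightarrow> ('a \<Rightarrow> nat) \<Rightarrow> real" where
  "monomial h \<alpha> = (\<Prod>b\<in>Basis. (h \<bullet> b) ^ \<alpha> b)"

definition mdeg :: "('a::euclidean_space \<Rightarrow> nat) \<Rightarrow> nat" where
  "mdeg \<alpha> = (\<Sum>b\<in>Basis. \<alpha> b)"

lemma abs_monomial_le:
  assumes "\<And>b. b \<in> Basis \<Longrightarrow> \<bar>h \<bullet> b\<bar> \<le> \<rho>"
  shows "\<bar>monomial h \<alpha>\<bar> \<le> \<rho> ^ mdeg \<alpha>"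
proof -
  have "\<bar>monomial h \<alpha>\<bar> = (\<Prod>b\<in>Basis. \<bar>h \<bullet> b\<bar> ^ \<alpha> b)"
    by (simp add: monomial_def abs_prod power_abs)
  also have "\<dots> \<le> (\<Prod>b\<in>Basis. \<rho> ^ \<alpha> b)"
    by (intro prod_mono) (auto intro!: power_mono assms)
  also have "\<dots> = \<rho> ^ mdeg \<alpha>"
    by (simp add: mdeg_def power_sum)
  finally show ?thesis .
qed

lemma has_sum_transfer:
  assumes "(f has_sum s) A" "\<And>x. x \<in> A \<Longrightarrow> f x = g x"
  shows "(g has_sum s) A"
  using assms has_sum_cong by blast

text \<open>Summability of real families is absolute, so the absolute values form a summable family
  on the product, and the iterated sum may be read as a double sum.\<close>

lemma has_sum_product:
  fixes f g :: "_ \<Rightarrow> real"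
  assumes f: "(f has_sum a) A" and g: "(g has_sum b) B"
  shows "((\<lambda>(x, y). f x * g y) has_sum (a * b)) (A \<times> B)"
proof (rule has_sum_SigmaI)
  show "((\<lambda>y. case (x, y) of (x, y) \<Rightarrow> f x * g y) has_sum (f x * b)) B" for x
    using has_sum_cmult_right[OF g] by simp
  show "((\<lambda>x. f x * b) has_sum (a * b)) A"
    using has_sum_cmult_left[OF f] by simp
  have fa: "(\<lambda>x. \<bar>f x\<bar>) summable_on A" and ga: "(\<lambda>x. \<bar>g x\<bar>) summable_on B"
    using f g has_sum_imp_summable summable_on_iff_abs_summable_on_real by force+
  have "(\<lambda>(x, y). \<bar>f x\<bar> * \<bar>g y\<bar>) summable_on A \<times> B"
  proof (rule summable_on_SigmaI)
    show "((\<lambda>y. case (x, y) of (x, y) \<Rightarrow> \<bar>f x\<bar> * \<bar>g y\<bar>) has_sum (\<bar>f x\<bar> * infsum (\<lambda>y. \<bar>g y\<bar>) B)) B" for x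
      using has_sum_cmult_right[OF has_sum_infsum[OF ga]] by simp
    show "(\<lambda>x. \<bar>f x\<bar> * infsum (\<lambda>y. \<bar>g y\<bar>) B) summable_on A"
      using summable_on_cmult_left[OF fa] by simp
  qed auto
  then show "(\<lambda>(x, y). f x * g y) summable_on A \<times> B"
    unfolding summable_on_iff_abs_summable_on_real[of "\<lambda>(x, y). f x * g y"]
    by (simp add: case_prod_unfold abs_mult)
qed

text \<open>\<open>M\<close> is a weighted l^1 norm of the coefficients. On the cube of half-width
  \<open>\<rho>\<close> the monomial of \<open>\<alpha>\<close> is bounded by
  \<open>\<rho> ^ mdeg \<alpha>\<close>, a bound attained at a corner, so this norm controls the
  series.\<close>

definition cube_coeffs ::
  "real \<Rightarrow> real \<Rightarrow> ('a::euclidean_space \<Rightarrow> real) \<Rightarrow> (('a \<Rightarrow> nat) \<Rightarrow> real) \<Rightarrow> bool" where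
  "cube_coeffs \<rho> M f c \<longleftrightarrow> ((\<lambda>\<alpha>. \<bar>c \<alpha>\<bar> * \<rho> ^ mdeg \<alpha>) has_sum M) multi_indices \<and>
     (\<forall>h. (\<forall>b\<in>Basis. \<bar>h \<bullet> b\<bar> \<le> \<rho>) \<longrightarrow>
       ((\<lambda>\<alpha>. c \<alpha> * monomial h \<alpha>) has_sum f h) multi_indices)"

text \<open>\<open>N\<close> is only an upper bound of the norm, which lets sums, products and
  series be estimated without knowing the norms of the results.\<close>

definition cube_series :: "real \<Rightarrow> real \<Rightarrow> ('a::euclidean_space \<Rightarrow> real) \<Rightarrow> bool" where
  "cube_series \<rho> N f \<longleftrightarrow> \<rho> > 0 \<and> (\<exists>c M. M \<le> N \<and> cube_coeffs \<rho> M f c)"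

lemma cube_coeffsD:
  assumes "cube_coeffs \<rho> M f c"
  shows "((\<lambda>\<alpha>. \<bar>c \<alpha>\<bar> * \<rho> ^ mdeg \<alpha>) has_sum M) multi_indices"
    and "\<And>h. (\<forall>b\<in>Basis. \<bar>h \<bullet> b\<bar> \<le> \<rho>) \<Longrightarrow> ((\<lambda>\<alpha>. c \<alpha> * monomial h \<alpha>) has_sum f h) multi_indices"
  using assms unfolding cube_coeffs_def by blast+

lemma cube_seriesE:
  assumes "cube_series \<rho> N f"
  obtains c M where "\<rho> > 0" "M \<le> N" "cube_coeffs \<rho> M f c"
  using assms unfolding cube_series_def by blast

lemma cube_seriesI:
  assumes "\<rho> > 0" and sm: "(\<lambda>\<alpha>. \<bar>c \<alpha>\<bar> * \<rho> ^ mdeg \<alpha>) summable_on multi_indices"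
    and le: "infsum (\<lambda>\<alpha>. \<bar>c \<alpha>\<bar> * \<rho> ^ mdeg \<alpha>) multi_indices \<le> N"
    and "\<And>h. (\<forall>b\<in>Basis. \<bar>h \<bullet> b\<bar> \<le> \<rho>) \<Longrightarrow> ((\<lambda>\<alpha>. c \<alpha> * monomial h \<alpha>) has_sum f h) multi_indices"
  shows "cube_series \<rho> N f"
  unfolding cube_series_def cube_coeffs_def using assms(1,4) le has_sum_infsum[OF sm] by blast

text \<open>Products and series of power series are sums of monomials over other index sets; collecting
  equal exponents turns any such absolutely convergent family into a power series.\<close>

lemma cube_series_regroup:
  fixes f :: "'a::euclidean_space \<Rightarrow> real"
  assumes \<rho>: "\<rho> > 0"
    and m: "\<And>j. j \<in> J \<Longrightarrow> m j \<in> multi_indices"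
    and N: "((\<lambda>j. \<bar>a j\<bar> * \<rho> ^ mdeg (m j)) has_sum N) J"
    and f: "\<And>h. (\<And>b. b \<in> Basis \<Longrightarrow> \<bar>h \<bullet> b\<bar> \<le> \<rho>) \<Longrightarrow> ((\<lambda>j. a j * monomial h (m j)) has_sum f h) J"
  shows "cube_series \<rho> N f"
proof -
  define F where "F \<alpha> = {j \<in> J. m j = \<alpha>}" for \<alpha>
  define c where "c \<alpha> = infsum a (F \<alpha>)" for \<alpha>
  have bij: "bij_betw snd (Sigma multi_indices F) J"
    by (auto simp: bij_betw_def inj_on_def F_def image_iff m)
  have F: "m j = \<alpha>" if "j \<in> F \<alpha>" for j \<alpha>
    using that by (simp add: F_def)
  have abs_F: "(\<lambda>j. \<bar>a j\<bar>) summable_on F \<alpha>" for \<alpha>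
  proof -
    have "(\<lambda>j. \<bar>a j\<bar> * \<rho> ^ mdeg (m j)) summable_on F \<alpha>"
      by (rule summable_on_subset_banach[OF has_sum_imp_summable[OF N]]) (auto simp: F_def)
    then have "(\<lambda>j. \<bar>a j\<bar> * \<rho> ^ mdeg \<alpha>) summable_on F \<alpha>"
      using F by (simp cong: summable_on_cong)
    then have "(\<lambda>j. (\<bar>a j\<bar> * \<rho> ^ mdeg \<alpha>) * inverse (\<rho> ^ mdeg \<alpha>)) summable_on F \<alpha>"
      by (rule summable_on_cmult_left)
    then show ?thesis using \<rho> by (simp add: mult.assoc)
  qed
  have c: "(a has_sum c \<alpha>) (F \<alpha>)" for \<alpha>
    unfolding c_def using abs_F summable_on_iff_abs_summable_on_real[of a "F \<alpha>"] by auto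
  have c_le: "\<bar>c \<alpha>\<bar> \<le> infsum (\<lambda>j. \<bar>a j\<bar>) (F \<alpha>)" for \<alpha>
    unfolding c_def using norm_infsum_bound[of a "F \<alpha>"] abs_F[of \<alpha>] by simp
  have "((\<lambda>p. \<bar>a (snd p)\<bar> * \<rho> ^ mdeg (m (snd p))) has_sum N) (Sigma multi_indices F)"
    using has_sum_reindex_bij_betw[OF bij, of "\<lambda>j. \<bar>a j\<bar> * \<rho> ^ mdeg (m j)"] N by simp
  then have *: "((\<lambda>\<alpha>. infsum (\<lambda>j. \<bar>a j\<bar>) (F \<alpha>) * \<rho> ^ mdeg \<alpha>) has_sum N) multi_indices"
  proof (rule has_sum_Sigma')
    fix \<alpha> :: "'a \<Rightarrow> nat"
    show "((\<lambda>j. \<bar>a (snd (\<alpha>, j))\<bar> * \<rho> ^ mdeg (m (snd (\<alpha>, j)))) has_sum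
        infsum (\<lambda>j. \<bar>a j\<bar>) (F \<alpha>) * \<rho> ^ mdeg \<alpha>) (F \<alpha>)"
      using has_sum_cmult_left[OF has_sum_infsum[OF abs_F[of \<alpha>]], of "\<rho> ^ mdeg \<alpha>"] F
      by (simp cong: has_sum_cong)
  qed
  have sm: "(\<lambda>\<alpha>. \<bar>c \<alpha>\<bar> * \<rho> ^ mdeg \<alpha>) summable_on multi_indices"
    by (rule summable_on_comparison_test[OF has_sum_imp_summable[OF *]])
      (use \<rho> c_le in \<open>auto intro!: mult_right_mono\<close>)
  have le: "infsum (\<lambda>\<alpha>. \<bar>c \<alpha>\<bar> * \<rho> ^ mdeg \<alpha>) multi_indices \<le> N"
    by (rule has_sum_mono[OF has_sum_infsum[OF sm] *]) (use \<rho> c_le in \<open>auto intro!: mult_right_mono\<close>)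
  from \<rho> sm le show ?thesis
  proof (rule cube_seriesI)
    fix h :: 'a assume h: "\<forall>b\<in>Basis. \<bar>h \<bullet> b\<bar> \<le> \<rho>"
    have "((\<lambda>p. a (snd p) * monomial h (m (snd p))) has_sum f h) (Sigma multi_indices F)"
      using has_sum_reindex_bij_betw[OF bij, of "\<lambda>j. a j * monomial h (m j)"] f[of h] h by simp
    then show "((\<lambda>\<alpha>. c \<alpha> * monomial h \<alpha>) has_sum f h) multi_indices"
    proof (rule has_sum_Sigma')
      fix \<alpha> :: "'a \<Rightarrow> nat"
      show "((\<lambda>j. a (snd (\<alpha>, j)) * monomial h (m (snd (\<alpha>, j)))) has_sum c \<alpha> * monomial h \<alpha>) (F \<alpha>)"
        using has_sum_cmult_left[OF c[of \<alpha>], of "monomial h \<alpha>"] F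
        by (simp cong: has_sum_cong)
    qed
  qed
qed

lemma cube_series_mono: "cube_series \<rho> N f \<Longrightarrow> N \<le> N' \<Longrightarrow> cube_series \<rho> N' f"
  unfolding cube_series_def using order_trans by blast

lemma cube_series_nonneg: "cube_series \<rho> N f \<Longrightarrow> 0 \<le> N"
  unfolding cube_series_def cube_coeffs_def
  by (smt (verit) has_sum_nonneg abs_ge_zero mult_nonneg_nonneg zero_le_power)

lemma cube_series_const:
  assumes "\<rho> > 0"
  shows "cube_series \<rho> \<bar>k\<bar> (\<lambda>h::'a::euclidean_space. k)"
  by (rule cube_series_regroup[where J = "{()}" and a = "\<lambda>_. k" and m = "\<lambda>_. \<lambda>b\<in>Basis. 0"])
    (auto simp: assms mdeg_def monomial_def intro!: has_sum_finiteI)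

lemma cube_series_coordinate:
  assumes "\<rho> > 0" "b \<in> Basis"
  shows "cube_series \<rho> \<rho> (\<lambda>h::'a::euclidean_space. h \<bullet> b)"
proof (rule cube_series_regroup[where J = "{()}" and a = "\<lambda>_. 1"
      and m = "\<lambda>_. \<lambda>b'\<in>Basis. if b' = b then 1 else 0"])
  have "mdeg (\<lambda>b'\<in>Basis. if b' = b then 1 else 0) = 1"
    using assms by (simp add: mdeg_def)
  then show "((\<lambda>j. \<bar>1\<bar> * \<rho> ^ mdeg (\<lambda>b'\<in>Basis. if b' = b then 1 else 0)) has_sum \<rho>) {()}"
    by (intro has_sum_finiteI) auto
  have "monomial h (\<lambda>b'\<in>Basis. if b' = b then 1 else 0) = h \<bullet> b" for h
  proof -
    have "monomial h (\<lambda>b'\<in>Basis. if b' = b then 1 else 0) = (\<Prod>b'\<in>Basis. if b' = b then h \<bullet> b else 1)"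
      unfolding monomial_def by (rule prod.cong) auto
    then show ?thesis using assms by simp
  qed
  then show "((\<lambda>j. 1 * monomial h (\<lambda>b'\<in>Basis. if b' = b then 1 else 0)) has_sum h \<bullet> b) {()}" for h
    by (intro has_sum_finiteI) auto
qed (use assms in auto)

lemma cube_series_add:
  assumes f: "cube_series \<rho> N f" and g: "cube_series \<rho> N' g"
  shows "cube_series \<rho> (N + N') (\<lambda>h. f h + g h)"
proof -
  obtain c M where \<rho>: "\<rho> > 0" and c1: "M \<le> N" and c2: "cube_coeffs \<rho> M f c"
    using f by (rule cube_seriesE)
  note c = c1 cube_coeffsD[OF c2]
  obtain e M' where e1: "M' \<le> N'" and e2: "cube_coeffs \<rho> M' g e"
    using g by (rule cube_seriesE)
  note e = e1 cube_coeffsD[OF e2]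
  note s = has_sum_add[OF c(2) e(2)]
  have le: "\<bar>c \<alpha> + e \<alpha>\<bar> * \<rho> ^ mdeg \<alpha> \<le> \<bar>c \<alpha>\<bar> * \<rho> ^ mdeg \<alpha> + \<bar>e \<alpha>\<bar> * \<rho> ^ mdeg \<alpha>" for \<alpha>
    using \<rho> by (simp add: abs_triangle_ineq mult_right_mono flip: distrib_right)
  have sm: "(\<lambda>\<alpha>. \<bar>c \<alpha> + e \<alpha>\<bar> * \<rho> ^ mdeg \<alpha>) summable_on multi_indices"
    by (rule summable_on_comparison_test[OF has_sum_imp_summable[OF s]]) (use \<rho> le in auto)
  have "infsum (\<lambda>\<alpha>. \<bar>c \<alpha> + e \<alpha>\<bar> * \<rho> ^ mdeg \<alpha>) multi_indices \<le> M + M'"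
    by (rule has_sum_mono[OF has_sum_infsum[OF sm] s]) (use le in auto)
  then have "infsum (\<lambda>\<alpha>. \<bar>c \<alpha> + e \<alpha>\<bar> * \<rho> ^ mdeg \<alpha>) multi_indices \<le> N + N'"
    using c(1) e(1) by linarith
  with \<rho> sm show ?thesis
  proof (rule cube_seriesI)
    show "((\<lambda>\<alpha>. (c \<alpha> + e \<alpha>) * monomial h \<alpha>) has_sum f h + g h) multi_indices"
      if "\<forall>b\<in>Basis. \<bar>h \<bullet> b\<bar> \<le> \<rho>" for h
      using has_sum_add[OF c(3)[OF that] e(3)[OF that]] by (simp add: distrib_right)
  qed
qed

text \<open>The Cauchy product: adding exponents adds degrees, so the weighted norm is
  submultiplicative.\<close>

lemma cube_series_mult:
  fixes f g :: "'a::euclidean_space \<Rightarrow> real"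
  assumes f: "cube_series \<rho> N f" and g: "cube_series \<rho> N' g"
  shows "cube_series \<rho> (N * N') (\<lambda>h. f h * g h)"
proof -
  obtain c M where \<rho>: "\<rho> > 0" and c1: "M \<le> N" and c2: "cube_coeffs \<rho> M f c"
    using f by (rule cube_seriesE)
  note c = c1 cube_coeffsD[OF c2]
  obtain e M' where e1: "M' \<le> N'" and e2: "cube_coeffs \<rho> M' g e"
    using g by (rule cube_seriesE)
  note e = e1 cube_coeffsD[OF e2]
  have M: "0 \<le> M" "0 \<le> M'"
    using has_sum_nonneg[OF c(2)] has_sum_nonneg[OF e(2)] \<rho> by auto
  define m :: "('a \<Rightarrow> nat) \<times> ('a \<Rightarrow> nat) \<Rightarrow> 'a \<Rightarrow> nat"
    where "m = (\<lambda>(\<alpha>, \<beta>). \<lambda>b\<in>Basis. \<alpha> b + \<beta> b)"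
  have mdeg_m: "mdeg (m (\<alpha>, \<beta>)) = mdeg \<alpha> + mdeg \<beta>" for \<alpha> \<beta>
    by (simp add: m_def mdeg_def sum.distrib)
  have monomial_m: "monomial h (m (\<alpha>, \<beta>)) = monomial h \<alpha> * monomial h \<beta>" for h \<alpha> \<beta>
    by (simp add: m_def monomial_def prod.distrib power_add)
  have "cube_series \<rho> (M * M') (\<lambda>h. f h * g h)"
  proof (rule cube_series_regroup[where J = "multi_indices \<times> multi_indices" and m = m
        and a = "\<lambda>(\<alpha>, \<beta>). c \<alpha> * e \<beta>"])
    show "((\<lambda>j. \<bar>case j of (\<alpha>, \<beta>) \<Rightarrow> c \<alpha> * e \<beta>\<bar> * \<rho> ^ mdeg (m j)) has_sum M * M')
        (multi_indices \<times> multi_indices)"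
      using has_sum_product[OF c(2) e(2)]
      by (rule has_sum_transfer)
        (auto simp: abs_mult mdeg_m power_add)
    show "((\<lambda>j. (case j of (\<alpha>, \<beta>) \<Rightarrow> c \<alpha> * e \<beta>) * monomial h (m j)) has_sum f h * g h)
        (multi_indices \<times> multi_indices)" if "\<And>b. b \<in> Basis \<Longrightarrow> \<bar>h \<bullet> b\<bar> \<le> \<rho>" for h
    proof (rule has_sum_transfer[OF has_sum_product[OF c(3) e(3)]])
      show "\<forall>b\<in>Basis. \<bar>h \<bullet> b\<bar> \<le> \<rho>" "\<forall>b\<in>Basis. \<bar>h \<bullet> b\<bar> \<le> \<rho>"
        using that by auto
    qed (auto simp: monomial_m)
  qed (auto simp: \<rho> m_def)
  moreover have "M * M' \<le> N * N'"
    using c(1) e(1) M by (intro mult_mono) auto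
  ultimately show ?thesis by (rule cube_series_mono)
qed

text \<open>Completeness of the algebra: a series whose norms are summable is one absolutely
  convergent family, indexed by the number of the term and the exponent.\<close>

lemma cube_series_suminf:
  fixes f :: "nat \<Rightarrow> 'a::euclidean_space \<Rightarrow> real"
  assumes f: "\<And>k. cube_series \<rho> (N k) (f k)" and N: "summable N"
  shows "cube_series \<rho> (suminf N) (\<lambda>h. \<Sum>k. f k h)"
proof -
  have "\<exists>c M. M \<le> N k \<and> cube_coeffs \<rho> M (f k) c" for k
    using f[of k] unfolding cube_series_def by blast
  then obtain c M where M: "\<And>k. M k \<le> N k" and cM: "\<And>k. cube_coeffs \<rho> (M k) (f k) (c k)"
    by metis
  note c = cube_coeffsD(1)[OF cM] and fc = cube_coeffsD(2)[OF cM]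
  have \<rho>: "\<rho> > 0" using f by (simp add: cube_series_def)
  have M0: "0 \<le> M k" for k
    using has_sum_nonneg[OF c[of k]] \<rho> by auto
  have sM: "summable M"
    by (rule summable_comparison_test'[OF N, of 0]) (use M M0 in auto)
  have hM: "(M has_sum suminf M) UNIV"
    using M0 sM by (intro norm_summable_imp_has_sum) (auto simp: summable_sums)
  have abs_sum: "((\<lambda>(k, \<alpha>). \<bar>c k \<alpha>\<bar> * \<rho> ^ mdeg \<alpha>) has_sum suminf M) (UNIV \<times> multi_indices)"
    using c \<rho> by (intro has_sum_SigmaI[OF _ hM] summable_on_SigmaI[OF _ has_sum_imp_summable[OF hM]]) auto
  have "cube_series \<rho> (suminf M) (\<lambda>h. \<Sum>k. f k h)"
  proof (rule cube_series_regroup[where J = "UNIV \<times> multi_indices" and m = snd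
        and a = "\<lambda>(k, \<alpha>). c k \<alpha>"])
    show "((\<lambda>j. \<bar>case j of (k, \<alpha>) \<Rightarrow> c k \<alpha>\<bar> * \<rho> ^ mdeg (snd j)) has_sum suminf M) (UNIV \<times> multi_indices)"
      using abs_sum by (simp add: case_prod_unfold)
    fix h :: 'a assume h: "\<And>b. b \<in> Basis \<Longrightarrow> \<bar>h \<bullet> b\<bar> \<le> \<rho>"
    have fch: "((\<lambda>\<alpha>. c k \<alpha> * monomial h \<alpha>) has_sum f k h) multi_indices" for k
      by (rule fc) (use h in blast)
    have "(\<lambda>j. norm ((case j of (k, \<alpha>) \<Rightarrow> c k \<alpha>) * monomial h (snd j))) summable_on (UNIV \<times> multi_indices)"
      by (rule Infinite_Sum.abs_summable_on_comparison_test'[OF has_sum_imp_summable[OF abs_sum]])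
        (auto simp: abs_mult intro!: mult_left_mono abs_monomial_le h)
    then have sm: "(\<lambda>j. (case j of (k, \<alpha>) \<Rightarrow> c k \<alpha>) * monomial h (snd j)) summable_on (UNIV \<times> multi_indices)"
      using summable_on_iff_abs_summable_on_real by blast
    have inf: "((\<lambda>k. f k h) has_sum infsum (\<lambda>j. (case j of (k, \<alpha>) \<Rightarrow> c k \<alpha>) * monomial h (snd j)) (UNIV \<times> multi_indices)) UNIV"
      by (rule has_sum_Sigma'[OF has_sum_infsum[OF sm]]) (simp add: fch)
    have "((\<lambda>k. f k h) has_sum (\<Sum>k. f k h)) UNIV"
      using inf by (simp flip: sums_unique[OF has_sum_imp_sums[OF inf]])
    then show "((\<lambda>j. (case j of (k, \<alpha>) \<Rightarrow> c k \<alpha>) * monomial h (snd j)) has_sum (\<Sum>k. f k h)) (UNIV \<times> multi_indices)"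
      by (intro has_sum_SigmaI[OF _ _ sm]) (simp_all add: fch)
  qed (auto simp: \<rho>)
  moreover have "suminf M \<le> suminf N"
    by (rule suminf_le[OF M sM N])
  ultimately show ?thesis by (rule cube_series_mono)
qed

lemma cube_series_power:
  assumes "cube_series \<rho> N f"
  shows "cube_series \<rho> (N ^ k) (\<lambda>h. f h ^ k)"
proof (induction k)
  case 0
  then show ?case using cube_series_const[of \<rho> 1] assms by (simp add: cube_series_def)
next
  case (Suc k)
  then show ?case using cube_series_mult[OF assms Suc] by simp
qed

lemma cube_series_shrink:
  assumes f: "cube_series \<rho> N f" and \<rho>': "0 < \<rho>'" "\<rho>' \<le> \<rho>"
  shows "cube_series \<rho>' N f"
proof -
  obtain c M where \<rho>: "\<rho> > 0" and c1: "M \<le> N" and c2: "cube_coeffs \<rho> M f c"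
    using f by (rule cube_seriesE)
  note c = c1 cube_coeffsD[OF c2]
  have le: "\<bar>c \<alpha>\<bar> * \<rho>' ^ mdeg \<alpha> \<le> \<bar>c \<alpha>\<bar> * \<rho> ^ mdeg \<alpha>" for \<alpha>
    using \<rho>' by (intro mult_left_mono power_mono) auto
  have sm: "(\<lambda>\<alpha>. \<bar>c \<alpha>\<bar> * \<rho>' ^ mdeg \<alpha>) summable_on multi_indices"
    by (rule summable_on_comparison_test[OF has_sum_imp_summable[OF c(2)]]) (use \<rho>' le in auto)
  have "infsum (\<lambda>\<alpha>. \<bar>c \<alpha>\<bar> * \<rho>' ^ mdeg \<alpha>) multi_indices \<le> M"
    by (rule has_sum_mono[OF has_sum_infsum[OF sm] c(2)]) (use le in auto)
  then have "infsum (\<lambda>\<alpha>. \<bar>c \<alpha>\<bar> * \<rho>' ^ mdeg \<alpha>) multi_indices \<le> N"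
    using c(1) by linarith
  with \<rho>'(1) sm show ?thesis
    by (rule cube_seriesI) (use c(3) \<rho>'(2) in \<open>meson order_trans\<close>)
qed

text \<open>With no constant term every exponent that occurs has degree at least one, so passing to
  the smaller cube gains a factor \<open>\<rho>' / \<rho>\<close>. This is what makes a norm small
  enough for the binomial series.\<close>

lemma cube_series_shrink_vanishing:
  fixes f :: "'a::euclidean_space \<Rightarrow> real"
  assumes f: "cube_series \<rho> N f" and f0: "f 0 = 0" and \<rho>': "0 < \<rho>'" "\<rho>' \<le> \<rho>"
  shows "cube_series \<rho>' (N * (\<rho>' / \<rho>)) f"
proof -
  obtain c M where \<rho>: "\<rho> > 0" and c1: "M \<le> N" and c2: "cube_coeffs \<rho> M f c"
    using f by (rule cube_seriesE)
  note c = c1 cube_coeffsD[OF c2]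
  define z :: "'a \<Rightarrow> nat" where "z = (\<lambda>b\<in>Basis. 0)"
  have z: "z \<in> multi_indices" by (auto simp: z_def)
  have deg_pos: "mdeg \<alpha> > 0" if "\<alpha> \<in> multi_indices" "\<alpha> \<noteq> z" for \<alpha>
  proof (rule ccontr)
    assume "\<not> mdeg \<alpha> > 0"
    then have "\<alpha> b = 0" if "b \<in> Basis" for b
      using that by (simp add: mdeg_def)
    then have "\<alpha> = z"
      using that(1) by (intro ext) (auto simp: z_def PiE_def extensional_def)
    then show False using that by simp
  qed
  have mono0: "monomial 0 \<alpha> = 0" if "\<alpha> \<in> multi_indices" "\<alpha> \<noteq> z" for \<alpha> :: "'a \<Rightarrow> nat"
  proof -
    have "\<exists>b\<in>Basis. \<alpha> b \<noteq> 0"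
      using deg_pos[OF that] unfolding mdeg_def by (metis gr_implies_not0 sum.neutral)
    then show ?thesis by (auto simp: monomial_def)
  qed
  \<comment> \<open>At the origin only the constant monomial survives (\<open>0 ^ 0 = 1\<close>), so
    its coefficient is the value \<open>f 0\<close>.\<close>
  have "((\<lambda>\<alpha>. c \<alpha> * monomial 0 \<alpha>) has_sum c z) multi_indices"
  proof (rule has_sum_finite_neutralI[of "{z}"])
    show "c z = (\<Sum>\<alpha>\<in>{z}. c \<alpha> * monomial 0 \<alpha>)"
      by (simp add: monomial_def z_def)
  qed (use z mono0 in auto)
  then have cz: "c z = 0"
    using c(3)[of 0] f0 \<rho> has_sum_unique by fastforce
  have le: "\<bar>c \<alpha>\<bar> * \<rho>' ^ mdeg \<alpha> \<le> \<bar>c \<alpha>\<bar> * \<rho> ^ mdeg \<alpha> * (\<rho>' / \<rho>)"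
    if \<alpha>: "\<alpha> \<in> multi_indices" for \<alpha>
  proof (cases "\<alpha> = z")
    case True
    then show ?thesis using cz by simp
  next
    case False
    then obtain k where k: "mdeg \<alpha> = Suc k"
      using deg_pos[OF \<alpha> False] gr0_implies_Suc by blast
    have "\<rho>' ^ mdeg \<alpha> = \<rho>' * \<rho>' ^ k"
      by (simp add: k)
    also have "\<dots> \<le> \<rho>' * \<rho> ^ k"
      using \<rho>' by (intro mult_left_mono power_mono) auto
    also have "\<dots> = \<rho> ^ mdeg \<alpha> * (\<rho>' / \<rho>)"
      using \<rho> by (simp add: k)
    finally have "\<rho>' ^ mdeg \<alpha> \<le> \<rho> ^ mdeg \<alpha> * (\<rho>' / \<rho>)" .
    then show ?thesis
      unfolding mult.assoc by (rule mult_left_mono) simp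
  qed
  note s = has_sum_cmult_left[OF c(2), of "\<rho>' / \<rho>"]
  have sm: "(\<lambda>\<alpha>. \<bar>c \<alpha>\<bar> * \<rho>' ^ mdeg \<alpha>) summable_on multi_indices"
    by (rule summable_on_comparison_test[OF has_sum_imp_summable[OF s] le]) (use \<rho>' in auto)
  have "infsum (\<lambda>\<alpha>. \<bar>c \<alpha>\<bar> * \<rho>' ^ mdeg \<alpha>) multi_indices \<le> M * (\<rho>' / \<rho>)"
    by (rule has_sum_mono[OF has_sum_infsum[OF sm] s le])
  also have "\<dots> \<le> N * (\<rho>' / \<rho>)"
    using c(1) \<rho> \<rho>' by (intro mult_right_mono) auto
  finally show ?thesis
    by (rule cube_seriesI[OF \<rho>'(1) sm]) (use c(3) \<rho>'(2) in \<open>meson order_trans\<close>)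
qed

lemma cube_series_cong:
  assumes f: "cube_series \<rho> N f" and eq: "\<And>h. (\<And>b. b \<in> Basis \<Longrightarrow> \<bar>h \<bullet> b\<bar> \<le> \<rho>) \<Longrightarrow> f h = g h"
  shows "cube_series \<rho> N g"
proof -
  have "((\<lambda>\<alpha>. c \<alpha> * monomial h \<alpha>) has_sum g h) multi_indices"
    if "((\<lambda>\<alpha>. c \<alpha> * monomial h \<alpha>) has_sum f h) multi_indices" "\<forall>b\<in>Basis. \<bar>h \<bullet> b\<bar> \<le> \<rho>" for h c
    using that eq[of h] by simp
  then show ?thesis
    using f unfolding cube_series_def cube_coeffs_def by blast
qed

lemma cube_series_bound:
  assumes f: "cube_series \<rho> N f" and h: "\<And>b. b \<in> Basis \<Longrightarrow> \<bar>h \<bullet> b\<bar> \<le> \<rho>"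
  shows "\<bar>f h\<bar> \<le> N"
proof -
  obtain c M where \<rho>: "\<rho> > 0" and c1: "M \<le> N" and c2: "cube_coeffs \<rho> M f c"
    using f by (rule cube_seriesE)
  note c = c1 cube_coeffsD[OF c2]
  have fh: "((\<lambda>\<alpha>. c \<alpha> * monomial h \<alpha>) has_sum f h) multi_indices"
    using c(3) h by blast
  have le: "\<bar>c \<alpha> * monomial h \<alpha>\<bar> \<le> \<bar>c \<alpha>\<bar> * \<rho> ^ mdeg \<alpha>" for \<alpha>
    by (simp add: abs_mult mult_left_mono abs_monomial_le h)
  have "f h \<le> M"
    by (rule has_sum_mono[OF fh c(2)]) (use le abs_le_D1 in blast)
  moreover have "- f h \<le> M"
    by (rule has_sum_mono[OF has_sum_uminusI[OF fh] c(2)]) (use le abs_le_D2 in blast)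
  ultimately show ?thesis using c(1) by linarith
qed

text \<open>The binomial series applied inside the algebra: it converges in norm because the bound
  \<open>N < 1\<close> lies inside the disc of convergence of the scalar series.\<close>

lemma cube_series_powr:
  assumes w: "cube_series \<rho> N w" and N: "N < 1"
  shows "\<exists>N'. cube_series \<rho> N' (\<lambda>h. (1 + w h) powr p)"
proof -
  have N0: "0 \<le> N" using cube_series_nonneg[OF w] .
  have \<rho>: "\<rho> > 0" using w by (simp add: cube_series_def)
  have "ereal (norm N) < conv_radius (\<lambda>n. p gchoose n)"
    using N N0 by (simp add: conv_radius_gchoose)
  then have sm: "summable (\<lambda>n. norm ((p gchoose n) * N ^ n))"
    by (rule abs_summable_in_conv_radius)
  have "cube_series \<rho> (\<bar>p gchoose n\<bar> * N ^ n) (\<lambda>h. (p gchoose n) * w h ^ n)" for n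
    using cube_series_mult[OF cube_series_const cube_series_power[OF w]] \<rho> by blast
  moreover have "summable (\<lambda>n. \<bar>p gchoose n\<bar> * N ^ n)"
    using sm N0 by (simp add: abs_mult)
  ultimately have "cube_series \<rho> (\<Sum>n. \<bar>p gchoose n\<bar> * N ^ n) (\<lambda>h. \<Sum>n. (p gchoose n) * w h ^ n)"
    by (rule cube_series_suminf)
  then have "cube_series \<rho> (\<Sum>n. \<bar>p gchoose n\<bar> * N ^ n) (\<lambda>h. (1 + w h) powr p)"
  proof (rule cube_series_cong)
    fix h :: 'a assume "\<And>b. b \<in> Basis \<Longrightarrow> \<bar>h \<bullet> b\<bar> \<le> \<rho>"
    \<comment> \<open>The norm dominates each value on the cube, so the scalar binomial theorem
      identifies the sum pointwise.\<close>
    then have "\<bar>w h\<bar> < 1" using cube_series_bound[OF w] N by (meson le_less_trans)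
    then show "(\<Sum>n. (p gchoose n) * w h ^ n) = (1 + w h) powr p"
      using gen_binomial_real sums_unique by metis
  qed
  then show ?thesis by blast
qed

section \<open>Germs of real analytic functions\<close>

definition analytic_germ :: "('a::euclidean_space \<Rightarrow> real) \<Rightarrow> 'a \<Rightarrow> bool" where
  "analytic_germ f a \<longleftrightarrow> (\<exists>\<rho> N. cube_series \<rho> N (\<lambda>h. f (a + h)))"

lemma analytic_germI: "cube_series \<rho> N (\<lambda>h. f (a + h)) \<Longrightarrow> analytic_germ f a"
  unfolding analytic_germ_def by (intro exI)

lemma analytic_germ_const: "analytic_germ (\<lambda>_. k) a"
  by (rule analytic_germI, rule cube_series_const, rule zero_less_one)

lemma analytic_germ_join:
  assumes "analytic_germ f a" "analytic_germ g a"
  obtains \<rho> N N' where "cube_series \<rho> N (\<lambda>h. f (a + h))" "cube_series \<rho> N' (\<lambda>h. g (a + h))"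
proof -
  obtain r N s N' where f: "cube_series r N (\<lambda>h. f (a + h))" and g: "cube_series s N' (\<lambda>h. g (a + h))"
    using assms unfolding analytic_germ_def by blast
  then have "r > 0" "s > 0" by (auto simp: cube_series_def)
  then have "cube_series (min r s) N (\<lambda>h. f (a + h))" "cube_series (min r s) N' (\<lambda>h. g (a + h))"
    by (auto intro: cube_series_shrink[OF f] cube_series_shrink[OF g])
  then show thesis by (rule that)
qed

lemma analytic_germ_add:
  "analytic_germ f a \<Longrightarrow> analytic_germ g a \<Longrightarrow> analytic_germ (\<lambda>x. f x + g x) a"
  by (erule (1) analytic_germ_join) (rule analytic_germI, rule cube_series_add)

lemma analytic_germ_mult:
  "analytic_germ f a \<Longrightarrow> analytic_germ g a \<Longrightarrow> analytic_germ (\<lambda>x. f x * g x) a"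
  by (erule (1) analytic_germ_join) (rule analytic_germI, rule cube_series_mult)

lemma analytic_germ_sum:
  "finite A \<Longrightarrow> (\<And>i. i \<in> A \<Longrightarrow> analytic_germ (f i) a) \<Longrightarrow> analytic_germ (\<lambda>x. \<Sum>i\<in>A. f i x) a"
  by (induction rule: finite_induct) (auto intro: analytic_germ_const analytic_germ_add)

lemma analytic_germ_inner: "analytic_germ (\<lambda>x. x \<bullet> v) a"
proof -
  have "analytic_germ (\<lambda>x. x \<bullet> b) a" if "b \<in> Basis" for b
  proof -
    have "cube_series 1 (\<bar>a \<bullet> b\<bar> + 1) (\<lambda>h. a \<bullet> b + h \<bullet> b)"
      by (intro cube_series_add cube_series_const cube_series_coordinate that) auto
    then show ?thesis by (intro analytic_germI) (simp add: inner_add_left)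
  qed
  then have "analytic_germ (\<lambda>x. \<Sum>b\<in>Basis. (x \<bullet> b) * (v \<bullet> b)) a"
    by (intro analytic_germ_sum analytic_germ_mult analytic_germ_const) auto
  then show ?thesis by (simp flip: euclidean_inner)
qed

text \<open>Write \<open>f = f a * (1 + w)\<close> with \<open>w\<close> vanishing at
  \<open>a\<close>, and shrink the cube until the norm of \<open>w\<close> is below one.\<close>

lemma analytic_germ_powr:
  assumes f: "analytic_germ f a" and pos: "f a > 0"
  shows "analytic_germ (\<lambda>x. f x powr p) a"
proof -
  have "analytic_germ (\<lambda>x. f x * (1 / f a) + (- 1)) a"
    by (intro analytic_germ_add analytic_germ_mult f analytic_germ_const)
  then obtain r N where w: "cube_series r N (\<lambda>h. f (a + h) * (1 / f a) + (- 1))"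
    unfolding analytic_germ_def by blast
  have r: "r > 0" and N: "0 \<le> N"
    using w cube_series_nonneg[OF w] by (auto simp: cube_series_def)
  \<comment> \<open>The new norm bound of \<open>w\<close> is
    \<open>N * (s / r) = N / (N + 2)\<close>, below one.\<close>
  define s where "s = r / (N + 2)"
  have s: "0 < s" "s \<le> r" "N * (s / r) < 1"
  proof -
    show "0 < s" "s \<le> r" using r N by (auto simp: s_def field_simps)
    have "s / r = 1 / (N + 2)" using r by (simp add: s_def)
    then show "N * (s / r) < 1" using N by simp
  qed
  have w': "cube_series s (N * (s / r)) (\<lambda>h. f (a + h) * (1 / f a) + (- 1))"
    by (rule cube_series_shrink_vanishing[OF w _ s(1,2)]) (use pos in simp)
  obtain N' where "cube_series s N' (\<lambda>h. (1 + (f (a + h) * (1 / f a) + (- 1))) powr p)"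
    using cube_series_powr[OF w' s(3)] by blast
  then have "cube_series s (\<bar>f a powr p\<bar> * N')
      (\<lambda>h. f a powr p * (1 + (f (a + h) * (1 / f a) + (- 1))) powr p)"
    using s(1) by (intro cube_series_mult cube_series_const)
  then have "cube_series s (\<bar>f a powr p\<bar> * N') (\<lambda>h. f (a + h) powr p)"
  proof (rule cube_series_cong)
    fix h :: 'a assume "\<And>b. b \<in> Basis \<Longrightarrow> \<bar>h \<bullet> b\<bar> \<le> s"
    then have "\<bar>f (a + h) * (1 / f a) + (- 1)\<bar> < 1"
      using cube_series_bound[OF w'] s(3) by (meson le_less_trans)
    \<comment> \<open>Positivity of both factors makes \<open>powr\<close> multiplicative.\<close>
    then have "f (a + h) > 0" using pos by (auto simp: abs_if field_simps split: if_splits)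
    then show "f a powr p * (1 + (f (a + h) * (1 / f a) + (- 1))) powr p = f (a + h) powr p"
      using pos by (simp flip: powr_mult)
  qed
  then show ?thesis by (rule analytic_germI)
qed

text \<open>A germ lives on a neighbourhood in the ambient space, so \<open>f\<close> itself serves
  as the extension \<open>h\<close>. The components are assembled into one vector-valued coefficient
  family on the smallest of their radii; a ball lies inside the cube of the same radius.\<close>

lemma real_analytic_onI:
  fixes f :: "'a::euclidean_space \<Rightarrow> 'b::euclidean_space"
  assumes germ: "\<And>a i. a \<in> S \<Longrightarrow> i \<in> Basis \<Longrightarrow> analytic_germ (\<lambda>x. f x \<bullet> i) a"
  shows "real_analytic_on f S"
  unfolding real_analytic_on_def
proof
  fix a assume a: "a \<in> S"
  have "\<exists>r c M. r > 0 \<and> cube_coeffs r M (\<lambda>h. f (a + h) \<bullet> i) c" if "i \<in> Basis" for i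
    using germ[OF a that] unfolding analytic_germ_def cube_series_def by blast
  then obtain r c M where r: "\<And>i. i \<in> Basis \<Longrightarrow> r i > 0"
    and cM: "\<And>i. i \<in> Basis \<Longrightarrow> cube_coeffs (r i) (M i) (\<lambda>h. f (a + h) \<bullet> i) (c i)"
    by metis
  note c = cube_coeffsD(2)[OF cM]
  define \<epsilon> where "\<epsilon> = Min (r ` Basis)"
  have \<epsilon>: "\<epsilon> > 0" "\<And>i. i \<in> Basis \<Longrightarrow> \<epsilon> \<le> r i"
    using r by (auto simp: \<epsilon>_def)
  define C where "C \<alpha> = (\<Sum>i\<in>Basis. c i \<alpha> *\<^sub>R i)" for \<alpha>
  have "((\<lambda>\<alpha>. (\<Prod>b\<in>Basis. ((x - a) \<bullet> b) ^ \<alpha> b) *\<^sub>R C \<alpha>) has_sum f x) multi_indices"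
    if x: "x \<in> ball a \<epsilon>" for x
  proof -
    have "\<bar>(x - a) \<bullet> b\<bar> \<le> \<epsilon>" if "b \<in> Basis" for b
      using x Basis_le_norm[OF that, of "x - a"] by (simp add: dist_norm norm_minus_commute)
    then have "((\<lambda>\<alpha>. c i \<alpha> * monomial (x - a) \<alpha>) has_sum f x \<bullet> i) multi_indices"
      if "i \<in> Basis" for i
      using c[OF that, of "x - a"] \<epsilon>(2)[OF that] order_trans by fastforce
    then have i: "((\<lambda>\<alpha>. (c i \<alpha> * monomial (x - a) \<alpha>) *\<^sub>R i) has_sum (f x \<bullet> i) *\<^sub>R i) multi_indices"
      if "i \<in> Basis" for i
      using has_sum_bounded_linear[OF bounded_linear_scaleR_left] that by blast
    have "((\<lambda>\<alpha>. \<Sum>i\<in>B. (c i \<alpha> * monomial (x - a) \<alpha>) *\<^sub>R i) has_sum (\<Sum>i\<in>B. (f x \<bullet> i) *\<^sub>R i)) multi_indices"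
      if "finite B" "B \<subseteq> Basis" for B
      using that by (induction rule: finite_induct) (auto intro!: has_sum_add i)
    from this[of Basis] show ?thesis
      by (simp add: C_def scaleR_sum_right euclidean_representation monomial_def mult.commute)
  qed
  then show "\<exists>\<epsilon>>0. \<exists>c h. (\<forall>x\<in>ball a \<epsilon>. ((\<lambda>\<alpha>. (\<Prod>b\<in>Basis. ((x - a) \<bullet> b) ^ \<alpha> b) *\<^sub>R c \<alpha>) has_sum h x) multi_indices) \<and>
      (\<forall>x\<in>S \<inter> ball a \<epsilon>. f x = h x)"
    using \<epsilon>(1) by blast
qed

lemma real_analytic_on_cong:
  assumes "\<And>x. x \<in> S \<Longrightarrow> f x = g x" "real_analytic_on f S"
  shows "real_analytic_on g S"
  unfolding real_analytic_on_def
proof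
  fix a assume "a \<in> S"
  then obtain \<epsilon> c h where "\<epsilon> > 0"
    "\<forall>x\<in>ball a \<epsilon>. ((\<lambda>\<alpha>. (\<Prod>b\<in>Basis. ((x - a) \<bullet> b) ^ \<alpha> b) *\<^sub>R c \<alpha>) has_sum h x) multi_indices"
    "\<forall>x\<in>S \<inter> ball a \<epsilon>. f x = h x"
    using assms(2) unfolding real_analytic_on_def by blast
  moreover from this(3) have "\<forall>x\<in>S \<inter> ball a \<epsilon>. g x = h x"
    using assms(1) by simp
  ultimately show "\<exists>\<epsilon>>0. \<exists>c h.
      (\<forall>x\<in>ball a \<epsilon>. ((\<lambda>\<alpha>. (\<Prod>b\<in>Basis. ((x - a) \<bullet> b) ^ \<alpha> b) *\<^sub>R c \<alpha>) has_sum h x) multi_indices) \<and>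
      (\<forall>x\<in>S \<inter> ball a \<epsilon>. g x = h x)"
    by blast
qed

subsection \<open>Homogeneous expansions\<close>

text \<open>The Taylor series sorted by degree, with the derivative of each homogeneous polynomial
  and majorants valid at all points carried along: an estimate of order \<open>m\<close> is needed
  for \<open>f\<close> and, with order \<open>m - 1\<close>, for its derivative.\<close>

definition homogeneous_expansion ::
  "('a::euclidean_space \<Rightarrow> real) \<Rightarrow> 'a \<Rightarrow> (nat \<Rightarrow> 'a \<Rightarrow> real) \<Rightarrow> (nat \<Rightarrow> 'a \<Rightarrow> 'a \<Rightarrow> real) \<Rightarrow>
   (nat \<Rightarrow> real) \<Rightarrow> real \<Rightarrow> bool" where
  "homogeneous_expansion f a P P' A \<rho> \<longleftrightarrow>
     \<rho> > 0 \<and> summable (\<lambda>k. A k * \<rho> ^ k) \<and> (\<forall>k. 0 \<le> A k) \<and>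
     (\<forall>k h. (P k has_derivative P' k h) (at h)) \<and>
     (\<forall>k v. continuous_on UNIV (\<lambda>h. P' k h v)) \<and>
     (\<forall>k t h. P k (t *\<^sub>R h) = t ^ k * P k h) \<and>
     (\<forall>k h. \<bar>P k h\<bar> \<le> A k * norm h ^ k) \<and>
     (\<forall>k h v. \<bar>P' k h v\<bar> \<le> real k * A k * norm h ^ (k - 1) * norm v) \<and>
     (\<forall>h. norm h < \<rho> \<longrightarrow> (\<lambda>k. P k h) sums f (a + h))"

definition monomial_deriv :: "'a::euclidean_space \<Rightarrow> ('a \<Rightarrow> nat) \<Rightarrow> 'a \<Rightarrow> real" where
  "monomial_deriv h \<alpha> v =
     (\<Sum>b\<in>Basis. (v \<bullet> b) * (real (\<alpha> b) * (h \<bullet> b) ^ (\<alpha> b - 1)) * (\<Prod>b'\<in>Basis - {b}. (h \<bullet> b') ^ \<alpha> b'))"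

lemma monomial_has_derivative:
  "((\<lambda>h. monomial h \<alpha>) has_derivative monomial_deriv h \<alpha>) (at h)"
proof -
  have "((\<lambda>h. \<Prod>b\<in>Basis. (h \<bullet> b) ^ \<alpha> b) has_derivative
      (\<lambda>v. \<Sum>b\<in>Basis. real (\<alpha> b) * (v \<bullet> b) * (h \<bullet> b) ^ (\<alpha> b - 1) * (\<Prod>b'\<in>Basis - {b}. (h \<bullet> b') ^ \<alpha> b'))) (at h)"
    by (rule has_derivative_prod) (auto intro!: derivative_eq_intros)
  then show ?thesis
    by (simp add: monomial_def[abs_def] monomial_deriv_def[abs_def] mult_ac)
qed

lemma abs_monomial_deriv_le:
  "\<bar>monomial_deriv h \<alpha> v\<bar> \<le> real (mdeg \<alpha>) * norm h ^ (mdeg \<alpha> - 1) * norm v"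
proof -
  have "\<bar>(v \<bullet> b) * (real (\<alpha> b) * (h \<bullet> b) ^ (\<alpha> b - 1)) * (\<Prod>b'\<in>Basis - {b}. (h \<bullet> b') ^ \<alpha> b')\<bar>
      \<le> real (\<alpha> b) * norm h ^ (mdeg \<alpha> - 1) * norm v" if b: "b \<in> Basis" for b
  \<comment> \<open>If \<open>\<alpha> b = 0\<close> the term vanishes; otherwise
    \<open>\<alpha> b - 1\<close> is a true predecessor and the degrees of the factors add up to
    \<open>mdeg \<alpha> - 1\<close>.\<close>
  proof (cases "\<alpha> b = 0")
    case False
    have deg: "mdeg \<alpha> = \<alpha> b + (\<Sum>b'\<in>Basis - {b}. \<alpha> b')"
      unfolding mdeg_def using b by (simp add: sum.remove)
    have "\<bar>\<Prod>b'\<in>Basis - {b}. (h \<bullet> b') ^ \<alpha> b'\<bar> = (\<Prod>b'\<in>Basis - {b}. \<bar>h \<bullet> b'\<bar> ^ \<alpha> b')"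
      by (simp add: abs_prod power_abs)
    also have "\<dots> \<le> (\<Prod>b'\<in>Basis - {b}. norm h ^ \<alpha> b')"
      by (intro prod_mono) (auto intro!: power_mono Basis_le_norm)
    also have "\<dots> = norm h ^ (\<Sum>b'\<in>Basis - {b}. \<alpha> b')"
      by (simp add: power_sum)
    finally have p: "\<bar>\<Prod>b'\<in>Basis - {b}. (h \<bullet> b') ^ \<alpha> b'\<bar> \<le> norm h ^ (\<Sum>b'\<in>Basis - {b}. \<alpha> b')" .
    have "\<bar>h \<bullet> b\<bar> ^ (\<alpha> b - 1) * \<bar>\<Prod>b'\<in>Basis - {b}. (h \<bullet> b') ^ \<alpha> b'\<bar>
        \<le> norm h ^ (\<alpha> b - 1) * norm h ^ (\<Sum>b'\<in>Basis - {b}. \<alpha> b')"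
      by (intro mult_mono p power_mono Basis_le_norm b) auto
    also have "\<dots> = norm h ^ (mdeg \<alpha> - 1)"
      using False by (simp add: deg flip: power_add)
    finally have "(real (\<alpha> b) * \<bar>v \<bullet> b\<bar>) * (\<bar>h \<bullet> b\<bar> ^ (\<alpha> b - 1) * \<bar>\<Prod>b'\<in>Basis - {b}. (h \<bullet> b') ^ \<alpha> b'\<bar>)
        \<le> (real (\<alpha> b) * norm v) * norm h ^ (mdeg \<alpha> - 1)"
      by (intro mult_mono Basis_le_norm b) auto
    then show ?thesis
      by (simp add: abs_mult power_abs mult_ac)
  qed simp
  then have "\<bar>monomial_deriv h \<alpha> v\<bar> \<le> (\<Sum>b\<in>Basis. real (\<alpha> b) * norm h ^ (mdeg \<alpha> - 1) * norm v)"
    unfolding monomial_deriv_def by (rule sum_abs[THEN order_trans, OF sum_mono])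
  also have "\<dots> = real (mdeg \<alpha>) * norm h ^ (mdeg \<alpha> - 1) * norm v"
    by (simp add: mdeg_def sum_distrib_right)
  finally show ?thesis .
qed

lemma finite_multi_indices_of_degree: "finite {\<alpha> \<in> multi_indices. mdeg \<alpha> = k}"
proof (rule finite_subset)
  show "{\<alpha> \<in> multi_indices. mdeg \<alpha> = k} \<subseteq> Basis \<rightarrow>\<^sub>E {..k}"
    unfolding mdeg_def by (auto simp: PiE_def intro!: member_le_sum)
  show "finite (Basis \<rightarrow>\<^sub>E {..k})"
    by (intro finite_PiE) auto
qed

text \<open>The assumption gives summability at the points of a ball, not a bound on the
  coefficients. At the point whose coordinates all equal \<open>\<rho>\<close> each monomial is
  \<open>\<rho> ^ mdeg \<alpha>\<close>, and there summability of reals is absolute.\<close>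

lemma power_series_imp_homogeneous_expansion:
  fixes f :: "'a::euclidean_space \<Rightarrow> real"
  assumes \<epsilon>: "\<epsilon> > 0"
    and sum: "\<And>x. x \<in> ball a \<epsilon> \<Longrightarrow> ((\<lambda>\<alpha>. monomial (x - a) \<alpha> * c \<alpha>) has_sum f x) multi_indices"
  shows "\<exists>P P' A \<rho>. homogeneous_expansion f a P P' A \<rho>"
proof -
  define D where "D k = {\<alpha> \<in> multi_indices :: ('a \<Rightarrow> nat) set. mdeg \<alpha> = k}" for k
  have fin: "finite (D k)" for k
    unfolding D_def by (rule finite_multi_indices_of_degree)
  have bij: "bij_betw snd (Sigma UNIV D) multi_indices"
    by (auto simp: bij_betw_def inj_on_def D_def image_iff)
  \<comment> \<open>By the triangle inequality the point with all coordinates \<open>\<rho>\<close>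
    has norm at most \<open>\<epsilon> / 2\<close>, inside the ball.\<close>
  define \<rho> where "\<rho> = \<epsilon> / (2 * real DIM('a))"
  have \<rho>: "0 < \<rho>" "\<rho> < \<epsilon>"
    using \<epsilon> DIM_positive[where 'a = 'a] by (simp_all add: \<rho>_def field_simps) (smt (verit) DIM_ge_Suc0 One_nat_def mult_le_cancel_left1 of_nat_1 of_nat_mono)
  define h0 :: 'a where "h0 = (\<Sum>b\<in>Basis. \<rho> *\<^sub>R b)"
  have "norm h0 \<le> (\<Sum>b\<in>(Basis::'a set). \<rho>)"
    unfolding h0_def using \<rho> by (intro sum_norm_le) auto
  also have "\<dots> < \<epsilon>" using \<epsilon> by (simp add: \<rho>_def)
  finally have "a + h0 \<in> ball a \<epsilon>" by (simp add: dist_norm)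
  moreover have "monomial h0 \<alpha> = \<rho> ^ mdeg \<alpha>" for \<alpha>
    by (simp add: monomial_def h0_def mdeg_def power_sum inner_sum_left_Basis)
  ultimately have "(\<lambda>\<alpha>. \<rho> ^ mdeg \<alpha> * c \<alpha>) summable_on multi_indices"
    using has_sum_imp_summable[OF sum[of "a + h0"]] by simp
  then have abs_sm: "(\<lambda>\<alpha>. \<bar>c \<alpha>\<bar> * \<rho> ^ mdeg \<alpha>) summable_on multi_indices"
    using \<rho> summable_on_iff_abs_summable_on_real[of "\<lambda>\<alpha>. \<rho> ^ mdeg \<alpha> * c \<alpha>"]
    by (simp add: abs_mult mult.commute)
  define A where "A k = (\<Sum>\<alpha>\<in>D k. \<bar>c \<alpha>\<bar>)" for k
  define P where "P k h = (\<Sum>\<alpha>\<in>D k. c \<alpha> * monomial h \<alpha>)" for k h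
  define P' where "P' k h v = (\<Sum>\<alpha>\<in>D k. c \<alpha> * monomial_deriv h \<alpha> v)" for k h v
  \<comment> \<open>Summing first over each finite class of equal degree turns a sum over exponents
    into a sum over degrees.\<close>
  have regroup: "(g has_sum s) UNIV"
    if "(F has_sum s) multi_indices" "\<And>k. g k = (\<Sum>\<alpha>\<in>D k. F \<alpha>)" for F :: "('a \<Rightarrow> nat) \<Rightarrow> real" and g s
  proof -
    have "((\<lambda>p. F (snd p)) has_sum s) (Sigma UNIV D)"
      using has_sum_reindex_bij_betw[OF bij, of F] that(1) by simp
    then show ?thesis
      by (rule has_sum_Sigma') (auto intro!: has_sum_finiteI fin simp: that(2))
  qed
  have "((\<lambda>k. A k * \<rho> ^ k) has_sum infsum (\<lambda>\<alpha>. \<bar>c \<alpha>\<bar> * \<rho> ^ mdeg \<alpha>) multi_indices) UNIV"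
    by (rule regroup[OF has_sum_infsum[OF abs_sm]]) (simp add: A_def D_def sum_distrib_right)
  then have A: "summable (\<lambda>k. A k * \<rho> ^ k)"
    using has_sum_imp_sums sums_summable by blast
  have sums: "(\<lambda>k. P k h) sums f (a + h)" if "norm h < \<rho>" for h
  proof -
    have "((\<lambda>\<alpha>. monomial h \<alpha> * c \<alpha>) has_sum f (a + h)) multi_indices"
      using sum[of "a + h"] that \<rho> by (simp add: dist_norm)
    then have "((\<lambda>k. P k h) has_sum f (a + h)) UNIV"
      by (rule regroup) (simp add: P_def mult.commute)
    then show ?thesis by (rule has_sum_imp_sums)
  qed
  have deriv: "(P k has_derivative P' k h) (at h)" for k h
    unfolding P_def[abs_def] P'_def[abs_def]
    by (intro has_derivative_sum has_derivative_mult_right monomial_has_derivative)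
  have cont: "continuous_on UNIV (\<lambda>h. P' k h v)" for k v
    unfolding P'_def monomial_deriv_def by (intro continuous_intros)
  have hom: "P k (t *\<^sub>R h) = t ^ k * P k h" for k t h
  proof -
    have "monomial (t *\<^sub>R h) \<alpha> = t ^ k * monomial h \<alpha>" if "\<alpha> \<in> D k" for \<alpha>
      using that by (auto simp: D_def monomial_def power_mult_distrib prod.distrib mdeg_def power_sum)
    then show ?thesis
      by (simp add: P_def sum_distrib_left mult.left_commute)
  qed
  have P_le: "\<bar>P k h\<bar> \<le> A k * norm h ^ k" for k h
  proof -
    have "\<bar>c \<alpha> * monomial h \<alpha>\<bar> \<le> \<bar>c \<alpha>\<bar> * norm h ^ k" if "\<alpha> \<in> D k" for \<alpha>
      using that abs_monomial_le[of h "norm h" \<alpha>]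
      by (auto simp: abs_mult D_def Basis_le_norm intro!: mult_left_mono)
    then show ?thesis
      unfolding P_def A_def sum_distrib_right by (rule sum_abs[THEN order_trans, OF sum_mono])
  qed
  have P'_le: "\<bar>P' k h v\<bar> \<le> real k * A k * norm h ^ (k - 1) * norm v" for k h v
  proof -
    have "\<bar>c \<alpha> * monomial_deriv h \<alpha> v\<bar> \<le> \<bar>c \<alpha>\<bar> * (real k * norm h ^ (k - 1) * norm v)" if "\<alpha> \<in> D k" for \<alpha>
      using that abs_monomial_deriv_le[of h \<alpha> v]
      by (auto simp: abs_mult D_def intro!: mult_left_mono)
    then have "\<bar>P' k h v\<bar> \<le> (\<Sum>\<alpha>\<in>D k. \<bar>c \<alpha>\<bar> * (real k * norm h ^ (k - 1) * norm v))"
      unfolding P'_def by (rule sum_abs[THEN order_trans, OF sum_mono])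
    then show ?thesis by (simp add: A_def mult_ac flip: sum_distrib_left sum_distrib_right)
  qed
  have "0 \<le> A k" for k by (simp add: A_def sum_nonneg)
  then have "homogeneous_expansion f a P P' A \<rho>"
    unfolding homogeneous_expansion_def using \<rho> A sums deriv cont hom P_le P'_le by blast
  then show ?thesis by blast
qed

lemma real_analytic_on_bounded_linear:
  assumes L: "bounded_linear L" and f: "real_analytic_on f S"
  shows "real_analytic_on (\<lambda>x. L (f x)) S"
  unfolding real_analytic_on_def
proof
  fix a assume "a \<in> S"
  then obtain \<epsilon> c h where \<epsilon>: "\<epsilon> > 0"
    and c: "\<forall>x\<in>ball a \<epsilon>. ((\<lambda>\<alpha>. (\<Prod>b\<in>Basis. ((x - a) \<bullet> b) ^ \<alpha> b) *\<^sub>R c \<alpha>) has_sum h x) multi_indices"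
    and h: "\<forall>x\<in>S \<inter> ball a \<epsilon>. f x = h x"
    using f unfolding real_analytic_on_def by blast
  have "\<forall>x\<in>ball a \<epsilon>. ((\<lambda>\<alpha>. (\<Prod>b\<in>Basis. ((x - a) \<bullet> b) ^ \<alpha> b) *\<^sub>R L (c \<alpha>)) has_sum L (h x)) multi_indices"
    using has_sum_bounded_linear[OF L c[rule_format]] bounded_linear.linear[OF L] by (simp add: linear_scale)
  then show "\<exists>\<epsilon>>0. \<exists>c h.
      (\<forall>x\<in>ball a \<epsilon>. ((\<lambda>\<alpha>. (\<Prod>b\<in>Basis. ((x - a) \<bullet> b) ^ \<alpha> b) *\<^sub>R c \<alpha>) has_sum h x) multi_indices) \<and>
      (\<forall>x\<in>S \<inter> ball a \<epsilon>. L (f x) = h x)"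
    using \<epsilon> h by (intro exI[of _ \<epsilon>] conjI exI[of _ "\<lambda>\<alpha>. L (c \<alpha>)"] exI[of _ "\<lambda>x. L (h x)"]) auto
qed

lemma real_analytic_on_imp_homogeneous_expansion:
  fixes f :: "'a::euclidean_space \<Rightarrow> real"
  assumes f: "real_analytic_on f S" and S: "open S" "a \<in> S"
  shows "\<exists>P P' A \<rho>. homogeneous_expansion f a P P' A \<rho>"
proof -
  obtain \<epsilon> c h where \<epsilon>: "\<epsilon> > 0"
    and c: "\<forall>x\<in>ball a \<epsilon>. ((\<lambda>\<alpha>. (\<Prod>b\<in>Basis. ((x - a) \<bullet> b) ^ \<alpha> b) *\<^sub>R c \<alpha>) has_sum h x) multi_indices"
    and h: "\<forall>x\<in>S \<inter> ball a \<epsilon>. f x = h x"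
    using f S(2) unfolding real_analytic_on_def by blast
  obtain \<delta> where \<delta>: "\<delta> > 0" "ball a \<delta> \<subseteq> S"
    using S open_contains_ball by blast
  have "((\<lambda>\<alpha>. monomial (x - a) \<alpha> * c \<alpha>) has_sum f x) multi_indices" if "x \<in> ball a (min \<delta> \<epsilon>)" for x
  proof -
    have "x \<in> ball a \<epsilon>" "x \<in> S" using that \<delta>(2) by (auto simp: subset_iff)
    then show ?thesis using c h by (simp add: monomial_def)
  qed
  then show ?thesis
    using \<epsilon> \<delta>(1) by (intro power_series_imp_homogeneous_expansion[of "min \<delta> \<epsilon>" a c f]) auto
qed

text \<open>Terms below order \<open>m\<close> vanish, so a power of \<open>norm h\<close> can be
  pulled out of the series and out of its termwise derivative. For \<open>m = 0\<close> truncated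
  subtraction turns the derivative bound into plain boundedness.\<close>

lemma homogeneous_expansion_bounds:
  fixes f :: "'a::euclidean_space \<Rightarrow> real"
  assumes e: "homogeneous_expansion f a P P' A \<rho>" and P0: "\<And>k h. k < m \<Longrightarrow> P k h = 0"
  shows "\<exists>C \<delta> D. 0 \<le> C \<and> 0 < \<delta> \<and> (\<forall>h. norm h < \<delta> \<longrightarrow> \<bar>f (a + h)\<bar> \<le> C * norm h ^ m \<and>
    (f has_derivative D h) (at (a + h)) \<and> (\<forall>v. \<bar>D h v\<bar> \<le> C * norm h ^ (m - 1) * norm v))"
proof -
  have \<rho>: "\<rho> > 0" and A: "summable (\<lambda>k. A k * \<rho> ^ k)" and A0: "\<And>k. 0 \<le> A k"
    and deriv: "\<And>k h. (P k has_derivative P' k h) (at h)"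
    and P_le: "\<And>k h. \<bar>P k h\<bar> \<le> A k * norm h ^ k"
    and P'_le: "\<And>k h v. \<bar>P' k h v\<bar> \<le> real k * A k * norm h ^ (k - 1) * norm v"
    and sums: "\<And>h. norm h < \<rho> \<Longrightarrow> (\<lambda>k. P k h) sums f (a + h)"
    using e by (auto simp: homogeneous_expansion_def)
  \<comment> \<open>Halving the radius absorbs the factor \<open>k\<close> from differentiation:
    \<open>k * r ^ (k - 1) <= 2 ^ k * r ^ (k - 1) = 2 / \<rho> * \<rho> ^ k\<close> for positive
    \<open>k\<close>.\<close>
  define r where "r = \<rho> / 2"
  have r: "0 < r" "r < \<rho>" using \<rho> by (auto simp: r_def)
  define B where "B k = 2 / \<rho> * (A k * \<rho> ^ k)" for k
  have B: "summable B" and B0: "0 \<le> B k" for k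
    unfolding B_def using A A0 \<rho> by (auto intro: summable_mult)
  have B_ge: "real k * A k * r ^ (k - 1) \<le> B k" for k
  proof (cases k)
    case (Suc j)
    have "real k * r ^ j \<le> 2 ^ k * r ^ j"
      using r of_nat_less_two_power[of k, where 'a = real] by (intro mult_right_mono) auto
    also have "\<dots> = 2 / \<rho> * \<rho> ^ k"
      using \<rho> by (simp add: r_def Suc power_divide)
    finally have "A k * (real k * r ^ j) \<le> A k * (2 / \<rho> * \<rho> ^ k)"
      using A0 by (rule mult_left_mono)
    then have "real k * A k * r ^ j \<le> 2 / \<rho> * (A k * \<rho> ^ k)"
      by (simp only: mult_ac)
    then show ?thesis by (simp only: B_def Suc diff_Suc_1)
  qed (simp add: B0)
  have P'0: "P' k h v = 0" if "k < m" for k h v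
  proof -
    have "P k = (\<lambda>h. 0)" using P0[OF that] by auto
    then have "P' k h = (\<lambda>_. 0)"
      using has_derivative_unique[OF deriv[of k h]] has_derivative_const by metis
    then show ?thesis by simp
  qed
  have split: "norm h ^ j \<le> norm h ^ i * (r ^ j / r ^ i)" if "i \<le> j" "norm h < r" for h :: 'a and i j :: nat
  proof -
    have "norm h ^ j = norm h ^ i * norm h ^ (j - i)"
      using that by (simp flip: power_add)
    also have "\<dots> \<le> norm h ^ i * r ^ (j - i)"
      using that r by (intro mult_left_mono power_mono) auto
    finally show ?thesis using that r by (simp add: power_diff)
  qed
  have P'_bound: "\<bar>P' k h v\<bar> \<le> (B k / r ^ (m - 1) * norm h ^ (m - 1)) * norm v" if h: "norm h < r" for k h v
  \<comment> \<open>The case \<open>k = 0\<close> is set apart for the sake of \<open>m = 0\<close>;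
    otherwise \<open>m <= k\<close> and \<open>k >= 1\<close> give \<open>m - 1 <= k - 1\<close>, so
    \<open>split\<close> applies to these exponents.\<close>
  proof (cases "k < m \<or> k = 0")
    case True
    then have "P' k h v = 0" using P'0 P'_le[of 0 h v] by auto
    then show ?thesis using B0 r by simp
  next
    case False
    have "\<bar>P' k h v\<bar> \<le> real k * A k * (norm h ^ (m - 1) * (r ^ (k - 1) / r ^ (m - 1))) * norm v"
      using False h
      by (intro order_trans[OF P'_le] mult_left_mono mult_right_mono split) (auto simp: A0)
    also have "\<dots> = (real k * A k * r ^ (k - 1)) * (norm h ^ (m - 1) / r ^ (m - 1) * norm v)"
      by simp
    also have "\<dots> \<le> B k * (norm h ^ (m - 1) / r ^ (m - 1) * norm v)"
      using r by (intro mult_right_mono B_ge) auto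
    finally show ?thesis by simp
  qed
  have P'_bound0: "\<bar>P' k h v\<bar> \<le> B k * norm v" if h: "norm h < r" for k h v
  proof -
    have "(B k / r ^ (m - 1)) * norm h ^ (m - 1) \<le> (B k / r ^ (m - 1)) * r ^ (m - 1)"
      using h r B0 by (intro mult_left_mono power_mono) auto
    also have "\<dots> = B k" using r by simp
    finally have "(B k / r ^ (m - 1)) * norm h ^ (m - 1) * norm v \<le> B k * norm v"
      by (rule mult_right_mono) simp
    then show ?thesis using P'_bound[OF h, of k v] by linarith
  qed
  have P'_sm: "summable (\<lambda>k. P' k h v)" if "norm h < r" for h v
    by (rule summable_comparison_test'[OF summable_mult2[OF B, of "norm v"], of 0])
      (use P'_bound0[OF that] in auto)
  define D where "D h v = (\<Sum>k. P' k h v)" for h v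
  \<comment> \<open>Termwise differentiation needs uniform convergence of the derivatives, supplied
    by the tails of the majorant \<open>B\<close>.\<close>
  have "\<exists>g. \<forall>x\<in>ball 0 r. (\<lambda>n. P n x) sums (g x) \<and> (g has_derivative D x) (at x within ball 0 r)"
  proof (rule has_derivative_series[where f' = P' and x = 0 and l = "f (a + 0)"])
    fix e :: real assume "e > 0"
    have "(\<lambda>n. suminf B - sum B {..<n}) \<longlonglongrightarrow> suminf B - suminf B"
      by (intro tendsto_diff tendsto_const summable_LIMSEQ B)
    then have "\<forall>\<^sub>F n in sequentially. suminf B - sum B {..<n} < e"
      using \<open>e > 0\<close> by (intro order_tendstoD) auto
    then show "\<forall>\<^sub>F n in sequentially. \<forall>x\<in>ball 0 r. \<forall>v. norm ((\<Sum>i<n. P' i x v) - D x v) \<le> e * norm v"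
    proof eventually_elim
      case (elim n)
      show ?case
      proof (intro ballI allI)
        fix x v :: 'a assume x: "x \<in> ball 0 r"
        then have x': "norm x < r" by simp
        note sm = P'_sm[OF x', of v]
        have sB: "summable (\<lambda>i. B (i + n) * norm v)"
          using B summable_ignore_initial_segment summable_mult2 by blast
        have "D x v - (\<Sum>i<n. P' i x v) = (\<Sum>i. P' (i + n) x v)"
          unfolding D_def using suminf_split_initial_segment[OF sm, of n] by simp
        also have "\<bar>\<dots>\<bar> \<le> (\<Sum>i. B (i + n) * norm v)"
          using norm_suminf_le[of "\<lambda>i. P' (i + n) x v", OF _ sB] P'_bound0[OF x'] by simp
        also have "\<dots> = (suminf B - sum B {..<n}) * norm v"
          using suminf_split_initial_segment[OF B, of n] B summable_ignore_initial_segment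
          by (subst suminf_mult2[symmetric]) auto
        also have "\<dots> \<le> e * norm v"
          using elim by (intro mult_right_mono) auto
        finally show "norm ((\<Sum>i<n. P' i x v) - D x v) \<le> e * norm v"
          by (simp add: abs_minus_commute)
      qed
    qed
  next
    show "(P n has_derivative P' n x) (at x within ball 0 r)" for n x
      using deriv has_derivative_at_withinI by blast
    show "(\<lambda>n. P n 0) sums f (a + 0)"
      by (rule sums) (use \<rho> in simp)
  qed (use r in auto)
  then obtain g where g: "\<And>x. norm x < r \<Longrightarrow> (\<lambda>n. P n x) sums g x"
    and g': "\<And>x. norm x < r \<Longrightarrow> (g has_derivative D x) (at x within ball 0 r)"
    by (metis mem_ball_0)
  have g_eq: "g x = f (a + x)" if "norm x < r" for x
    using g[OF that] sums[of x] that r sums_unique2 by fastforce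
  have f': "(f has_derivative D h) (at (a + h))" if h: "norm h < r" for h
  proof -
    have "(g has_derivative D h) (at h)"
      using g'[OF h] at_within_open[of h "ball 0 r"] h by simp
    then have "((\<lambda>x. f (a + x)) has_derivative D h) (at h)"
      by (rule has_derivative_transform_within_open[of _ _ _ _ "ball 0 r"]) (use h g_eq in auto)
    moreover have "((\<lambda>x. x - a) has_derivative (\<lambda>x. x)) (at (a + h))"
      by (auto intro!: derivative_eq_intros)
    ultimately have "((\<lambda>x. f (a + x)) \<circ> (\<lambda>x. x - a) has_derivative D h \<circ> (\<lambda>x. x)) (at (a + h))"
      by (intro diff_chain_at) simp_all
    then show ?thesis by (simp add: o_def)
  qed
  define C where "C = suminf B / r ^ (m - 1) + (\<Sum>k. A k * r ^ k) / r ^ m"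
  have Ar: "summable (\<lambda>k. A k * r ^ k)"
    by (rule summable_comparison_test'[OF A, of 0])
      (use A0 r in \<open>auto intro!: mult_left_mono power_mono\<close>)
  have C0: "0 \<le> suminf B / r ^ (m - 1)" "0 \<le> (\<Sum>k. A k * r ^ k) / r ^ m"
    using suminf_nonneg[OF B B0] suminf_nonneg[OF Ar] A0 r by auto
  have "\<bar>f (a + h)\<bar> \<le> C * norm h ^ m" if h: "norm h < r" for h
  proof -
    have le: "\<bar>P k h\<bar> \<le> A k * r ^ k * (norm h ^ m / r ^ m)" for k
    proof (cases "k < m")
      case False
      have "\<bar>P k h\<bar> \<le> A k * (norm h ^ m * (r ^ k / r ^ m))"
        using False h by (intro order_trans[OF P_le] mult_left_mono split) (auto simp: A0)
      then show ?thesis by (simp add: mult_ac)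
    qed (use P0 A0 r in auto)
    have "\<bar>f (a + h)\<bar> = \<bar>\<Sum>k. P k h\<bar>"
      using sums_unique[OF sums[of h]] h r by simp
    also have "\<dots> \<le> (\<Sum>k. A k * r ^ k * (norm h ^ m / r ^ m))"
      using norm_suminf_le[of "\<lambda>k. P k h", OF _ summable_mult2[OF Ar, of "norm h ^ m / r ^ m"]] le by simp
    also have "\<dots> = (\<Sum>k. A k * r ^ k) / r ^ m * norm h ^ m"
      using suminf_mult2[OF Ar, of "norm h ^ m / r ^ m"] by simp
    also have "\<dots> \<le> C * norm h ^ m"
      unfolding C_def using C0 by (intro mult_right_mono) auto
    finally show ?thesis .
  qed
  moreover have "\<bar>D h v\<bar> \<le> C * norm h ^ (m - 1) * norm v" if h: "norm h < r" for h v
  proof -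
    define s where "s = norm h ^ (m - 1) * norm v / r ^ (m - 1)"
    have "\<bar>D h v\<bar> \<le> (\<Sum>k. B k * s)"
      unfolding D_def using norm_suminf_le[of "\<lambda>k. P' k h v", OF _ summable_mult2[OF B, of s]] P'_bound[OF h, of _ v]
      by (simp add: s_def mult_ac)
    also have "\<dots> = suminf B / r ^ (m - 1) * (norm h ^ (m - 1) * norm v)"
      using suminf_mult2[OF B, of s] by (simp add: s_def)
    also have "\<dots> \<le> C * (norm h ^ (m - 1) * norm v)"
      unfolding C_def using C0 by (intro mult_right_mono) auto
    finally show ?thesis by (simp add: mult.assoc)
  qed
  moreover have "0 \<le> C" using C0 by (simp add: C_def)
  ultimately show ?thesis using r(1) f' by blast
qed

text \<open>Dropping one term leaves every majorant in place. Applied to the first non-zero term of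
  \<open>U\<close>, this raises the order of vanishing to \<open>l + 1\<close>.\<close>

lemma homogeneous_expansion_remove_term:
  assumes "homogeneous_expansion f a P P' A \<rho>"
  shows "homogeneous_expansion (\<lambda>x. f x - P l (x - a)) a (P(l := \<lambda>_. 0)) (P'(l := \<lambda>_ _. 0)) A \<rho>"
proof -
  have "(\<lambda>k. (P(l := \<lambda>_. 0)) k h) sums (f (a + h) - P l h)" if "norm h < \<rho>" for h
  proof -
    have "(\<lambda>k. P k h - (if k = l then P l h else 0)) sums (f (a + h) - P l h)"
      using assms that by (intro sums_diff sums_If_finite_set[of "{l}", simplified] ) (auto simp: homogeneous_expansion_def sums_single)
    moreover have "(\<lambda>k. P k h - (if k = l then P l h else 0)) = (\<lambda>k. (P(l := \<lambda>_. 0)) k h)"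
      by auto
    ultimately show ?thesis by simp
  qed
  then show ?thesis
    using assms unfolding homogeneous_expansion_def by (auto simp: mult_nonneg_nonneg)
qed

text \<open>Along the line through \<open>x\<close> the function is the one-variable power series
  with coefficients \<open>P k x\<close>. This links \<open>l\<close> and \<open>d\<close>, which
  are defined by iterated \<open>deriv\<close>, to the expansions.\<close>

lemma taylor_term_eq_homogeneous_term:
  assumes e: "homogeneous_expansion f 0 P P' A \<rho>"
  shows "taylor_term f k x = P k x"
proof -
  define F where "F = Abs_fps (\<lambda>k. P k x)"
  have \<rho>: "\<rho> > 0" and hom: "\<And>k t h. P k (t *\<^sub>R h) = t ^ k * P k h"
    and sums: "\<And>h. norm h < \<rho> \<Longrightarrow> (\<lambda>k. P k h) sums f (0 + h)"
    using e by (auto simp: homogeneous_expansion_def)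
  have "(\<lambda>t. f (t *\<^sub>R x)) has_fps_expansion F"
  proof (rule has_fps_expansionI)
    have "((\<lambda>t. norm (t *\<^sub>R x)) \<longlongrightarrow> norm (0 *\<^sub>R x)) (nhds 0)"
      by (intro tendsto_intros filterlim_ident)
    then have "\<forall>\<^sub>F t in nhds 0. norm (t *\<^sub>R x) < \<rho>"
      using \<rho> by (intro order_tendstoD) auto
    then show "\<forall>\<^sub>F t in nhds 0. (\<lambda>n. fps_nth F n * t ^ n) sums f (t *\<^sub>R x)"
    proof eventually_elim
      case (elim t)
      show ?case using sums[OF elim] by (simp add: F_def hom mult.commute)
    qed
  qed
  then have "(deriv ^^ k) (\<lambda>t. f (t *\<^sub>R x)) has_fps_expansion (fps_deriv ^^ k) F"
    by (induction k) (auto intro: has_fps_expansion_deriv)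
  then have "(deriv ^^ k) (\<lambda>t. f (t *\<^sub>R x)) 0 = fps_nth ((fps_deriv ^^ k) F) 0"
    unfolding has_fps_expansion_def by (auto dest!: eventually_nhds_x_imp_x simp: eval_fps_at_0)
  then show ?thesis
    by (simp add: taylor_term_def fps_0th_higher_deriv F_def)
qed

subsection \<open>Time changes and orbit equivalence\<close>

text \<open>Gronwall's argument for the squared norm, which unlike the norm is differentiable where
  \<open>w\<close> vanishes.\<close>

lemma linear_growth_zero_local:
  fixes w w' :: "real \<Rightarrow> 'v::real_inner"
  assumes deriv: "\<And>s. \<bar>s - t\<bar> < \<delta> \<Longrightarrow> (w has_vector_derivative w' s) (at s)"
    and bound: "\<And>s. \<bar>s - t\<bar> < \<delta> \<Longrightarrow> norm (w' s) \<le> C * norm (w s)"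
    and t: "w t = 0" and s: "\<bar>s - t\<bar> < \<delta>"
  shows "w s = 0"
proof -
  define N where "N s = w s \<bullet> w s" for s
  have N': "(N has_real_derivative 2 * (w s \<bullet> w' s)) (at s)" if "\<bar>s - t\<bar> < \<delta>" for s
    unfolding N_def has_real_derivative_iff_has_vector_derivative
    using bounded_bilinear.has_vector_derivative[OF bounded_bilinear_inner deriv[OF that] deriv[OF that]]
    by (simp add: inner_commute)
  have N'_le: "\<bar>2 * (w s \<bullet> w' s)\<bar> \<le> 2 * C * N s" if "\<bar>s - t\<bar> < \<delta>" for s
  proof -
    have "\<bar>w s \<bullet> w' s\<bar> \<le> norm (w s) * (C * norm (w s))"
      by (intro order_trans[OF Cauchy_Schwarz_ineq2] mult_left_mono bound that) simp
    also have "\<dots> = C * N s" by (simp add: N_def power2_norm_eq_inner[symmetric] power2_eq_square)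
    finally show ?thesis by simp
  qed
  have "N s \<le> 0"
  proof (cases "t \<le> s")
    case True
    \<comment> \<open>An exponential weight makes the squared norm non-increasing to the right of
      \<open>t\<close>; to the left the opposite weight makes it non-decreasing.\<close>
    have "N s * exp (- 2 * C * s) \<le> N t * exp (- 2 * C * t)"
    proof (rule DERIV_nonpos_imp_nonincreasing[OF True])
      fix x assume "t \<le> x" "x \<le> s"
      then have x: "\<bar>x - t\<bar> < \<delta>" using s by auto
      have "((\<lambda>s. N s * exp (- 2 * C * s)) has_real_derivative
          (2 * (w x \<bullet> w' x) - 2 * C * N x) * exp (- 2 * C * x)) (at x)"
        using x by (auto intro!: derivative_eq_intros N' simp: algebra_simps)
      moreover have "(2 * (w x \<bullet> w' x) - 2 * C * N x) * exp (- 2 * C * x) \<le> 0"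
        using N'_le[OF x] by (intro mult_nonpos_nonneg) auto
      ultimately show "\<exists>y. ((\<lambda>s. N s * exp (- 2 * C * s)) has_real_derivative y) (at x) \<and> y \<le> 0"
        by blast
    qed
    then show ?thesis using t by (simp add: N_def mult_le_0_iff)
  next
    case False
    then have "s \<le> t" by simp
    then have "N s * exp (2 * C * s) \<le> N t * exp (2 * C * t)"
    proof (rule DERIV_nonneg_imp_nondecreasing)
      fix x assume "s \<le> x" "x \<le> t"
      then have x: "\<bar>x - t\<bar> < \<delta>" using s by auto
      have "((\<lambda>s. N s * exp (2 * C * s)) has_real_derivative
          (2 * (w x \<bullet> w' x) + 2 * C * N x) * exp (2 * C * x)) (at x)"
        using x by (auto intro!: derivative_eq_intros N' simp: algebra_simps)
      moreover have "0 \<le> (2 * (w x \<bullet> w' x) + 2 * C * N x) * exp (2 * C * x)"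
        using N'_le[OF x] by (intro mult_nonneg_nonneg) auto
      ultimately show "\<exists>y. ((\<lambda>s. N s * exp (2 * C * s)) has_real_derivative y) (at x) \<and> 0 \<le> y"
        by blast
    qed
    then show ?thesis using t by (simp add: N_def mult_le_0_iff)
  qed
  then show ?thesis by (simp add: N_def flip: power2_norm_eq_inner)
qed

text \<open>The zero set is closed by continuity and open by the local Gronwall bound, hence it is
  the whole connected interval. Openness is tested at zeros only, so the growth bound is asked for
  near zeros only.\<close>

lemma linear_growth_zero:
  fixes w w' :: "real \<Rightarrow> 'v::real_inner"
  assumes I: "open I" "is_interval I" and a: "a \<in> I" "w a = 0"
    and deriv: "\<And>t. t \<in> I \<Longrightarrow> (w has_vector_derivative w' t) (at t)"
    and bound: "\<And>t. t \<in> I \<Longrightarrow> w t = 0 \<Longrightarrow> \<exists>C. \<forall>\<^sub>F s in nhds t. norm (w' s) \<le> C * norm (w s)"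
    and t: "t \<in> I"
  shows "w t = 0"
proof -
  define Z where "Z = {t \<in> I. w t = 0}"
  have "\<exists>\<delta>>0. ball t \<delta> \<subseteq> Z" if "t \<in> Z" for t
  proof -
    have tI: "t \<in> I" "w t = 0" using that by (auto simp: Z_def)
    obtain C where "\<forall>\<^sub>F s in nhds t. norm (w' s) \<le> C * norm (w s)"
      using bound[OF tI] by blast
    moreover have "\<forall>\<^sub>F s in nhds t. s \<in> I"
      using I(1) tI(1) by (rule eventually_nhds_in_open)
    ultimately have "\<forall>\<^sub>F s in nhds t. s \<in> I \<and> norm (w' s) \<le> C * norm (w s)"
      by eventually_elim simp
    then obtain \<delta> where \<delta>: "\<delta> > 0" "\<And>s. \<bar>s - t\<bar> < \<delta> \<Longrightarrow> s \<in> I \<and> norm (w' s) \<le> C * norm (w s)"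
      unfolding eventually_nhds_metric dist_real_def by blast
    have "w s = 0" if "\<bar>s - t\<bar> < \<delta>" for s
      by (rule linear_growth_zero_local[of t \<delta> w w' C s]) (use \<delta> deriv that tI in auto)
    then have "ball t \<delta> \<subseteq> Z"
      using \<delta> by (auto simp: Z_def dist_real_def abs_minus_commute)
    then show ?thesis using \<delta>(1) by blast
  qed
  then have "open Z" by (simp add: open_contains_ball)
  moreover have "closedin (top_of_set I) Z"
    unfolding Z_def
    by (intro continuous_closedin_preimage_constant continuous_at_imp_continuous_on)
      (use deriv has_vector_derivative_continuous in blast)
  moreover have "connected I" using I(2) is_interval_connected by blast
  moreover have "Z \<subseteq> I" "Z \<noteq> {}" using a by (auto simp: Z_def)
  ultimately have "Z = I"
    by (metis connected_clopen open_subset)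
  then show ?thesis using t by (auto simp: Z_def)
qed

text \<open>The coefficient \<open>k\<close> is a function of time along one given curve, so its
  continuity bounds it locally. Both the radius and the energy on the boundary obey such an
  equation.\<close>

lemma scalar_linear_ode_zero:
  fixes f k :: "real \<Rightarrow> real"
  assumes I: "open I" "is_interval I" and a: "a \<in> I" "f a = 0"
    and deriv: "\<And>t. t \<in> I \<Longrightarrow> (f has_real_derivative k t * f t) (at t)"
    and k: "continuous_on I k" and t: "t \<in> I"
  shows "f t = 0"
proof (rule linear_growth_zero[where w = f and w' = "\<lambda>t. k t * f t", OF I a _ _ t])
  show "(f has_vector_derivative k t * f t) (at t)" if "t \<in> I" for t
    using deriv[OF that] by (simp add: has_real_derivative_iff_has_vector_derivative)
  show "\<exists>C. \<forall>\<^sub>F s in nhds t. norm (k s * f s) \<le> C * norm (f s)" if "t \<in> I" for t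
  proof -
    have "isCont k t" using k I(1) that continuous_on_eq_continuous_at by blast
    then have "((\<lambda>s. \<bar>k s\<bar>) \<longlongrightarrow> \<bar>k t\<bar>) (nhds t)"
      using tendsto_at_iff_tendsto_nhds[of k t] by (auto simp: isCont_def intro: tendsto_rabs)
    then have "\<forall>\<^sub>F s in nhds t. \<bar>k s\<bar> < \<bar>k t\<bar> + 1" by (rule order_tendstoD) simp
    then have "\<forall>\<^sub>F s in nhds t. norm (k s * f s) \<le> (\<bar>k t\<bar> + 1) * norm (f s)"
      by eventually_elim (simp add: abs_mult mult_right_mono)
    then show ?thesis by blast
  qed
qed

section \<open>Changes of time on open intervals\<close>

lemma open_interval_stretch_upwards:
  fixes I :: "real set"
  assumes I: "open I" "is_interval I" "I \<noteq> {}"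
  shows "\<exists>p :: real \<Rightarrow> real. strict_mono_on I p \<and> continuous_on I p \<and> (\<forall>y. \<exists>t\<in>I. y \<le> p t)"
proof (cases "bdd_above I")
  case True
  have lt: "t < Sup I" if t: "t \<in> I" for t
  proof -
    obtain e where e: "e > 0" "ball t e \<subseteq> I"
      using I(1) t open_contains_ball by blast
    have "t + e / 2 \<in> I" using e(1) by (intro subsetD[OF e(2)]) (simp add: dist_real_def)
    then have "t + e / 2 \<le> Sup I" using True cSup_upper by blast
    then show ?thesis using e(1) by linarith
  qed
  have "\<exists>t\<in>I. y \<le> 1 / (Sup I - t)" for y
  proof -
    define K where "K = max 1 y"
    have "Sup I - 1 / K < Sup I" by (simp add: K_def)
    then obtain t where t: "t \<in> I" "Sup I - 1 / K < t"
      using I(3) True less_cSup_iff by blast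
    have "Sup I - t > 0" "K > 0" using lt[OF t(1)] by (auto simp: K_def)
    then have "K \<le> 1 / (Sup I - t)"
      using t(2) by (simp add: field_simps)
    then show ?thesis using t(1) by (intro bexI[of _ t]) (auto simp: K_def)
  qed
  moreover have "strict_mono_on I (\<lambda>t. 1 / (Sup I - t))"
    using lt by (auto simp: strict_mono_on_def intro!: divide_strict_left_mono)
  moreover have "continuous_on I (\<lambda>t. 1 / (Sup I - t))"
    using lt by (intro continuous_intros) force
  ultimately show ?thesis by blast
next
  case False
  have "\<exists>t\<in>I. y \<le> t" for y
  proof (rule ccontr)
    assume "\<not> (\<exists>t\<in>I. y \<le> t)"
    then have "bdd_above I" by (intro bdd_aboveI[of I y]) force
    then show False using False by simp
  qed
  then show ?thesis
    by (intro exI[of _ "\<lambda>t. t"]) (auto simp: strict_mono_on_def)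
qed

text \<open>An orbit on the boundary is sent to the equilibrium \<open>0\<close>, whose maximal
  curve runs over the whole line, while the orbit itself may have a bounded interval of times. The
  increasing surjection is the change of time between them.\<close>

lemma open_interval_stretch_to_line:
  fixes I :: "real set"
  assumes I: "open I" "is_interval I" "I \<noteq> {}"
  shows "\<exists>s :: real \<Rightarrow> real. strict_mono_on I s \<and> s ` I = UNIV"
proof -
  have I': "open (uminus ` I)" "is_interval (uminus ` I)" "uminus ` I \<noteq> {}"
    using I open_negations by auto
  obtain p :: "real \<Rightarrow> real" where p: "strict_mono_on I p" "continuous_on I p" "\<And>y. \<exists>t\<in>I. y \<le> p t"
    using open_interval_stretch_upwards[OF I] by blast
  obtain q :: "real \<Rightarrow> real" where q: "strict_mono_on (uminus ` I) q" "continuous_on (uminus ` I) q"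
    "\<And>y. \<exists>t\<in>I. y \<le> q (- t)"
    using open_interval_stretch_upwards[OF I'] by auto
  define s where "s t = p t - q (- t)" for t
  have q_mono: "q (- b) < q (- a)" if "a \<in> I" "b \<in> I" "a < b" for a b
    using that by (intro strict_mono_onD[OF q(1)]) auto
  have p_mono: "p a < p b" if "a \<in> I" "b \<in> I" "a < b" for a b
    using that by (intro strict_mono_onD[OF p(1)]) auto
  have q_le: "q (- b) \<le> q (- a)" if "a \<in> I" "b \<in> I" "a \<le> b" for a b
    using q_mono[OF that(1,2)] that(3) by (cases "a = b") auto
  have p_le: "p a \<le> p b" if "a \<in> I" "b \<in> I" "a \<le> b" for a b
    using p_mono[OF that(1,2)] that(3) by (cases "a = b") auto
  have mono: "strict_mono_on I s"
    using p_mono q_mono by (fastforce simp: strict_mono_on_def s_def)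
  have "continuous_on I (\<lambda>t. q (- t))"
    using continuous_on_compose[of I uminus q] q(2) by (simp add: o_def continuous_intros)
  then have "continuous_on I s"
    unfolding s_def by (intro continuous_intros p)
  then have "is_interval (s ` I)"
    using I(2) connected_continuous_image is_interval_connected_1 by blast
  obtain c where c: "c \<in> I" using I(3) by blast
  have "y \<in> s ` I" for y
  proof -
    obtain a where a: "a \<in> I" "y + q (- c) \<le> p a" using p(3) by blast
    obtain b where b: "b \<in> I" "p c - y \<le> q (- b)" using q(3) by blast
    have m: "max a c \<in> I" "min b c \<in> I" using a b c by (auto simp: max_def min_def)
    have "p a \<le> p (max a c)" using p_le[OF a(1) m(1)] by simp
    moreover have "q (- max a c) \<le> q (- c)" using q_le[OF c m(1)] by simp
    ultimately have 1: "y \<le> s (max a c)" using a(2) by (simp add: s_def)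
    have "q (- b) \<le> q (- min b c)" using q_le[OF m(2) b(1)] by simp
    moreover have "p (min b c) \<le> p c" using p_le[OF m(2) c] by simp
    ultimately have 2: "s (min b c) \<le> y" using b(2) by (simp add: s_def)
    show ?thesis
      by (rule mem_is_interval_1_I[OF \<open>is_interval (s ` I)\<close> imageI[OF m(2)] imageI[OF m(1)] 2 1])
  qed
  then show ?thesis using mono by blast
qed

text \<open>Extended real endpoints treat bounded, half-bounded and unbounded intervals
  together.\<close>

lemma antiderivative_on_open_interval:
  fixes c :: "real \<Rightarrow> real"
  assumes I: "open I" "is_interval I" "I \<noteq> {}" and c: "continuous_on I c"
  shows "\<exists>s. \<forall>t\<in>I. (s has_real_derivative c t) (at t)"
proof -
  define a b where "a = Inf (ereal ` I)" and "b = Sup (ereal ` I)"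
  have in_I: "x \<in> I" if x: "a < ereal x" "ereal x < b" for x
  proof -
    obtain y z where "y \<in> I" "z \<in> I" "y < x" "x < z"
      using x unfolding a_def b_def Inf_less_iff less_Sup_iff by auto
    then show ?thesis using mem_is_interval_1_I[OF I(2), of y z x] by simp
  qed
  have bounds: "a < ereal x \<and> ereal x < b" if x: "x \<in> I" for x
  proof -
    obtain e where e: "e > 0" "ball x e \<subseteq> I"
      using I(1) x open_contains_ball by blast
    have "x - e / 2 \<in> I" "x + e / 2 \<in> I"
      using e(1) by (intro subsetD[OF e(2)]; simp add: dist_real_def)+
    then have "a \<le> ereal (x - e / 2)" "ereal (x + e / 2) \<le> b"
      unfolding a_def b_def by (auto intro: Inf_lower Sup_upper)
    moreover have "ereal (x - e / 2) < ereal x" "ereal x < ereal (x + e / 2)"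
      using e(1) by auto
    ultimately show ?thesis by (meson le_less_trans less_le_trans)
  qed
  have "a < b" using bounds I(3) less_trans by blast
  moreover have "isCont c x" if "a < ereal x" "ereal x < b" for x
    using c I(1) in_I[OF that] continuous_on_eq_continuous_at by blast
  ultimately obtain s where "\<And>x. a < ereal x \<Longrightarrow> ereal x < b \<Longrightarrow> (s has_vector_derivative c x) (at x)"
    using einterval_antiderivative[of a b c] by blast
  then have "\<forall>t\<in>I. (s has_real_derivative c t) (at t)"
    using bounds by (simp add: has_real_derivative_iff_has_vector_derivative)
  then show ?thesis by blast
qed

text \<open>With \<open>s\<close> an antiderivative of \<open>c\<close>, the curve
  \<open>\<gamma>\<close> run through the inverse of \<open>s\<close> loses the factor
  \<open>c\<close>. The derivative of \<open>s\<close> is kept in the conclusion because it later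
  identifies a composite of two time changes as a translation.\<close>

lemma time_change:
  fixes \<gamma> :: "real \<Rightarrow> 'v::real_normed_vector"
  assumes I: "open I" "is_interval I" "I \<noteq> {}"
    and c: "continuous_on I c" "\<And>t. t \<in> I \<Longrightarrow> c t > 0"
    and \<gamma>: "\<And>t. t \<in> I \<Longrightarrow> (\<gamma> has_vector_derivative c t *\<^sub>R Y (\<gamma> t)) (at t)"
  shows "\<exists>s J \<delta>. open J \<and> is_interval J \<and> J \<noteq> {} \<and> strict_mono_on I s \<and> s ` I = J \<and>
    (\<forall>t\<in>I. (s has_real_derivative c t) (at t) \<and> \<delta> (s t) = \<gamma> t) \<and>
    (\<forall>u\<in>J. (\<delta> has_vector_derivative Y (\<delta> u)) (at u))"
proof -
  obtain s where s: "\<And>t. t \<in> I \<Longrightarrow> (s has_real_derivative c t) (at t)"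
    using antiderivative_on_open_interval[OF I c(1)] by blast
  have mono: "strict_mono_on I s"
  proof (rule strict_mono_onI)
    fix a b assume ab: "a \<in> I" "b \<in> I" "a < b"
    show "s a < s b"
    proof (rule DERIV_pos_imp_increasing[OF ab(3)])
      fix x assume "a \<le> x" "x \<le> b"
      then have "x \<in> I" using ab mem_is_interval_1_I[OF I(2)] by blast
      then show "\<exists>y. (s has_real_derivative y) (at x) \<and> 0 < y" using s c(2) by blast
    qed
  qed
  then have inj: "inj_on s I" by (rule strict_mono_on_imp_inj_on)
  have cont: "continuous_on I s"
    using s DERIV_isCont continuous_at_imp_continuous_on by blast
  define J where "J = s ` I"
  have J: "open J" "is_interval J" "J \<noteq> {}"
  proof -
    show "open J" unfolding J_def
      by (rule injective_into_1d_imp_open_map_UNIV[OF I(1) cont inj]) simp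
    show "is_interval J" unfolding J_def
      using I(2) cont connected_continuous_image is_interval_connected_1 by blast
  qed (use I in \<open>simp add: J_def\<close>)
  obtain \<sigma> where \<sigma>: "homeomorphism I J s \<sigma>"
    using homeomorphism_into_1d[of I s J] inj cont I(2) is_interval_path_connected
    by (auto simp: J_def)
  have \<sigma>_deriv: "(\<sigma> has_real_derivative 1 / c (\<sigma> u)) (at u)" if u: "u \<in> J" for u
  proof -
    have "\<sigma> u \<in> I" using \<sigma> u by (auto simp: homeomorphism_def)
    have "(\<sigma> has_real_derivative inverse (c (\<sigma> u))) (at u)"
    proof (rule has_field_derivative_inverse_basic)
      show "(s has_real_derivative c (\<sigma> u)) (at (\<sigma> u))" using s \<open>\<sigma> u \<in> I\<close> by blast
      show "c (\<sigma> u) \<noteq> 0" using c(2)[OF \<open>\<sigma> u \<in> I\<close>] by simp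
      show "isCont \<sigma> u"
        using \<sigma> J(1) u continuous_on_eq_continuous_at by (auto simp: homeomorphism_def)
      show "open J" "u \<in> J" by fact+
      show "\<And>z. z \<in> J \<Longrightarrow> s (\<sigma> z) = z" using \<sigma> by (auto simp: homeomorphism_def)
    qed
    then show ?thesis by (simp add: inverse_eq_divide)
  qed
  have "((\<gamma> \<circ> \<sigma>) has_vector_derivative Y ((\<gamma> \<circ> \<sigma>) u)) (at u)" if u: "u \<in> J" for u
  proof -
    have uI: "\<sigma> u \<in> I" using \<sigma> u by (auto simp: homeomorphism_def)
    have "((\<gamma> \<circ> \<sigma>) has_vector_derivative (1 / c (\<sigma> u)) *\<^sub>R (c (\<sigma> u) *\<^sub>R Y (\<gamma> (\<sigma> u)))) (at u)"
      using \<sigma>_deriv[OF u] \<gamma>[OF uI]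
      by (intro vector_diff_chain_at) (simp_all add: has_real_derivative_iff_has_vector_derivative)
    then show ?thesis using c(2)[OF uI] by simp
  qed
  moreover have "(\<gamma> \<circ> \<sigma>) (s t) = \<gamma> t" if "t \<in> I" for t
    using \<sigma> that by (simp add: homeomorphism_def)
  ultimately show ?thesis
    using J mono s J_def by (intro exI[of _ s] exI[of _ J] exI[of _ "\<gamma> \<circ> \<sigma>"]) auto
qed

text \<open>Only the values of the fields along integral curves are constrained, so that \<open>A\<close> and \<open>B\<close> need not
  be open; \<open>c\<close> is the density of the change of time.\<close>

locale time_changed_conjugacy =
  fixes X :: "'a::real_normed_vector \<Rightarrow> 'a" and S A :: "'a set"
    and Y :: "'b::real_normed_vector \<Rightarrow> 'b" and T B :: "'b set"
    and f :: "'a \<Rightarrow> 'b" and h :: "'b \<Rightarrow> 'a" and c :: "'a \<Rightarrow> real"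
  assumes homeo: "homeomorphism A B f h"
    and A_subset: "A \<subseteq> S" and B_subset: "B \<subseteq> T"
    and A_invariant: "\<And>I \<gamma>. integral_curve X S I \<gamma> \<Longrightarrow> \<gamma> ` I \<inter> A \<noteq> {} \<Longrightarrow> \<gamma> ` I \<subseteq> A"
    and B_invariant: "\<And>I \<gamma>. integral_curve Y T I \<gamma> \<Longrightarrow> \<gamma> ` I \<inter> B \<noteq> {} \<Longrightarrow> \<gamma> ` I \<subseteq> B"
    and push: "\<And>I \<gamma> t. integral_curve X S I \<gamma> \<Longrightarrow> \<gamma> ` I \<subseteq> A \<Longrightarrow> t \<in> I \<Longrightarrow>
      ((\<lambda>t. f (\<gamma> t)) has_vector_derivative c (\<gamma> t) *\<^sub>R Y (f (\<gamma> t))) (at t)"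
    and pull: "\<And>I \<gamma> t. integral_curve Y T I \<gamma> \<Longrightarrow> \<gamma> ` I \<subseteq> B \<Longrightarrow> t \<in> I \<Longrightarrow>
      ((\<lambda>t. h (\<gamma> t)) has_vector_derivative (1 / c (h (\<gamma> t))) *\<^sub>R X (h (\<gamma> t))) (at t)"
    and c_cont: "continuous_on A c" and c_pos: "\<And>z. z \<in> A \<Longrightarrow> c z > 0"
begin

text \<open>The assumptions are symmetric under exchanging the two sides and inverting the density,
  so every statement about \<open>f\<close> also holds for \<open>h\<close>.\<close>

lemma flip: "time_changed_conjugacy Y T B X S A h f (\<lambda>w. 1 / c (h w))"
proof -
  have fh: "f (h w) = w" "h w \<in> A" if "w \<in> B" for w
    using homeo that by (auto simp: homeomorphism_def)
  have hf: "h (f z) = z" "f z \<in> B" if "z \<in> A" for z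
    using homeo that by (auto simp: homeomorphism_def)
  show ?thesis
  proof unfold_locales
    show "homeomorphism B A h f" using homeo by (rule homeomorphism_symD)
    have "continuous_on B (\<lambda>w. c (h w))"
      using homeo c_cont by (intro continuous_on_compose2[of A c B h]) (auto simp: homeomorphism_def)
    then show "continuous_on B (\<lambda>w. 1 / c (h w))"
      using fh c_pos by (intro continuous_intros) force+
    show "((\<lambda>t. f (\<gamma> t)) has_vector_derivative (1 / (1 / c (h (f (\<gamma> t))))) *\<^sub>R Y (f (\<gamma> t))) (at t)"
      if "integral_curve X S I \<gamma>" "\<gamma> ` I \<subseteq> A" "t \<in> I" for I \<gamma> t
    proof -
      have "h (f (\<gamma> t)) = \<gamma> t" using hf that by blast
      then show ?thesis using push[OF that] by simp
    qed
  qed (use A_subset B_subset A_invariant B_invariant pull c_pos fh in auto)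
qed

lemma reparametrise:
  assumes \<gamma>: "integral_curve X S I \<gamma>" "\<gamma> ` I \<subseteq> A"
  shows "\<exists>s J \<delta>. integral_curve Y T J \<delta> \<and> \<delta> ` J \<subseteq> B \<and> strict_mono_on I s \<and> s ` I = J \<and>
    (\<forall>t\<in>I. (s has_real_derivative c (\<gamma> t)) (at t) \<and> \<delta> (s t) = f (\<gamma> t))"
proof -
  have I: "open I" "is_interval I" "I \<noteq> {}"
    and deriv: "\<And>t. t \<in> I \<Longrightarrow> (\<gamma> has_vector_derivative X (\<gamma> t)) (at t)"
    using \<gamma> by (auto simp: integral_curve_def)
  have "continuous_on I \<gamma>"
    using deriv has_vector_derivative_continuous continuous_at_imp_continuous_on by blast
  then have "continuous_on I (\<lambda>t. c (\<gamma> t))"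
    using c_cont \<gamma>(2) continuous_on_compose2 by blast
  moreover have "c (\<gamma> t) > 0" if "t \<in> I" for t
    using c_pos \<gamma>(2) that by blast
  ultimately obtain s J \<delta> where *: "open J" "is_interval J" "J \<noteq> {}" "strict_mono_on I s" "s ` I = J"
    "\<forall>t\<in>I. (s has_real_derivative c (\<gamma> t)) (at t) \<and> \<delta> (s t) = f (\<gamma> t)"
    "\<forall>u\<in>J. (\<delta> has_vector_derivative Y (\<delta> u)) (at u)"
    using time_change[OF I, of "\<lambda>t. c (\<gamma> t)" "\<lambda>t. f (\<gamma> t)" Y] push[OF \<gamma>] by blast
  have "\<delta> ` J \<subseteq> B"
  proof
    fix w assume "w \<in> \<delta> ` J"
    then obtain t where "t \<in> I" "w = f (\<gamma> t)" using * by auto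
    then show "w \<in> B" using homeo \<gamma>(2) by (auto simp: homeomorphism_def)
  qed
  moreover from this have "integral_curve Y T J \<delta>"
    using * B_subset by (auto simp: integral_curve_def)
  ultimately show ?thesis using * by blast
qed

text \<open>An extension of the image curve is carried back by \<open>h\<close> to an extension of
  \<open>\<gamma>\<close>, up to a shift of time. Maximality of \<open>\<gamma>\<close> forbids the
  latter to be proper, hence also the former.\<close>

lemma maximal_image:
  assumes max: "maximal_integral_curve X S I \<gamma>" and \<gamma>A: "\<gamma> ` I \<subseteq> A"
  shows "\<exists>J \<delta> s. maximal_integral_curve Y T J \<delta> \<and> \<delta> ` J \<subseteq> B \<and> strict_mono_on I s \<and> s ` I = J \<and>
    (\<forall>t\<in>I. f (\<gamma> t) = \<delta> (s t))"
proof -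
  interpret inv: time_changed_conjugacy Y T B X S A h f "\<lambda>w. 1 / c (h w)" by (rule flip)
  have \<gamma>: "integral_curve X S I \<gamma>" using max by (simp add: maximal_integral_curve_def)
  have I: "open I" "is_interval I" "I \<noteq> {}" using \<gamma> by (auto simp: integral_curve_def)
  obtain s J \<delta> where \<delta>: "integral_curve Y T J \<delta>" "\<delta> ` J \<subseteq> B" and s: "strict_mono_on I s" "s ` I = J"
    and s_all: "\<forall>t\<in>I. (s has_real_derivative c (\<gamma> t)) (at t) \<and> \<delta> (s t) = f (\<gamma> t)"
    using reparametrise[OF \<gamma> \<gamma>A] by blast
  have s': "\<And>t. t \<in> I \<Longrightarrow> (s has_real_derivative c (\<gamma> t)) (at t)"
    and \<delta>s: "\<And>t. t \<in> I \<Longrightarrow> \<delta> (s t) = f (\<gamma> t)"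
    using s_all by blast+
  have hf: "h (f (\<gamma> t)) = \<gamma> t" if "t \<in> I" for t
    using homeo \<gamma>A that by (auto simp: homeomorphism_def)
  have "J' = J" if ext: "integral_curve Y T J' \<delta>'" "J \<subseteq> J'" "\<forall>u\<in>J. \<delta>' u = \<delta> u" for J' \<delta>'
  proof -
    obtain u where u: "u \<in> J" using \<delta>(1) by (auto simp: integral_curve_def)
    \<comment> \<open>One point in \<open>B\<close> suffices: invariance keeps the whole extension
      in \<open>B\<close>, where \<open>h\<close> is available.\<close>
    have "\<delta>' u = \<delta> u" "u \<in> J'" "\<delta> u \<in> B" using ext u \<delta>(2) by auto
    then have "\<delta>' u \<in> \<delta>' ` J' \<inter> B" by (metis IntI imageI)
    then have "\<delta>' ` J' \<subseteq> B" using B_invariant[OF ext(1)] by blast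
    then obtain r K \<gamma>' where \<gamma>': "integral_curve X S K \<gamma>'" and r: "strict_mono_on J' r" "r ` J' = K"
      and r_all: "\<forall>u\<in>J'. (r has_real_derivative 1 / c (h (\<delta>' u))) (at u) \<and> \<gamma>' (r u) = h (\<delta>' u)"
      using inv.reparametrise[OF ext(1)] by blast
    have r': "\<And>u. u \<in> J' \<Longrightarrow> (r has_real_derivative 1 / c (h (\<delta>' u))) (at u)"
      and \<gamma>'r: "\<And>u. u \<in> J' \<Longrightarrow> \<gamma>' (r u) = h (\<delta>' u)"
      using r_all by blast+
    have sJ': "s t \<in> J'" "\<delta>' (s t) = f (\<gamma> t)" if "t \<in> I" for t
      using that s(2) ext \<delta>s by auto
    \<comment> \<open>The two densities are reciprocal along the curve, so the composite time change
      has derivative one and is a translation by some \<open>k\<close>; the interval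
      \<open>L\<close> undoes it.\<close>
    have "((\<lambda>t. r (s t) - t) has_real_derivative 0) (at t)" if t: "t \<in> I" for t
    proof -
      have "c (\<gamma> t) > 0" using c_pos \<gamma>A t by blast
      then have "1 / c (h (\<delta>' (s t))) * c (\<gamma> t) = 1"
        using sJ' hf t by simp
      moreover have "((\<lambda>t. r (s t)) has_real_derivative 1 / c (h (\<delta>' (s t))) * c (\<gamma> t)) (at t)"
        using DERIV_chain2[OF r'[OF sJ'(1)[OF t]] s'[OF t]] .
      ultimately show ?thesis by (auto intro!: derivative_eq_intros)
    qed
    then have "\<exists>k. \<forall>t\<in>I. r (s t) - t = k"
      using I by (intro has_field_derivative_zero_constant)
        (auto simp: is_interval_convex_1 intro: DERIV_subset)
    then obtain k where "\<forall>t\<in>I. r (s t) - t = k" by blast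
    then have k: "r (s t) = t + k" if "t \<in> I" for t using that by force
    define L where "L = (\<lambda>x. x - k) ` K"
    have L_iff: "t \<in> L \<longleftrightarrow> t + k \<in> K" for t
      by (force simp: L_def)
    have "integral_curve X S L (\<lambda>t. \<gamma>' (t + k))"
      unfolding integral_curve_def
    proof (intro conjI ballI)
      have K: "open K" "is_interval K" "K \<noteq> {}" "\<gamma>' ` K \<subseteq> S"
        and K': "\<And>t. t \<in> K \<Longrightarrow> (\<gamma>' has_vector_derivative X (\<gamma>' t)) (at t)"
        using \<gamma>' by (auto simp: integral_curve_def)
      have "L = (+) (- k) ` K" by (auto simp: L_def)
      then show "open L" using K(1) open_translation by metis
      show "is_interval L" unfolding L_def using K(2) by simp
      show "L \<noteq> {}" using K(3) by (simp add: L_def)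
      show "(\<lambda>t. \<gamma>' (t + k)) ` L \<subseteq> S" using K(4) by (auto simp: L_iff)
      fix t assume "t \<in> L"
      then have "((\<gamma>' \<circ> (\<lambda>t. t + k)) has_vector_derivative 1 *\<^sub>R X (\<gamma>' (t + k))) (at t)"
        by (intro vector_diff_chain_at K') (auto simp: L_iff intro!: derivative_eq_intros)
      then show "((\<lambda>t. \<gamma>' (t + k)) has_vector_derivative X (\<gamma>' (t + k))) (at t)"
        by (simp add: o_def)
    qed
    moreover have "I \<subseteq> L" using k r(2) sJ' by (auto simp: L_iff) (metis imageI)
    moreover have "\<gamma>' (t + k) = \<gamma> t" if "t \<in> I" for t
    proof -
      have "\<gamma>' (t + k) = \<gamma>' (r (s t))" using k[OF that] by simp
      also have "\<dots> = h (f (\<gamma> t))" using \<gamma>'r[of "s t"] sJ'[OF that] by simp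
      finally show ?thesis using hf[OF that] by simp
    qed
    ultimately have "L = I"
      using max unfolding maximal_integral_curve_def by blast
    have "J' \<subseteq> J"
    proof
      fix u assume u: "u \<in> J'"
      then have "r u - k \<in> I" using r(2) \<open>L = I\<close> by (auto simp: L_def)
      moreover from this have "r u = r (s (r u - k))" using k by simp
      ultimately have "u = s (r u - k)"
        using strict_mono_on_imp_inj_on[OF r(1)] u sJ' by (meson inj_onD)
      then show "u \<in> J" using \<open>r u - k \<in> I\<close> s(2) by blast
    qed
    then show ?thesis using ext(2) by simp
  qed
  then have "maximal_integral_curve Y T J \<delta>"
    unfolding maximal_integral_curve_def using \<delta>(1) by blast
  then show ?thesis
    using \<delta>(2) s \<delta>s by (intro exI[of _ J] exI[of _ \<delta>] exI[of _ s]) simp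
qed

lemma orbit_image:
  assumes "C \<in> orbits X S A"
  shows "f ` C \<in> orbits Y T B"
proof -
  obtain I \<gamma> where C: "C = \<gamma> ` I" "maximal_integral_curve X S I \<gamma>" "\<gamma> ` I \<subseteq> A"
    using assms by (auto simp: orbits_def)
  obtain J \<delta> s where *: "maximal_integral_curve Y T J \<delta>" "\<delta> ` J \<subseteq> B" "s ` I = J"
    "\<forall>t\<in>I. f (\<gamma> t) = \<delta> (s t)"
    using maximal_image[OF C(2,3)] by blast
  have "f ` C = \<delta> ` J"
    unfolding C(1) *(3)[symmetric] image_image using *(4) by (intro image_cong) auto
  then show ?thesis using *(1,2) unfolding orbits_def by blast
qed

lemma orbits_image: "(\<lambda>C. f ` C) ` orbits X S A = orbits Y T B"
proof
  interpret inv: time_changed_conjugacy Y T B X S A h f "\<lambda>w. 1 / c (h w)" by (rule flip)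
  show "(\<lambda>C. f ` C) ` orbits X S A \<subseteq> orbits Y T B" using orbit_image by blast
  show "orbits Y T B \<subseteq> (\<lambda>C. f ` C) ` orbits X S A"
  proof
    fix D assume D: "D \<in> orbits Y T B"
    then have "D \<subseteq> B" by (auto simp: orbits_def)
    then have "f ` h ` D = id ` D"
      unfolding image_image using homeo by (intro image_cong) (auto simp: homeomorphism_def)
    then show "D \<in> (\<lambda>C. f ` C) ` orbits X S A"
      using inv.orbit_image[OF D] by (metis imageI image_id id_apply)
  qed
qed

lemma topological_equivalence: "topological_equivalence X S A Y T B f"
  unfolding topological_equivalence_def
proof (intro conjI)
  show "flow_invariant X S A" "flow_invariant Y T B"
    unfolding flow_invariant_def maximal_integral_curve_def
    using A_subset B_subset A_invariant B_invariant by meson+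
  show "\<exists>f'. homeomorphism A B f f'" using homeo by blast
  show "maps_orbits_oriented X S A Y T f"
    unfolding maps_orbits_oriented_def by (intro allI impI) (use maximal_image in fast)
  show "(\<lambda>C. f ` C) ` orbits X S A = orbits Y T B" by (rule orbits_image)
qed

end

subsection \<open>McGehee coordinates\<close>

text \<open>An explicit formula on the ambient space, so that it can be differentiated and expanded;
  it inverts \<open>mcgehee_map\<close> away from \<open>x = 0\<close>.\<close>

definition mcgehee_inverse :: "nat \<Rightarrow> (real^'n) \<times> (real^'n) \<Rightarrow> real \<times> (real^'n) \<times> (real^'n)" where
  "mcgehee_inverse l = (\<lambda>(x, v). (norm x, x /\<^sub>R norm x, norm x powr - (real l / 2) *\<^sub>R v))"

definition mcgehee_interior :: "real \<Rightarrow> (real \<times> (real^'n) \<times> (real^'n)) set" where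
  "mcgehee_interior r\<^sub>E = {(r, q, y). 0 < r \<and> r < r\<^sub>E \<and> norm q = 1}"

lemma mcgehee_interior_eq: "mcgehee_interior r\<^sub>E = mcgehee_space r\<^sub>E - mcgehee_boundary"
  by (auto simp: mcgehee_interior_def mcgehee_space_def mcgehee_boundary_def)

lemma mcgehee_space_cases:
  assumes "z \<in> mcgehee_space r\<^sub>E"
  shows "z \<in> mcgehee_boundary \<or> z \<in> mcgehee_interior r\<^sub>E"
  using assms by (auto simp: mcgehee_interior_eq)

lemma mcgehee_inverse_map:
  assumes "z \<in> mcgehee_interior r\<^sub>E"
  shows "mcgehee_inverse l (mcgehee_map l z) = z"
proof -
  obtain r q y where "z = (r, q, y)" "0 < r" "norm q = 1"
    using assms by (auto simp: mcgehee_interior_def)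
  then show ?thesis
    by (simp add: mcgehee_inverse_def mcgehee_map_def flip: powr_add)
qed

lemma mcgehee_map_inverse:
  assumes "fst w \<noteq> 0"
  shows "mcgehee_map l (mcgehee_inverse l w) = w"
  using assms by (cases w) (simp add: mcgehee_inverse_def mcgehee_map_def flip: powr_add)

lemma mcgehee_inverse_in_interior:
  assumes "fst w \<noteq> 0" "norm (fst w) < r\<^sub>E"
  shows "mcgehee_inverse l w \<in> mcgehee_interior r\<^sub>E"
  using assms by (cases w) (simp add: mcgehee_inverse_def mcgehee_interior_def)

lemma mcgehee_map_interior:
  assumes "z \<in> mcgehee_interior r\<^sub>E"
  shows "fst (mcgehee_map l z) \<noteq> 0" "norm (fst (mcgehee_map l z)) < r\<^sub>E"
  using assms by (auto simp: mcgehee_interior_def mcgehee_map_def)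

lemma the_inv_into_mcgehee_map:
  assumes "fst w \<noteq> 0" "norm (fst w) < r\<^sub>E"
  shows "the_inv_into (mcgehee_interior r\<^sub>E) (mcgehee_map l) w = mcgehee_inverse l w"
proof (rule the_inv_into_f_eq)
  show "inj_on (mcgehee_map l) (mcgehee_interior r\<^sub>E)"
    by (rule inj_on_inverseI[where g = "mcgehee_inverse l"]) (rule mcgehee_inverse_map)
qed (use assms in \<open>auto simp: mcgehee_map_inverse mcgehee_inverse_in_interior\<close>)

definition mcgehee_inverse_deriv ::
  "nat \<Rightarrow> (real^'n) \<times> (real^'n) \<Rightarrow> (real^'n) \<times> (real^'n) \<Rightarrow> real \<times> (real^'n) \<times> (real^'n)" where
  "mcgehee_inverse_deriv l = (\<lambda>(x, v) (a, b).
     (a \<bullet> sgn x,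
      a /\<^sub>R norm x - (a \<bullet> sgn x / norm x ^ 2) *\<^sub>R x,
      norm x powr - (real l / 2) *\<^sub>R b
        - (real l / 2 * norm x powr (- (real l / 2) - 1) * (a \<bullet> sgn x)) *\<^sub>R v))"

lemma mcgehee_inverse_has_derivative:
  assumes x: "x \<noteq> 0"
  shows "(mcgehee_inverse l has_derivative mcgehee_inverse_deriv l (x, v)) (at (x, v))"
proof -
  have N: "((\<lambda>p. norm (fst p)) has_derivative (\<lambda>p. fst p \<bullet> sgn x)) (at (x, v))"
  proof -
    have "(norm has_derivative (\<lambda>h. h \<bullet> sgn x)) (at (fst (x, v)))"
      using has_derivative_norm[OF x] by simp
    from has_derivative_compose[OF has_derivative_fst[OF has_derivative_ident] this]
    show ?thesis by simp
  qed
  have "((\<lambda>r. r powr - (real l / 2)) has_real_derivative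
      - (real l / 2) * norm x powr (- (real l / 2) - 1)) (at (norm (fst (x, v))))"
    using x has_real_derivative_powr[of "norm x" "- (real l / 2)"] by simp
  note P = DERIV_compose_FDERIV[OF this N]
  have "((\<lambda>r. inverse r) has_real_derivative - (1 / norm x ^ 2)) (at (norm (fst (x, v))))"
    using x by (auto intro!: derivative_eq_intros simp: power2_eq_square field_simps)
  note R = DERIV_compose_FDERIV[OF this N]
  have "(mcgehee_inverse l has_derivative (\<lambda>p. (fst p \<bullet> sgn x,
        inverse (norm (fst (x, v))) *\<^sub>R fst p + (fst p \<bullet> sgn x * - (1 / norm x ^ 2)) *\<^sub>R fst (x, v),
        norm (fst (x, v)) powr - (real l / 2) *\<^sub>R snd p +
          (fst p \<bullet> sgn x * (- (real l / 2) * norm x powr (- (real l / 2) - 1))) *\<^sub>R snd (x, v)))) (at (x, v))"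
    unfolding mcgehee_inverse_def case_prod_unfold
    by (intro has_derivative_Pair N has_derivative_scaleR R P has_derivative_fst has_derivative_snd has_derivative_ident)
  then show ?thesis
    by (rule has_derivative_eq_rhs) (auto simp: mcgehee_inverse_deriv_def algebra_simps)
qed

lemma EL_field_Pair: "EL_field g U \<mu> (x, v) = (v, snd (EL_field g U \<mu> (x, v)))"
  by (simp add: EL_field_def)

text \<open>Only the first component \<open>v\<close> of the Euler-Lagrange field enters the radial
  and spherical parts, and it is \<open>r^(l/2) y\<close> for every system; the acceleration
  \<open>b\<close> stays symbolic. The exponent \<open>1 - l\<close> is
  \<open>(1 - l/2) - l/2\<close>.\<close>

lemma scaled_mcgehee_inverse_deriv:
  assumes r: "0 < r" and q: "norm q = 1"
  shows "r powr (1 - real l / 2) *\<^sub>R mcgehee_inverse_deriv l (mcgehee_map l (r, q, y)) (r powr (real l / 2) *\<^sub>R y, b) =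
    (r * (q \<bullet> y), y - (q \<bullet> y) *\<^sub>R q, r powr (1 - real l) *\<^sub>R b - (real l / 2 * (q \<bullet> y)) *\<^sub>R y)"
proof -
  define c where "c = real l / 2"
  have sgn: "sgn (r *\<^sub>R q) = q" using r q by (simp add: sgn_div_norm)
  have n: "norm (r *\<^sub>R q) = r" using r q by simp
  have 1: "r powr (1 - c) * r powr c = r" using r by (simp flip: powr_add)
  have 2: "r powr (1 - c) * r powr - c = r powr (1 - real l)"
    by (simp add: c_def flip: powr_add)
  have 3: "r powr (1 - c) * (r powr (- c - 1) * (r powr c * r powr c)) = 1"
    using r by (simp flip: powr_add)
  have "r powr (1 - c) * ((r powr c *\<^sub>R y) \<bullet> q) = r * (q \<bullet> y)"
    using 1 by (simp add: inner_commute mult.assoc[symmetric])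
  moreover have "r powr (1 - c) *\<^sub>R ((r powr c *\<^sub>R y) /\<^sub>R r - (((r powr c *\<^sub>R y) \<bullet> q) / r ^ 2) *\<^sub>R r *\<^sub>R q)
      = y - (q \<bullet> y) *\<^sub>R q"
  proof -
    have a: "r powr (1 - c) * (inverse r * r powr c) = 1"
      using 1 r by (simp add: field_simps)
    have b: "r powr (1 - c) * (((r powr c *\<^sub>R y) \<bullet> q) / r ^ 2 * r) = q \<bullet> y"
      using 1 r by (simp add: inner_commute power2_eq_square field_simps)
    show ?thesis using a b by (simp add: scaleR_diff_right)
  qed
  moreover have "r powr (1 - c) *\<^sub>R (r powr - c *\<^sub>R b - (c * r powr (- c - 1) * ((r powr c *\<^sub>R y) \<bullet> q)) *\<^sub>R (r powr c *\<^sub>R y))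
      = r powr (1 - real l) *\<^sub>R b - (c * (q \<bullet> y)) *\<^sub>R y"
  proof -
    have "r powr (1 - c) * (c * r powr (- c - 1) * ((r powr c *\<^sub>R y) \<bullet> q) * r powr c)
        = (r powr (1 - c) * (r powr (- c - 1) * (r powr c * r powr c))) * (c * (q \<bullet> y))"
      by (simp add: inner_commute)
    then show ?thesis using 2 3 by (simp add: scaleR_diff_right)
  qed
  ultimately show ?thesis
    unfolding mcgehee_map_def mcgehee_inverse_deriv_def c_def by (simp only: prod.case sgn n scaleR_Pair) auto
qed

text \<open>At \<open>r = 0\<close> the convention \<open>0 powr a = 0\<close> drops the
  acceleration, so this formula represents the field in the interior only; the boundary value is its
  limit.\<close>

definition mcgehee_interior_field ::
  "nat \<Rightarrow> (real^'n \<Rightarrow> real^'n^'n) \<Rightarrow> (real^'n \<Rightarrow> real) \<Rightarrow> (real^'n \<Rightarrow> real^'n) \<Rightarrow>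
   real \<times> (real^'n) \<times> (real^'n) \<Rightarrow> real \<times> (real^'n) \<times> (real^'n)" where
  "mcgehee_interior_field l g U \<mu> = (\<lambda>(r, q, y).
     (r * (q \<bullet> y), y - (q \<bullet> y) *\<^sub>R q,
      r powr (1 - real l) *\<^sub>R snd (EL_field g U \<mu> (mcgehee_map l (r, q, y))) - (real l / 2 * (q \<bullet> y)) *\<^sub>R y))"

lemma mcgehee_interior_field_eq:
  assumes z: "z \<in> mcgehee_interior r\<^sub>E"
  shows "fst z powr (1 - real l / 2) *\<^sub>R mcgehee_inverse_deriv l (mcgehee_map l z) (EL_field g U \<mu> (mcgehee_map l z))
    = mcgehee_interior_field l g U \<mu> z"
proof -
  obtain r q y where *: "z = (r, q, y)" "0 < r" "norm q = 1"
    using z by (auto simp: mcgehee_interior_def)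
  have "EL_field g U \<mu> (mcgehee_map l z)
      = (r powr (real l / 2) *\<^sub>R y, snd (EL_field g U \<mu> (mcgehee_map l z)))"
    using EL_field_Pair[of g U \<mu> "r *\<^sub>R q" "r powr (real l / 2) *\<^sub>R y"] by (simp add: * mcgehee_map_def)
  then show ?thesis
    using scaled_mcgehee_inverse_deriv[OF *(2,3), of l y "snd (EL_field g U \<mu> (mcgehee_map l z))"]
    by (simp add: mcgehee_interior_field_def *(1))
qed

text \<open>\<open>the_inv_into\<close> is unspecified off the image of the interior, but a
  derivative depends only on the germ, and that image is the open set
  \<open>0 < norm x < r\<^sub>E\<close>.\<close>

lemma frechet_derivative_the_inv_mcgehee_map:
  fixes w :: "(real^'n) \<times> (real^'n)"
  assumes w: "fst w \<noteq> 0" "norm (fst w) < r\<^sub>E"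
  shows "frechet_derivative (the_inv_into (mcgehee_space r\<^sub>E - mcgehee_boundary) (mcgehee_map l)) (at w)
    = mcgehee_inverse_deriv l w"
proof -
  obtain x v where xv: "w = (x, v)" by (cases w)
  have D: "(mcgehee_inverse l has_derivative mcgehee_inverse_deriv l w) (at w)"
    using mcgehee_inverse_has_derivative w by (simp add: xv)
  define W :: "((real^'n) \<times> (real^'n)) set" where "W = (ball 0 r\<^sub>E - {0}) \<times> UNIV"
  have "(the_inv_into (mcgehee_interior r\<^sub>E) (mcgehee_map l) has_derivative mcgehee_inverse_deriv l w) (at w)"
  proof (rule has_derivative_transform_within_open[OF D])
    show "open W" unfolding W_def by (intro open_Times open_Diff) auto
    show "w \<in> W" using w by (simp add: W_def xv)
    show "mcgehee_inverse l w' = the_inv_into (mcgehee_interior r\<^sub>E) (mcgehee_map l) w'" if "w' \<in> W" for w'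
      using that by (subst the_inv_into_mcgehee_map) (auto simp: W_def)
  qed
  then show ?thesis
    by (simp add: mcgehee_interior_eq frechet_derivative_at[symmetric])
qed

lemma mcgehee_field_interior:
  assumes z: "z \<in> mcgehee_interior r\<^sub>E"
  shows "mcgehee_field r\<^sub>E l g U \<mu> z = mcgehee_interior_field l g U \<mu> z"
proof -
  have "z \<notin> mcgehee_boundary" using z by (auto simp: mcgehee_interior_eq)
  then show ?thesis
    unfolding mcgehee_field_def mcgehee_extend_def
    using mcgehee_interior_field_eq[OF z] mcgehee_map_interior[OF z]
    by (simp add: frechet_derivative_the_inv_mcgehee_map)
qed

text \<open>The points \<open>(r, q, y)\<close> with \<open>r\<close> decreasing to 0 approach the
  boundary point. On a trivial filter \<open>Lim\<close> would not determine a value.\<close>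

lemma mcgehee_boundary_islimpt:
  assumes r: "r\<^sub>E > 0" and z: "z \<in> (mcgehee_boundary :: (real \<times> (real^'n) \<times> (real^'n)) set)"
  shows "at z within mcgehee_interior r\<^sub>E \<noteq> bot"
proof -
  obtain q y where q: "z = (0, q, y)" "norm q = 1" using z by (auto simp: mcgehee_boundary_def)
  have "((\<lambda>r. (r, q, y)) \<longlongrightarrow> (0, q, y)) (at_right 0)"
    by (intro tendsto_intros)
  moreover have "\<forall>\<^sub>F r in at_right 0. (r, q, y) \<in> mcgehee_interior r\<^sub>E \<and> (r, q, y) \<noteq> (0, q, y)"
    using eventually_at_right_less[of 0] eventually_at_right_field[of "\<lambda>r. r < r\<^sub>E" 0] r q(2)
    by (auto simp: mcgehee_interior_def eventually_at_right_field)
  ultimately have "filterlim (\<lambda>r. (r, q, y)) (at (0, q, y) within mcgehee_interior r\<^sub>E) (at_right 0)"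
    unfolding filterlim_at by (auto elim: eventually_mono)
  then show ?thesis
    unfolding q using filterlim_filtermap filtermap_bot_iff trivial_limit_at_right_real
    by (metis filterlim_def le_bot)
qed

text \<open>On the interior the expression under \<open>Lim\<close> is
  \<open>mcgehee_interior_field\<close>, so a limit of that formula is enough.\<close>

lemma mcgehee_field_boundary:
  assumes r: "r\<^sub>E > 0" and z: "z \<in> mcgehee_boundary"
    and lim: "(mcgehee_interior_field l g U \<mu> \<longlongrightarrow> L) (at z within mcgehee_interior r\<^sub>E)"
  shows "mcgehee_field r\<^sub>E l g U \<mu> z = L"
proof -
  have "((\<lambda>z. fst z powr (1 - real l / 2) *\<^sub>R
       frechet_derivative (the_inv_into (mcgehee_space r\<^sub>E - mcgehee_boundary) (mcgehee_map l))
         (at (mcgehee_map l z)) (EL_field g U \<mu> (mcgehee_map l z))) \<longlongrightarrow> L) (at z within mcgehee_interior r\<^sub>E)"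
    by (rule Lim_transform_within[OF lim zero_less_one])
      (simp add: frechet_derivative_the_inv_mcgehee_map mcgehee_map_interior mcgehee_interior_field_eq[symmetric])
  then show ?thesis
    unfolding mcgehee_field_def mcgehee_extend_def mcgehee_interior_eq[symmetric]
    using z tendsto_Lim[OF mcgehee_boundary_islimpt[OF r z]] by simp
qed

lemma mcgehee_energy_interior:
  assumes z: "z \<in> mcgehee_interior r\<^sub>E"
  shows "mcgehee_energy r\<^sub>E l g U z = energy g U (mcgehee_map l z) / fst z ^ l"
  using z unfolding mcgehee_energy_def mcgehee_extend_def by (auto simp: mcgehee_interior_eq)

lemma mcgehee_energy_boundary:
  assumes r: "r\<^sub>E > 0" and z: "z \<in> mcgehee_boundary"
    and lim: "((\<lambda>z. energy g U (mcgehee_map l z) / fst z ^ l) \<longlongrightarrow> L) (at z within mcgehee_interior r\<^sub>E)"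
  shows "mcgehee_energy r\<^sub>E l g U z = L"
  unfolding mcgehee_energy_def mcgehee_extend_def mcgehee_interior_eq[symmetric]
  using z tendsto_Lim[OF mcgehee_boundary_islimpt[OF r z] lim] by simp

text \<open>The curve is differentiated in coordinates: the ambient space of \<open>M\<close> has
  one dimension more than that of \<open>TE\<close>, so the derivative of
  \<open>mcgehee_inverse l\<close> cannot simply be inverted there.\<close>

lemma mcgehee_push:
  assumes \<gamma>: "(\<gamma> has_vector_derivative mcgehee_interior_field l g U \<mu> (\<gamma> t)) (at t)"
    and int: "\<gamma> t \<in> mcgehee_interior r\<^sub>E"
  shows "((\<lambda>t. mcgehee_map l (\<gamma> t)) has_vector_derivative
    fst (\<gamma> t) powr (1 - real l / 2) *\<^sub>R EL_field g U \<mu> (mcgehee_map l (\<gamma> t))) (at t)"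
proof -
  define r q y where "r t = fst (\<gamma> t)" and "q t = fst (snd (\<gamma> t))" and "y t = snd (snd (\<gamma> t))" for t
  have \<gamma>_eq: "\<gamma> t = (r t, q t, y t)" for t by (simp add: r_def q_def y_def)
  have pos: "r t > 0" using int by (simp add: \<gamma>_eq mcgehee_interior_def)
  define c where "c = real l / 2"
  define b where "b = snd (EL_field g U \<mu> (mcgehee_map l (\<gamma> t)))"
  have EL: "EL_field g U \<mu> (mcgehee_map l (\<gamma> t)) = (r t powr c *\<^sub>R y t, b)"
    using EL_field_Pair[of g U \<mu> "r t *\<^sub>R q t" "r t powr c *\<^sub>R y t"]
    by (simp add: \<gamma>_eq mcgehee_map_def b_def c_def)
  have \<gamma>': "(\<gamma> has_vector_derivative (r t * (q t \<bullet> y t), y t - (q t \<bullet> y t) *\<^sub>R q t,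
      r t powr (1 - real l) *\<^sub>R b - (c * (q t \<bullet> y t)) *\<^sub>R y t)) (at t)"
    using \<gamma> by (simp add: mcgehee_interior_field_def \<gamma>_eq b_def c_def)
  have r': "(r has_real_derivative r t * (q t \<bullet> y t)) (at t)"
    using bounded_linear.has_vector_derivative[OF bounded_linear_fst \<gamma>']
    unfolding r_def[abs_def] has_real_derivative_iff_has_vector_derivative by simp
  note s' = bounded_linear.has_vector_derivative[OF bounded_linear_snd \<gamma>']
  have q': "(q has_vector_derivative y t - (q t \<bullet> y t) *\<^sub>R q t) (at t)"
    using bounded_linear.has_vector_derivative[OF bounded_linear_fst s']
    unfolding q_def[abs_def] by simp
  have y': "(y has_vector_derivative r t powr (1 - real l) *\<^sub>R b - (c * (q t \<bullet> y t)) *\<^sub>R y t) (at t)"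
    using bounded_linear.has_vector_derivative[OF bounded_linear_snd s']
    unfolding y_def[abs_def] by simp
  have "((\<lambda>t. r t powr c) has_real_derivative c * r t powr (c - 1) * (r t * (q t \<bullet> y t))) (at t)"
    by (rule DERIV_chain2[OF has_real_derivative_powr[OF pos] r'])
  moreover have "r t powr (c - 1) * r t = r t powr c"
    using pos powr_add[of "r t" "c - 1" 1] by simp
  then have "c * r t powr (c - 1) * (r t * (q t \<bullet> y t)) = c * (q t \<bullet> y t) * r t powr c"
    by (metis mult.assoc mult.commute)
  ultimately have p': "((\<lambda>t. r t powr c) has_real_derivative c * (q t \<bullet> y t) * r t powr c) (at t)"
    by simp
  \<comment> \<open>The exponents add up: \<open>l/2 + (1 - l) = 1 - l/2\<close> and
    \<open>(1 - l/2) + l/2 = 1\<close>.\<close>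
  have pw: "r t powr c * r t powr (1 - real l) = r t powr (1 - c)" "r t powr (1 - c) * r t powr c = r t"
    using pos by (simp_all add: c_def flip: powr_add)
  have 1: "r t *\<^sub>R (y t - (q t \<bullet> y t) *\<^sub>R q t) + (r t * (q t \<bullet> y t)) *\<^sub>R q t = r t powr (1 - c) *\<^sub>R r t powr c *\<^sub>R y t"
    using pw by (simp add: algebra_simps)
  have 2: "r t powr c *\<^sub>R (r t powr (1 - real l) *\<^sub>R b - (c * (q t \<bullet> y t)) *\<^sub>R y t) + (c * (q t \<bullet> y t) * r t powr c) *\<^sub>R y t
      = r t powr (1 - c) *\<^sub>R b"
    using pw by (simp add: scaleR_diff_right mult_ac)
  have "((\<lambda>t. (r t *\<^sub>R q t, r t powr c *\<^sub>R y t)) has_vector_derivative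
      (r t *\<^sub>R (y t - (q t \<bullet> y t) *\<^sub>R q t) + (r t * (q t \<bullet> y t)) *\<^sub>R q t,
       r t powr c *\<^sub>R (r t powr (1 - real l) *\<^sub>R b - (c * (q t \<bullet> y t)) *\<^sub>R y t) + (c * (q t \<bullet> y t) * r t powr c) *\<^sub>R y t)) (at t)"
    by (intro has_vector_derivative_Pair has_vector_derivative_scaleR r' q' y' p')
  then have "((\<lambda>t. (r t *\<^sub>R q t, r t powr c *\<^sub>R y t)) has_vector_derivative
      (r t powr (1 - c) *\<^sub>R r t powr c *\<^sub>R y t, r t powr (1 - c) *\<^sub>R b)) (at t)"
    unfolding 1 2 .
  then show ?thesis
    unfolding EL by (simp add: mcgehee_map_def \<gamma>_eq c_def)
qed

lemma mcgehee_pull: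
  assumes \<delta>: "(\<delta> has_vector_derivative EL_field g U \<mu> (\<delta> t)) (at t)"
    and dom: "fst (\<delta> t) \<noteq> 0" "norm (fst (\<delta> t)) < r\<^sub>E"
  shows "((\<lambda>t. mcgehee_inverse l (\<delta> t)) has_vector_derivative
    (1 / fst (mcgehee_inverse l (\<delta> t)) powr (1 - real l / 2)) *\<^sub>R
      mcgehee_interior_field l g U \<mu> (mcgehee_inverse l (\<delta> t))) (at t)"
proof -
  define z where "z = mcgehee_inverse l (\<delta> t)"
  have z: "z \<in> mcgehee_interior r\<^sub>E" and map: "mcgehee_map l z = \<delta> t"
    using dom by (simp_all add: z_def mcgehee_inverse_in_interior mcgehee_map_inverse)
  have pos: "fst z > 0" using z by (auto simp: mcgehee_interior_def)
  have "(mcgehee_inverse l has_derivative mcgehee_inverse_deriv l (\<delta> t)) (at (\<delta> t))"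
    using mcgehee_inverse_has_derivative[OF dom(1), of l "snd (\<delta> t)"] by simp
  then have "((mcgehee_inverse l \<circ> \<delta>) has_vector_derivative mcgehee_inverse_deriv l (\<delta> t) (EL_field g U \<mu> (\<delta> t))) (at t)"
    using \<delta> by (intro vector_derivative_diff_chain_within) (auto intro: has_derivative_at_withinI)
  moreover have "(1 / fst z powr (1 - real l / 2)) *\<^sub>R mcgehee_interior_field l g U \<mu> z
      = mcgehee_inverse_deriv l (\<delta> t) (EL_field g U \<mu> (\<delta> t))"
    using mcgehee_interior_field_eq[OF z, of l g U \<mu>, symmetric] pos by (simp add: map)
  ultimately show ?thesis by (simp add: o_def z_def)
qed

subsection \<open>The Euler-Lagrange field near the critical point\<close>

lemma partial_eq:
  assumes "(f has_derivative D) (at x)"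
  shows "partial i f x = D (axis i 1)"
  unfolding partial_def frechet_derivative_at[OF assms, symmetric] ..

lemma has_derivative_partials:
  fixes f :: "real^'n \<Rightarrow> real"
  assumes "f differentiable (at x)"
  shows "(f has_derivative (\<lambda>v. \<Sum>k\<in>UNIV. v $ k * partial k f x)) (at x)"
proof -
  let ?D = "frechet_derivative f (at x)"
  have D: "(f has_derivative ?D) (at x)"
    using assms by (simp add: frechet_derivative_works)
  then have lin: "linear ?D" by (rule has_derivative_linear)
  have "?D v = (\<Sum>k\<in>UNIV. v $ k * partial k f x)" for v
  proof -
    have "v = (\<Sum>k\<in>UNIV. v $ k *\<^sub>R axis k 1)"
      using basis_expansion[of v] by (simp add: scalar_mult_eq_scaleR)
    then have "?D v = (\<Sum>k\<in>UNIV. ?D (v $ k *\<^sub>R axis k 1))"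
      by (metis (no_types, lifting) lin linear_sum sum.cong)
    then show ?thesis
      by (simp add: linear_scale[OF lin] partial_def)
  qed
  then show ?thesis using D by (metis (no_types, lifting) has_derivative_eq_rhs ext)
qed

lemma abs_bilinear_sum_le:
  fixes v :: "real^'n"
  assumes "\<And>i j. \<bar>c i j\<bar> \<le> C"
  shows "\<bar>\<Sum>i\<in>UNIV. \<Sum>j\<in>UNIV. c i j * v $ i * v $ j\<bar> \<le> real CARD('n) * (real CARD('n) * (C * norm v ^ 2))"
proof -
  have t: "\<bar>c i j * v $ i * v $ j\<bar> \<le> C * norm v ^ 2" for i j
  proof -
    have "\<bar>c i j\<bar> * (\<bar>v $ i\<bar> * \<bar>v $ j\<bar>) \<le> C * (norm v * norm v)"
      using assms[of i j] by (intro mult_mono component_le_norm_cart) auto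
    then show ?thesis by (simp add: abs_mult power2_eq_square mult.assoc)
  qed
  have s: "\<bar>\<Sum>j\<in>UNIV. c i j * v $ i * v $ j\<bar> \<le> real CARD('n) * (C * norm v ^ 2)" for i
    by (rule order_trans[OF sum_abs sum_bounded_above]) (rule t)
  show ?thesis
    by (rule order_trans[OF sum_abs sum_bounded_above]) (rule s)
qed

lemma norm_cart_le:
  fixes w :: "real^'n"
  assumes "\<And>i. \<bar>w $ i\<bar> \<le> C"
  shows "norm w \<le> real CARD('n) * C"
  by (rule order_trans[OF norm_le_l1_cart]) (use assms in \<open>auto intro: sum_bounded_above\<close>)

text \<open>The consequences of analyticity that the McGehee blow-up uses; \<open>Ul\<close> is the leading
  homogeneous term of \<open>U\<close> and \<open>dUl\<close> its gradient.\<close>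

locale em_system =
  fixes r\<^sub>E :: real and g :: "real^'n \<Rightarrow> real^'n^'n" and U :: "real^'n \<Rightarrow> real"
    and \<mu> :: "real^'n \<Rightarrow> real^'n" and l :: nat
    and Ul :: "real^'n \<Rightarrow> real" and dUl :: "real^'n \<Rightarrow> real^'n"
  assumes rE_pos: "r\<^sub>E > 0" and l_ge: "2 \<le> l"
    and g_sym: "\<And>x. x \<in> ball 0 r\<^sub>E \<Longrightarrow> transpose (g x) = g x"
    and g_posdef: "\<And>x v. x \<in> ball 0 r\<^sub>E \<Longrightarrow> v \<noteq> 0 \<Longrightarrow> v \<bullet> (g x *v v) > 0"
    and g_0: "g 0 = mat 1"
    and g_diff: "\<And>x i j. x \<in> ball 0 r\<^sub>E \<Longrightarrow> (\<lambda>y. g y $ i $ j) differentiable (at x)"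
    and g_bound: "\<exists>C. \<forall>\<^sub>F x in nhds 0. \<forall>i j k. \<bar>partial k (\<lambda>y. g y $ i $ j) x\<bar> \<le> C"
    and U_diff: "\<And>x. x \<in> ball 0 r\<^sub>E \<Longrightarrow> U differentiable (at x)"
    and U_0: "U 0 = 0"
    and dU_bound: "\<exists>C. \<forall>\<^sub>F x in nhds 0. \<forall>i. \<bar>partial i U x\<bar> \<le> C * norm x"
    and U_exp: "\<exists>C. \<forall>\<^sub>F x in nhds 0. \<bar>U x - Ul x\<bar> \<le> C * norm x ^ (l + 1)"
    and dU_exp: "\<exists>C. \<forall>\<^sub>F x in nhds 0. \<forall>i. \<bar>partial i U x - dUl x $ i\<bar> \<le> C * norm x ^ l"
    and Ul_hom: "\<And>t x. Ul (t *\<^sub>R x) = t ^ l * Ul x"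
    and Ul_deriv: "\<And>x. (Ul has_derivative (\<lambda>v. dUl x \<bullet> v)) (at x)"
    and dUl_cont: "continuous_on UNIV dUl"
    and mu_bound: "\<exists>C. \<forall>\<^sub>F x in nhds 0. \<forall>i j. \<bar>partial i (\<lambda>y. \<mu> y $ j) x\<bar> \<le> C * norm x powr (real l / 2)"
begin

abbreviation E where "E \<equiv> ball 0 r\<^sub>E :: (real^'n) set"
abbreviation X where "X \<equiv> EL_field g U \<mu>"
abbreviation H where "H \<equiv> energy g U"

text \<open>The Christoffel symbols of the first kind, contracted twice with \<open>v\<close>. With
  the index \<open>m\<close> still lowered, the inverse metric factors out of the whole
  acceleration.\<close>

definition christoffel_lower :: "real^'n \<Rightarrow> real^'n \<Rightarrow> real^'n" where
  "christoffel_lower x v = (\<chi> m. 1/2 * (\<Sum>i\<in>UNIV. \<Sum>j\<in>UNIV.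
     (partial i (\<lambda>y. g y $ m $ j) x + partial j (\<lambda>y. g y $ m $ i) x - partial m (\<lambda>y. g y $ i $ j) x) * v $ i * v $ j))"

definition dU :: "real^'n \<Rightarrow> real^'n" where
  "dU x = (\<chi> i. partial i U x)"

definition momentum_force :: "real^'n \<Rightarrow> real^'n \<Rightarrow> real^'n" where
  "momentum_force x v = - (christoffel_lower x v + dU x + contract_d \<mu> x v)"

lemma acceleration: "snd (X (x, v)) = matrix_inv (g x) *v momentum_force x v"
proof -
  let ?G = "\<lambda>i j m. partial i (\<lambda>y. g y $ m $ j) x + partial j (\<lambda>y. g y $ m $ i) x - partial m (\<lambda>y. g y $ i $ j) x"
  have "(\<Sum>i\<in>UNIV. \<Sum>j\<in>UNIV. christoffel g x k i j * v $ i * v $ j)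
      = (matrix_inv (g x) *v christoffel_lower x v) $ k" for k
  proof -
    have "(\<Sum>i\<in>UNIV. \<Sum>j\<in>UNIV. christoffel g x k i j * v $ i * v $ j)
        = (\<Sum>i\<in>UNIV. \<Sum>j\<in>UNIV. \<Sum>m\<in>UNIV. matrix_inv (g x) $ k $ m * (1/2 * (?G i j m * v $ i * v $ j)))"
      unfolding christoffel_def sum_distrib_left sum_distrib_right
      by (intro sum.cong refl) (simp add: mult_ac)
    \<comment> \<open>Moving the sum over \<open>m\<close> outermost lets the inverse metric act
      once on a vector.\<close>
    also have "\<dots> = (\<Sum>i\<in>UNIV. \<Sum>m\<in>UNIV. \<Sum>j\<in>UNIV. matrix_inv (g x) $ k $ m * (1/2 * (?G i j m * v $ i * v $ j)))"
      by (intro sum.cong refl sum.swap)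
    also have "\<dots> = (\<Sum>m\<in>UNIV. \<Sum>i\<in>UNIV. \<Sum>j\<in>UNIV. matrix_inv (g x) $ k $ m * (1/2 * (?G i j m * v $ i * v $ j)))"
      by (rule sum.swap)
    also have "\<dots> = (matrix_inv (g x) *v christoffel_lower x v) $ k"
      by (simp add: matrix_vector_mult_def christoffel_lower_def sum_distrib_left)
    finally show ?thesis .
  qed
  then have "(\<chi> k. \<Sum>i\<in>UNIV. \<Sum>j\<in>UNIV. christoffel g x k i j * v $ i * v $ j)
      = matrix_inv (g x) *v christoffel_lower x v"
    by (simp add: vec_eq_iff)
  moreover have "matrix_inv (g x) *v - w = - (matrix_inv (g x) *v w)" for w
    using linear_neg[OF matrix_vector_mul_linear] .
  ultimately show ?thesis
    by (simp add: EL_field_def grad_def riesz_def momentum_force_def dU_def matrix_vector_right_distrib matrix_vector_mult_diff_distrib)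
qed

lemma g_invertible:
  assumes "x \<in> E"
  shows "g x ** matrix_inv (g x) = mat 1"
proof -
  \<comment> \<open>Definiteness leaves no kernel, so \<open>matrix_inv\<close>, a choice of some
    inverse, is a genuine one.\<close>
  have "u = 0" if "g x *v u = 0" for u
    using g_posdef[OF assms, of u] that by (cases "u = 0") auto
  then have "invertible (g x)"
    unfolding invertible_left_inverse matrix_left_invertible_ker by blast
  then have "\<exists>B. g x ** B = mat 1 \<and> B ** g x = mat 1"
    by (simp add: invertible_def)
  then show ?thesis
    unfolding matrix_inv_def by (rule someI2_ex) blast
qed

lemma g_acceleration:
  assumes "x \<in> E"
  shows "g x *v snd (X (x, v)) = momentum_force x v"
  using g_invertible[OF assms] by (simp add: acceleration matrix_vector_mul_assoc)

section \<open>Conservation of energy\<close>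

lemma inner_symmetric:
  assumes "x \<in> E"
  shows "u \<bullet> (g x *v w) = (g x *v u) \<bullet> w"
  using dot_lmul_matrix[of u "g x" w] g_sym[OF assms] by (metis vector_transpose_matrix)

text \<open>The magnetic force does no work: \<open>d\<mu>\<close> is antisymmetric, and swapping
  the summation indices cancels the double sum.\<close>

lemma inner_contract_d: "v \<bullet> contract_d \<mu> x v = 0"
proof -
  let ?P = "\<lambda>i j. v $ j * (v $ i * partial i (\<lambda>y. \<mu> y $ j) x)"
  have "v \<bullet> contract_d \<mu> x v = (\<Sum>j\<in>UNIV. \<Sum>i\<in>UNIV. ?P i j - ?P j i)"
    by (simp add: inner_vec_def contract_d_def sum_distrib_left algebra_simps)
  also have "\<dots> = (\<Sum>j\<in>UNIV. \<Sum>i\<in>UNIV. ?P i j) - (\<Sum>j\<in>UNIV. \<Sum>i\<in>UNIV. ?P j i)"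
    by (simp add: sum_subtractf)
  also have "(\<Sum>j\<in>UNIV. \<Sum>i\<in>UNIV. ?P j i) = (\<Sum>j\<in>UNIV. \<Sum>i\<in>UNIV. ?P i j)"
    by (rule sum.swap)
  finally show ?thesis by simp
qed

text \<open>Renaming indices makes the three derivative terms equal, two with sign plus and one with
  minus. What is left is half the derivative of the metric along \<open>v\<close>, evaluated twice
  on \<open>v\<close>: the term produced by differentiating the kinetic energy.\<close>

lemma inner_christoffel_lower:
  "v \<bullet> christoffel_lower x v
    = 1/2 * (\<Sum>i\<in>UNIV. \<Sum>j\<in>UNIV. v $ i * (\<Sum>k\<in>UNIV. v $ k * partial k (\<lambda>y. g y $ i $ j) x) * v $ j)"
proof -
  define D where "D i m j = partial i (\<lambda>y. g y $ m $ j) x * (v $ m * v $ i * v $ j)" for i m j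
  define T where "T = (\<Sum>m\<in>UNIV. \<Sum>i\<in>UNIV. \<Sum>j\<in>UNIV. D m i j)"
  have a: "(\<Sum>m\<in>UNIV. \<Sum>i\<in>UNIV. \<Sum>j\<in>UNIV. D i m j) = T"
    unfolding T_def by (rule sum.swap)
  have "(\<Sum>m\<in>UNIV. \<Sum>i\<in>UNIV. \<Sum>j\<in>UNIV. D j m i) = (\<Sum>m\<in>UNIV. \<Sum>j\<in>UNIV. \<Sum>i\<in>UNIV. D j m i)"
    by (intro sum.cong refl sum.swap)
  also have "\<dots> = T" using a .
  finally have b: "(\<Sum>m\<in>UNIV. \<Sum>i\<in>UNIV. \<Sum>j\<in>UNIV. D j m i) = T" .
  have "v \<bullet> christoffel_lower x v = (\<Sum>m\<in>UNIV. \<Sum>i\<in>UNIV. \<Sum>j\<in>UNIV. 1/2 * (D i m j + D j m i - D m i j))"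
    unfolding inner_vec_def christoffel_lower_def D_def
    by (auto simp: sum_distrib_left algebra_simps intro!: sum.cong)
  also have "\<dots> = 1/2 * (T + T - T)"
    unfolding sum_distrib_left[symmetric] sum_subtractf sum.distrib a b T_def[symmetric] ..
  also have "T = (\<Sum>i\<in>UNIV. \<Sum>m\<in>UNIV. \<Sum>j\<in>UNIV. D m i j)"
    unfolding T_def by (rule sum.swap)
  also have "\<dots> = (\<Sum>i\<in>UNIV. \<Sum>j\<in>UNIV. \<Sum>m\<in>UNIV. D m i j)"
    by (intro sum.cong refl sum.swap)
  also have "\<dots> = (\<Sum>i\<in>UNIV. \<Sum>j\<in>UNIV. v $ i * (\<Sum>k\<in>UNIV. v $ k * partial k (\<lambda>y. g y $ i $ j) x) * v $ j)"
    by (intro sum.cong refl) (simp add: D_def sum_distrib_left sum_distrib_right mult_ac)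
  finally show ?thesis by simp
qed

lemma energy_eq_sum: "H (x, v) = 1/2 * (\<Sum>i\<in>UNIV. \<Sum>j\<in>UNIV. v $ i * g x $ i $ j * v $ j) + U x"
  by (simp add: energy_def inner_vec_def matrix_vector_mult_def sum_distrib_left mult.assoc)

lemma energy_deriv:
  assumes \<delta>: "(\<delta> has_vector_derivative X (\<delta> t)) (at t)" and dom: "fst (\<delta> t) \<in> E"
  shows "((\<lambda>t. H (\<delta> t)) has_real_derivative 0) (at t)"
proof -
  define x v where "x t = fst (\<delta> t)" and "v t = snd (\<delta> t)" for t
  have \<delta>_eq: "\<delta> t = (x t, v t)" for t by (simp add: x_def v_def)
  have xE: "x t \<in> E" using dom by (simp add: x_def)
  define a where "a = snd (X (\<delta> t))"
  have \<delta>': "(\<delta> has_vector_derivative (v t, a)) (at t)"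
    using \<delta> EL_field_Pair[of g U \<mu> "x t" "v t"] by (simp add: a_def \<delta>_eq)
  have x': "(x has_vector_derivative v t) (at t)"
    using bounded_linear.has_vector_derivative[OF bounded_linear_fst \<delta>'] unfolding x_def[abs_def] by simp
  have v': "(v has_vector_derivative a) (at t)"
    using bounded_linear.has_vector_derivative[OF bounded_linear_snd \<delta>'] unfolding v_def[abs_def] by simp
  have vi: "((\<lambda>t. v t $ i) has_real_derivative a $ i) (at t)" for i
    using bounded_linear.has_vector_derivative[OF bounded_linear_vec_nth v']
    by (simp add: has_real_derivative_iff_has_vector_derivative)
  have comp: "((\<lambda>t. f (x t)) has_real_derivative (\<Sum>k\<in>UNIV. v t $ k * partial k f (x t))) (at t)"
    if "f differentiable (at (x t))" for f :: "real^'n \<Rightarrow> real"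
    using vector_derivative_diff_chain_within[of x "v t" t UNIV f "\<lambda>v. \<Sum>k\<in>UNIV. v $ k * partial k f (x t)"]
      x' has_derivative_partials[OF that]
    by (auto simp: has_real_derivative_iff_has_vector_derivative o_def intro: has_derivative_at_withinI)
  define Dg where "Dg i j = (\<Sum>k\<in>UNIV. v t $ k * partial k (\<lambda>y. g y $ i $ j) (x t))" for i j
  have gij: "((\<lambda>t. g (x t) $ i $ j) has_real_derivative Dg i j) (at t)" for i j
    unfolding Dg_def by (rule comp) (rule g_diff[OF xE])
  have Ut: "((\<lambda>t. U (x t)) has_real_derivative v t \<bullet> dU (x t)) (at t)"
    using comp[OF U_diff[OF xE]] by (simp add: inner_vec_def dU_def)
  have "((\<lambda>t. H (\<delta> t)) has_real_derivative
      1/2 * (\<Sum>i\<in>UNIV. \<Sum>j\<in>UNIV.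
        (a $ i * g (x t) $ i $ j + Dg i j * v t $ i) * v t $ j + a $ j * (v t $ i * g (x t) $ i $ j))
      + v t \<bullet> dU (x t)) (at t)"
    unfolding \<delta>_eq energy_eq_sum
    by (intro DERIV_add DERIV_cmult DERIV_sum DERIV_mult vi gij Ut)
  \<comment> \<open>The two occurrences of the acceleration agree by symmetry of \<open>g\<close>;
    replacing \<open>g a\<close> by the force cancels the derivatives of the metric and of
    \<open>U\<close>.\<close>
  moreover have "1/2 * (\<Sum>i\<in>UNIV. \<Sum>j\<in>UNIV.
        (a $ i * g (x t) $ i $ j + Dg i j * v t $ i) * v t $ j + a $ j * (v t $ i * g (x t) $ i $ j))
      + v t \<bullet> dU (x t) = 0"
  proof -
    have "(\<Sum>i\<in>UNIV. \<Sum>j\<in>UNIV.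
        (a $ i * g (x t) $ i $ j + Dg i j * v t $ i) * v t $ j + a $ j * (v t $ i * g (x t) $ i $ j))
      = a \<bullet> (g (x t) *v v t) + (\<Sum>i\<in>UNIV. \<Sum>j\<in>UNIV. v t $ i * Dg i j * v t $ j) + v t \<bullet> (g (x t) *v a)"
      by (simp add: inner_vec_def matrix_vector_mult_def sum_distrib_left sum.distrib algebra_simps)
    moreover have "(\<Sum>i\<in>UNIV. \<Sum>j\<in>UNIV. v t $ i * Dg i j * v t $ j) = 2 * (v t \<bullet> christoffel_lower (x t) (v t))"
      unfolding inner_christoffel_lower Dg_def by simp
    moreover have "a \<bullet> (g (x t) *v v t) = v t \<bullet> (g (x t) *v a)"
      using inner_symmetric[OF xE] by (metis inner_commute)
    moreover have "g (x t) *v a = momentum_force (x t) (v t)"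
      unfolding a_def \<delta>_eq by (rule g_acceleration[OF xE])
    then have "v t \<bullet> (g (x t) *v a) = - (v t \<bullet> christoffel_lower (x t) (v t)) - v t \<bullet> dU (x t)"
      by (simp add: momentum_force_def inner_diff_right inner_contract_d)
    ultimately show ?thesis by simp
  qed
  ultimately show ?thesis by simp
qed

lemma energy_constant:
  assumes \<delta>: "integral_curve X (E \<times> UNIV) J \<delta>" and st: "s \<in> J" "t \<in> J"
  shows "H (\<delta> s) = H (\<delta> t)"
proof -
  have J: "is_interval J" and \<delta>': "\<And>t. t \<in> J \<Longrightarrow> (\<delta> has_vector_derivative X (\<delta> t)) (at t)"
    and dom: "\<And>t. t \<in> J \<Longrightarrow> fst (\<delta> t) \<in> E"
    using \<delta> by (force simp: integral_curve_def)+
  have "\<exists>c. \<forall>t\<in>J. H (\<delta> t) = c"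
  proof (rule has_field_derivative_zero_constant)
    show "convex J" using J by (simp add: is_interval_convex_1)
    show "((\<lambda>t. H (\<delta> t)) has_real_derivative 0) (at t within J)" if "t \<in> J" for t
      using energy_deriv[OF \<delta>' dom] that by (meson DERIV_subset subset_UNIV)
  qed
  then show ?thesis using st by metis
qed

text \<open>One constant serves all estimates at a point, so that a single eventuality can be
  transported along filters. The exponent \<open>l / 2\<close> in the magnetic bound is what weak
  magnetism yields for the first derivatives of \<open>\<mu>\<close>.\<close>

definition bounds_at :: "real \<Rightarrow> real^'n \<Rightarrow> bool" where
  "bounds_at C x \<longleftrightarrow> x \<in> E \<and>
    (\<forall>v. norm (christoffel_lower x v) \<le> C * norm v ^ 2) \<and>
    (\<forall>v. norm (contract_d \<mu> x v) \<le> C * norm x powr (real l / 2) * norm v) \<and>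
    norm (dU x - dUl x) \<le> C * norm x ^ l \<and> norm (dU x) \<le> C * norm x \<and>
    \<bar>U x - Ul x\<bar> \<le> C * norm x ^ (l + 1)"

lemma bounds_near_0: "\<exists>C\<ge>0. \<forall>\<^sub>F x in nhds 0. bounds_at C x"
proof -
  obtain C1 where C1: "\<forall>\<^sub>F x in nhds 0. \<forall>i j k. \<bar>partial k (\<lambda>y. g y $ i $ j) x\<bar> \<le> C1" using g_bound by blast
  obtain C2 where C2: "\<forall>\<^sub>F x in nhds 0. \<forall>i j. \<bar>partial i (\<lambda>y. \<mu> y $ j) x\<bar> \<le> C2 * norm x powr (real l / 2)"
    using mu_bound by blast
  obtain C3 where C3: "\<forall>\<^sub>F x in nhds 0. \<forall>i. \<bar>partial i U x - dUl x $ i\<bar> \<le> C3 * norm x ^ l" using dU_exp by blast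
  obtain C4 where C4: "\<forall>\<^sub>F x in nhds 0. \<forall>i. \<bar>partial i U x\<bar> \<le> C4 * norm x" using dU_bound by blast
  obtain C5 where C5: "\<forall>\<^sub>F x in nhds 0. \<bar>U x - Ul x\<bar> \<le> C5 * norm x ^ (l + 1)" using U_exp by blast
  define N where "N = real CARD('n)"
  \<comment> \<open>Each \<open>N\<close> comes from one sum over coordinates, \<open>3 * C1\<close>
    and \<open>2 * C2\<close> from the number of derivatives combined; absolute values let the total
    dominate every summand.\<close>
  define C where "C = \<bar>N * (1/2 * (N * (N * (3 * C1))))\<bar> + \<bar>N * (N * (2 * C2))\<bar> + \<bar>N * C3\<bar> + \<bar>N * C4\<bar> + \<bar>C5\<bar>"
  have C: "N * (1/2 * (N * (N * (3 * C1)))) \<le> C" "N * (N * (2 * C2)) \<le> C" "N * C3 \<le> C" "N * C4 \<le> C" "C5 \<le> C" "0 \<le> C"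
    by (auto simp: C_def)
  have "\<forall>\<^sub>F x :: real^'n in nhds 0. x \<in> E"
    using rE_pos by (intro eventually_nhds_in_open) auto
  with C1 C2 C3 C4 C5 have "\<forall>\<^sub>F x in nhds 0. bounds_at C x"
  proof eventually_elim
    case (elim x)
    have "norm (christoffel_lower x v) \<le> C * norm v ^ 2" for v
    proof -
      let ?G = "\<lambda>m i j. partial i (\<lambda>y. g y $ m $ j) x + partial j (\<lambda>y. g y $ m $ i) x - partial m (\<lambda>y. g y $ i $ j) x"
      have G: "\<bar>?G m i j\<bar> \<le> 3 * C1" for m i j
      proof -
        have "\<bar>partial i (\<lambda>y. g y $ m $ j) x\<bar> \<le> C1" "\<bar>partial j (\<lambda>y. g y $ m $ i) x\<bar> \<le> C1"
          "\<bar>partial m (\<lambda>y. g y $ i $ j) x\<bar> \<le> C1"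
          using elim(1) by blast+
        then show ?thesis by linarith
      qed
      have "norm (christoffel_lower x v) \<le> N * (1/2 * (N * (N * (3 * C1 * norm v ^ 2))))"
        unfolding N_def
      proof (rule norm_cart_le)
        fix m
        show "\<bar>christoffel_lower x v $ m\<bar> \<le> 1/2 * (real CARD('n) * (real CARD('n) * (3 * C1 * norm v ^ 2)))"
          using abs_bilinear_sum_le[where c = "?G m" and C = "3 * C1" and v = v] G
          by (simp add: christoffel_lower_def abs_mult)
      qed
      also have "\<dots> = (N * (1/2 * (N * (N * (3 * C1))))) * norm v ^ 2" by simp
      also have "\<dots> \<le> C * norm v ^ 2" using C by (intro mult_right_mono) auto
      finally show ?thesis .
    qed
    moreover have "norm (contract_d \<mu> x v) \<le> C * norm x powr (real l / 2) * norm v" for v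
    proof -
      define p where "p = norm x powr (real l / 2)"
      have "\<bar>v $ i * (partial i (\<lambda>y. \<mu> y $ j) x - partial j (\<lambda>y. \<mu> y $ i) x)\<bar> \<le> norm v * (2 * C2 * p)" for i j
      proof -
        have "\<bar>partial i (\<lambda>y. \<mu> y $ j) x\<bar> \<le> C2 * p" "\<bar>partial j (\<lambda>y. \<mu> y $ i) x\<bar> \<le> C2 * p"
          using elim(2) unfolding p_def by blast+
        then have "\<bar>partial i (\<lambda>y. \<mu> y $ j) x - partial j (\<lambda>y. \<mu> y $ i) x\<bar> \<le> 2 * C2 * p" by linarith
        then show ?thesis unfolding abs_mult by (intro mult_mono component_le_norm_cart) auto
      qed
      then have "\<bar>contract_d \<mu> x v $ j\<bar> \<le> N * (norm v * (2 * C2 * p))" for j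
        unfolding contract_d_def N_def
        by (simp, intro sum_abs[THEN order_trans] sum_bounded_above) auto
      then have "norm (contract_d \<mu> x v) \<le> N * (N * (norm v * (2 * C2 * p)))"
        unfolding N_def by (rule norm_cart_le)
      also have "\<dots> = (N * (N * (2 * C2))) * (p * norm v)" by simp
      also have "\<dots> \<le> C * (p * norm v)"
        using C by (intro mult_right_mono) (auto simp: p_def)
      finally show ?thesis by (simp add: p_def mult.assoc)
    qed
    moreover have "norm (dU x - dUl x) \<le> C * norm x ^ l"
    proof -
      have "norm (dU x - dUl x) \<le> N * (C3 * norm x ^ l)"
        unfolding N_def using elim(3) by (intro norm_cart_le) (simp add: dU_def)
      also have "\<dots> = (N * C3) * norm x ^ l" by simp
      also have "\<dots> \<le> C * norm x ^ l" using C by (intro mult_right_mono) auto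
      finally show ?thesis .
    qed
    moreover have "norm (dU x) \<le> C * norm x"
    proof -
      have "norm (dU x) \<le> N * (C4 * norm x)"
        unfolding N_def using elim(4) by (intro norm_cart_le) (simp add: dU_def)
      also have "\<dots> = (N * C4) * norm x" by simp
      also have "\<dots> \<le> C * norm x" using C by (intro mult_right_mono) auto
      finally show ?thesis .
    qed
    moreover have "\<bar>U x - Ul x\<bar> \<le> C * norm x ^ (l + 1)"
      by (rule order_trans[OF elim(5)]) (use C in \<open>intro mult_right_mono; simp\<close>)
    ultimately show ?case using elim(6) unfolding bounds_at_def by blast
  qed
  then show ?thesis using C by blast
qed

text \<open>Continuity of the entries at 0 suffices, as the operator norm of
  \<open>g x - mat 1\<close> is at most the sum of their absolute values.\<close>

lemma g_near_identity:
  assumes "e > 0"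
  shows "\<forall>\<^sub>F x in nhds 0. \<forall>u. norm (g x *v u - u) \<le> e * norm u"
proof -
  have "isCont (\<lambda>x. g x $ i $ j) 0" for i j
    using g_diff[of 0 i j] rE_pos by (simp add: differentiable_imp_continuous_within)
  then have "((\<lambda>x. g x $ i $ j) \<longlongrightarrow> (mat 1 :: real^'n^'n) $ i $ j) (nhds 0)" for i j
    unfolding g_0[symmetric] isCont_def
    by (rule tendsto_at_iff_tendsto_nhds[of "\<lambda>x. g x $ i $ j" 0 for i j, THEN iffD1])
  then have "((\<lambda>x. \<Sum>i\<in>UNIV. \<Sum>j\<in>UNIV. \<bar>g x $ i $ j - (mat 1 :: real^'n^'n) $ i $ j\<bar>) \<longlongrightarrow>
      (\<Sum>i\<in>UNIV. \<Sum>j\<in>UNIV. \<bar>(mat 1 :: real^'n^'n) $ i $ j - (mat 1 :: real^'n^'n) $ i $ j\<bar>)) (nhds 0)"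
    by (intro tendsto_sum tendsto_rabs tendsto_diff tendsto_const)
  then have "\<forall>\<^sub>F x in nhds 0. (\<Sum>i\<in>UNIV. \<Sum>j\<in>UNIV. \<bar>g x $ i $ j - (mat 1 :: real^'n^'n) $ i $ j\<bar>) < e"
    by (rule order_tendstoD) (use assms in simp)
  then show ?thesis
  proof eventually_elim
    case (elim x)
    show ?case
    proof
      fix u
      have "norm (g x *v u - u) = norm ((g x - mat 1) *v u)"
        by (simp add: matrix_vector_mult_diff_rdistrib)
      also have "\<dots> \<le> onorm ((*v) (g x - mat 1)) * norm u"
        by (rule onorm) (rule matrix_vector_mul_bounded_linear)
      also have "\<dots> \<le> e * norm u"
        using onorm_le_matrix_component_sum[of "g x - mat 1"] elim by (intro mult_right_mono) auto
      finally show "norm (g x *v u - u) \<le> e * norm u" .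
    qed
  qed
qed

text \<open>Closeness to the identity passes to the inverse as for a Neumann series: if
  \<open>u\<close> is the preimage of \<open>w\<close>, then \<open>w - u\<close> has norm at most
  \<open>e * norm u\<close>. Continuity of matrix inversion is thereby avoided.\<close>

lemma matrix_inv_bounds:
  assumes x: "x \<in> E" and e: "e \<le> 1/2" "\<And>u. norm (g x *v u - u) \<le> e * norm u"
  shows "norm (matrix_inv (g x) *v w) \<le> 2 * norm w" "norm (matrix_inv (g x) *v w - w) \<le> 2 * e * norm w"
proof -
  define u where "u = matrix_inv (g x) *v w"
  have gu: "g x *v u = w" using g_invertible[OF x] by (simp add: u_def matrix_vector_mul_assoc)
  have *: "norm (w - u) \<le> e * norm u" using e(2)[of u] by (simp add: gu)
  also have "\<dots> \<le> 1/2 * norm u" using e(1) by (intro mult_right_mono) auto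
  finally have "norm (w - u) \<le> 1/2 * norm u" .
  moreover have "norm u \<le> norm w + norm (w - u)"
    using norm_triangle_ineq4[of w "w - u"] by simp
  ultimately have u: "norm u \<le> 2 * norm w" by simp
  then show "norm (matrix_inv (g x) *v w) \<le> 2 * norm w" by (simp add: u_def)
  show "norm (matrix_inv (g x) *v w - w) \<le> 2 * e * norm w"
  proof (cases "u = 0")
    case True
    then show ?thesis using gu by (simp add: u_def)
  next
    case False
    \<comment> \<open>Non-negativity of \<open>e\<close> comes from the estimate itself at a
      non-zero \<open>u\<close>.\<close>
    then have "0 \<le> e" using * by (smt (verit) norm_ge_zero mult_neg_pos zero_less_norm_iff)
    then have "e * norm u \<le> e * (2 * norm w)" using u by (rule mult_left_mono[rotated])
    then show ?thesis using * by (simp add: u_def norm_minus_commute)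
  qed
qed

end

subsection \<open>The McGehee flow at the boundary\<close>

lemma eventually_nhds_fst:
  assumes "\<forall>\<^sub>F x in nhds (fst w). P x"
  shows "\<forall>\<^sub>F w in nhds w. P (fst w)"
  using eventually_compose_filterlim[OF assms] tendsto_fst[OF filterlim_ident] by blast

context em_system
begin

abbreviation M where "M \<equiv> mcgehee_space r\<^sub>E :: (real \<times> (real^'n) \<times> (real^'n)) set"
abbreviation Mi where "Mi \<equiv> mcgehee_interior r\<^sub>E :: (real \<times> (real^'n) \<times> (real^'n)) set"
abbreviation bM where "bM \<equiv> mcgehee_boundary :: (real \<times> (real^'n) \<times> (real^'n)) set"
abbreviation Xt where "Xt \<equiv> mcgehee_field r\<^sub>E l g U \<mu>"
abbreviation Ht where "Ht \<equiv> mcgehee_energy r\<^sub>E l g U"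

text \<open>For \<open>norm w < 1\<close> the quadratic Christoffel term is at most linear, the
  factor \<open>norm x powr (real l / 2)\<close> is at most one, and \<open>dU\<close> is itself of
  linear size. This bound is what the uniqueness of the equilibrium rests on.\<close>

lemma field_linear_growth: "\<exists>K. \<forall>\<^sub>F w in nhds 0. norm (X w) \<le> K * norm w"
proof -
  obtain C where C: "0 \<le> C" and ev: "\<forall>\<^sub>F x in nhds 0. bounds_at C x"
    using bounds_near_0 by blast
  have "\<forall>\<^sub>F x in nhds 0. \<forall>u. norm (g x *v u - u) \<le> 1/2 * norm u"
    by (rule g_near_identity) simp
  with ev have "\<forall>\<^sub>F x in nhds 0. bounds_at C x \<and> (\<forall>u. norm (g x *v u - u) \<le> 1/2 * norm u)"
    by eventually_elim blast
  then have "\<forall>\<^sub>F w in nhds 0. bounds_at C (fst w) \<and> (\<forall>u. norm (g (fst w) *v u - u) \<le> 1/2 * norm u)"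
    by (intro eventually_nhds_fst) (simp only: fst_zero)
  moreover have "\<forall>\<^sub>F w :: (real^'n) \<times> (real^'n) in nhds 0. w \<in> ball 0 1"
    by (rule eventually_nhds_in_open) auto
  \<comment> \<open>Three forces bounded by \<open>C * norm w\<close>, doubled by the inverse
    metric, give \<open>6 * C\<close>; the velocity component adds 1.\<close>
  ultimately have "\<forall>\<^sub>F w in nhds 0. norm (X w) \<le> (1 + 6 * C) * norm w"
  proof eventually_elim
    case (elim w)
    define x v where "x = fst w" and "v = snd w"
    have w: "w = (x, v)" by (simp add: x_def v_def)
    note elim = elim[unfolded bounds_at_def]
    have xw: "norm x \<le> norm w" and vw: "norm v \<le> norm w"
      using norm_fst_le[of x v] norm_snd_le[of v x] by (simp_all add: w)
    have w1: "norm w < 1" using elim by simp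
    have inv: "norm (matrix_inv (g x) *v u) \<le> 2 * norm u" for u
      using elim matrix_inv_bounds(1)[of x "1/2" u] by (simp add: x_def)
    have "C * norm v ^ 2 \<le> C * norm w"
      using C vw w1 mult_mono[of "norm v" "norm w" "norm v" 1]
      by (intro mult_left_mono) (auto simp: power2_eq_square)
    then have 1: "norm (christoffel_lower x v) \<le> C * norm w"
      using elim order_trans unfolding x_def by blast
    have "norm x powr (real l / 2) \<le> 1"
      using xw w1 by (intro powr_le1) auto
    then have "C * norm x powr (real l / 2) * norm v \<le> C * 1 * norm w"
      using C vw by (intro mult_mono) auto
    then have 2: "norm (contract_d \<mu> x v) \<le> C * norm w"
      using elim order_trans unfolding x_def by fastforce
    have 3: "norm (dU x) \<le> C * norm w"
      using elim order_trans[OF _ mult_left_mono[OF xw C]] unfolding x_def by blast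
    have "norm (momentum_force x v) \<le> norm (christoffel_lower x v) + norm (dU x) + norm (contract_d \<mu> x v)"
      unfolding momentum_force_def norm_minus_cancel
      using norm_triangle_ineq[of "christoffel_lower x v + dU x" "contract_d \<mu> x v"]
        norm_triangle_ineq[of "christoffel_lower x v" "dU x"] by linarith
    also have "\<dots> \<le> 3 * C * norm w" using 1 2 3 by simp
    finally have "norm (snd (X w)) \<le> 6 * C * norm w"
      using inv[of "momentum_force x v"] by (simp add: w acceleration)
    moreover have "norm (fst (X w)) \<le> norm w"
      using vw EL_field_Pair[of g U \<mu> x v] by (metis w fst_conv)
    moreover have "norm (X w) \<le> norm (fst (X w)) + norm (snd (X w))"
      using norm_Pair_le[of "fst (X w)" "snd (X w)"] by simp
    ultimately show ?case by (simp add: algebra_simps)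
  qed
  then show ?thesis by blast
qed

lemma field_at_origin: "X 0 = 0"
  using field_linear_growth by (auto dest: eventually_nhds_x_imp_x)

lemma origin_isolated_orbit:
  assumes \<delta>: "integral_curve X (E \<times> UNIV) J \<delta>" and t0: "t0 \<in> J" "\<delta> t0 = 0" and t: "t \<in> J"
  shows "\<delta> t = 0"
proof (rule linear_growth_zero[where w = \<delta> and w' = "\<lambda>t. X (\<delta> t)" and a = t0 and I = J])
  show "open J" "is_interval J"
    using \<delta> by (auto simp: integral_curve_def)
  show deriv: "(\<delta> has_vector_derivative X (\<delta> t)) (at t)" if "t \<in> J" for t
    using \<delta> that by (auto simp: integral_curve_def)
  fix t assume t: "t \<in> J" "\<delta> t = 0"
  obtain K where K: "\<forall>\<^sub>F w in nhds 0. norm (X w) \<le> K * norm w" using field_linear_growth by blast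
  have "isCont \<delta> t" using deriv[OF t(1)] has_vector_derivative_continuous by blast
  then have "(\<delta> \<longlongrightarrow> 0) (nhds t)"
    using tendsto_at_iff_tendsto_nhds[of \<delta> t] t(2) by (simp add: isCont_def)
  from eventually_compose_filterlim[OF K this]
  show "\<exists>K. \<forall>\<^sub>F s in nhds t. norm (X (\<delta> s)) \<le> K * norm (\<delta> s)" by blast
qed (use t0 t in auto)

section \<open>Boundary values of the McGehee field\<close>

lemma dUl_hom:
  assumes "t > 0"
  shows "dUl (t *\<^sub>R x) = t ^ (l - 1) *\<^sub>R dUl x"
proof -
  have "((\<lambda>x. Ul (t *\<^sub>R x)) has_derivative (\<lambda>v. dUl (t *\<^sub>R x) \<bullet> (t *\<^sub>R v))) (at x)"
    by (rule has_derivative_compose[OF has_derivative_scaleR_right[OF has_derivative_ident] Ul_deriv])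
  moreover have "((\<lambda>x. Ul (t *\<^sub>R x)) has_derivative (\<lambda>v. t ^ l * (dUl x \<bullet> v))) (at x)"
    unfolding Ul_hom by (intro has_derivative_mult_right Ul_deriv)
  ultimately have eq: "(\<lambda>v. dUl (t *\<^sub>R x) \<bullet> (t *\<^sub>R v)) = (\<lambda>v. t ^ l * (dUl x \<bullet> v))"
    by (rule has_derivative_unique)
  have "dUl (t *\<^sub>R x) \<bullet> v = (t ^ (l - 1) *\<^sub>R dUl x) \<bullet> v" for v
  proof -
    have "t * (dUl (t *\<^sub>R x) \<bullet> v) = t ^ l * (dUl x \<bullet> v)" using fun_cong[OF eq, of v] by simp
    also have "t ^ l = t * t ^ (l - 1)" using l_ge by (simp flip: power_Suc)
    finally show ?thesis using assms by simp
  qed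
  then show ?thesis by (metis vector_eq_rdot)
qed

text \<open>The radial derivative of \<open>Ul\<close>, computed once by the chain rule and once by
  homogeneity. It makes the derivative of the boundary energy a multiple of that energy.\<close>

lemma euler_identity: "dUl q \<bullet> q = real l * Ul q"
proof -
  have "((\<lambda>t. Ul (t *\<^sub>R q)) has_derivative (\<lambda>h. dUl (1 *\<^sub>R q) \<bullet> (h *\<^sub>R q))) (at 1)"
    by (rule has_derivative_compose[OF has_derivative_scaleR_left[OF has_derivative_ident] Ul_deriv])
  then have "((\<lambda>t. Ul (t *\<^sub>R q)) has_real_derivative dUl q \<bullet> q) (at 1)"
    unfolding has_field_derivative_def by (rule has_derivative_eq_rhs) (auto simp: mult.commute)
  moreover have "((\<lambda>t. Ul (t *\<^sub>R q)) has_real_derivative real l * Ul q) (at 1)"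
    unfolding Ul_hom by (auto intro!: derivative_eq_intros)
  ultimately show ?thesis by (rule DERIV_unique)
qed

lemma Ul_cont: "continuous_on S Ul"
  using Ul_deriv has_derivative_continuous continuous_at_imp_continuous_on by blast

lemma tendsto_near_boundary:
  assumes z0: "z0 \<in> bM" and S: "S \<subseteq> M"
  shows "((\<lambda>z. fst z *\<^sub>R fst (snd z)) \<longlongrightarrow> 0) (at z0 within S)" "(fst \<longlongrightarrow> 0) (at z0 within S)"
    "((\<lambda>z. fst (snd z)) \<longlongrightarrow> fst (snd z0)) (at z0 within S)"
    "((\<lambda>z. snd (snd z)) \<longlongrightarrow> snd (snd z0)) (at z0 within S)"
proof -
  show "(fst \<longlongrightarrow> 0) (at z0 within S)"
    using tendsto_fst[OF tendsto_ident_at, of z0 S] z0 by (auto simp: mcgehee_boundary_def)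
  have snd: "(snd \<longlongrightarrow> snd z0) (at z0 within S)" by (rule tendsto_snd[OF tendsto_ident_at])
  show q: "((\<lambda>z. fst (snd z)) \<longlongrightarrow> fst (snd z0)) (at z0 within S)" by (rule tendsto_fst[OF snd])
  show "((\<lambda>z. snd (snd z)) \<longlongrightarrow> snd (snd z0)) (at z0 within S)" by (rule tendsto_snd[OF snd])
  show "((\<lambda>z. fst z *\<^sub>R fst (snd z)) \<longlongrightarrow> 0) (at z0 within S)"
    using tendsto_scaleR[OF \<open>(fst \<longlongrightarrow> 0) (at z0 within S)\<close> q] by simp
qed

text \<open>After substituting \<open>x = r q\<close> and \<open>v = r^(l/2) y\<close>, homogeneity
  turns the leading gradient into exactly \<open>dUl q\<close>. The other three terms carry a factor
  \<open>r ^ l\<close>, of which \<open>r powr (1 - real l)\<close> leaves a single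
  \<open>r\<close>, with an error locally uniform in \<open>y\<close>.\<close>

lemma scaled_force_tendsto:
  assumes z0: "z0 \<in> bM"
  shows "((\<lambda>(r, q, y). r powr (1 - real l) *\<^sub>R momentum_force (r *\<^sub>R q) (r powr (real l / 2) *\<^sub>R y))
    \<longlongrightarrow> - dUl (fst (snd z0))) (at z0 within Mi)"
proof -
  have MiM: "Mi \<subseteq> M" by (auto simp: mcgehee_interior_eq)
  note lims = tendsto_near_boundary[OF z0 MiM]
  obtain C where C: "0 \<le> C" and ev: "\<forall>\<^sub>F x in nhds 0. bounds_at C x"
    using bounds_near_0 by blast
  define f where "f = (\<lambda>(r, q, y). r powr (1 - real l) *\<^sub>R momentum_force (r *\<^sub>R q) (r powr (real l / 2) *\<^sub>R (y :: real^'n)))"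
  have "\<forall>\<^sub>F z in at z0 within Mi. z \<in> Mi" by (simp add: eventually_at_filter)
  with eventually_compose_filterlim[OF ev lims(1)]
  have "\<forall>\<^sub>F z in at z0 within Mi. norm (f z + dUl (fst (snd z)))
      \<le> C * fst z * (norm (snd (snd z)) ^ 2 + 1 + norm (snd (snd z)))"
  proof eventually_elim
    case (elim z)
    note elim = elim[unfolded bounds_at_def]
    obtain r q y where z: "z = (r, q, y)" by (cases z)
    have r: "r > 0" and q: "norm q = 1" using elim by (auto simp: z mcgehee_interior_def)
    define x v p where "x = r *\<^sub>R q" and "v = r powr (real l / 2) *\<^sub>R y" and "p = r powr (1 - real l)"
    have nx: "norm x = r" using r q by (simp add: x_def)
    have nv: "norm v = r powr (real l / 2) * norm y" by (simp add: v_def)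
    have p0: "p \<ge> 0" by (simp add: p_def)
    have hl: "r powr (real l / 2) * r powr (real l / 2) = r powr real l" by (simp flip: powr_add)
    have pl: "p * r powr real l = r" using r by (simp add: p_def flip: powr_add)
    have pl': "p * r ^ l = r" using pl r by (simp add: powr_realpow)
    have 1: "norm (p *\<^sub>R christoffel_lower x v) \<le> C * r * norm y ^ 2"
    proof -
      have "p * norm (christoffel_lower x v) \<le> p * (C * norm v ^ 2)"
        using elim p0 by (intro mult_left_mono) (auto simp: z x_def)
      also have "\<dots> = C * (p * (r powr (real l / 2) * r powr (real l / 2))) * norm y ^ 2"
        by (simp add: nv power2_eq_square)
      finally show ?thesis using p0 by (simp add: hl pl)
    qed
    have 2: "norm (p *\<^sub>R contract_d \<mu> x v) \<le> C * r * norm y"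
    proof -
      have "p * norm (contract_d \<mu> x v) \<le> p * (C * norm x powr (real l / 2) * norm v)"
        using elim p0 by (intro mult_left_mono) (auto simp: z x_def)
      also have "\<dots> = C * (p * (r powr (real l / 2) * r powr (real l / 2))) * norm y"
        by (simp add: nv nx)
      finally show ?thesis using p0 by (simp add: hl pl)
    qed
    have 3: "norm (p *\<^sub>R (dU x - dUl x)) \<le> C * r"
    proof -
      have "p * norm (dU x - dUl x) \<le> p * (C * norm x ^ l)"
        using elim p0 by (intro mult_left_mono) (auto simp: z x_def)
      also have "\<dots> = C * (p * r ^ l)" by (simp add: nx)
      finally show ?thesis using p0 by (simp add: pl')
    qed
    have "p * r ^ (l - 1) = 1"
    proof -
      have "r ^ (l - 1) = r powr (real l - 1)" using r l_ge by (simp add: powr_realpow[symmetric] of_nat_diff)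
      then show ?thesis using r by (simp add: p_def flip: powr_add)
    qed
    then have "p *\<^sub>R dUl x = dUl q" using dUl_hom[OF r, of q] by (simp add: x_def)
    then have "f z + dUl q = - (p *\<^sub>R christoffel_lower x v + p *\<^sub>R (dU x - dUl x) + p *\<^sub>R contract_d \<mu> x v)"
      by (simp add: f_def z momentum_force_def x_def v_def p_def scaleR_add_right scaleR_diff_right)
    then have "norm (f z + dUl q) \<le> norm (p *\<^sub>R christoffel_lower x v) + norm (p *\<^sub>R (dU x - dUl x)) + norm (p *\<^sub>R contract_d \<mu> x v)"
      using norm_triangle_ineq[of "p *\<^sub>R christoffel_lower x v + p *\<^sub>R (dU x - dUl x)" "p *\<^sub>R contract_d \<mu> x v"]
        norm_triangle_ineq[of "p *\<^sub>R christoffel_lower x v" "p *\<^sub>R (dU x - dUl x)"]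
      by (simp only: norm_minus_cancel)
    also have "\<dots> \<le> C * r * (norm y ^ 2 + 1 + norm y)"
      using 1 2 3 by (simp add: algebra_simps)
    finally show ?case by (simp add: z)
  qed
  moreover have "((\<lambda>z. C * fst z * (norm (snd (snd z)) ^ 2 + 1 + norm (snd (snd z)))) \<longlongrightarrow>
      C * 0 * (norm (snd (snd z0)) ^ 2 + 1 + norm (snd (snd z0)))) (at z0 within Mi)"
    by (intro tendsto_intros lims)
  then have "((\<lambda>z. C * fst z * (norm (snd (snd z)) ^ 2 + 1 + norm (snd (snd z)))) \<longlongrightarrow> 0) (at z0 within Mi)"
    by simp
  ultimately have "((\<lambda>z. f z + dUl (fst (snd z))) \<longlongrightarrow> 0) (at z0 within Mi)"
    by (rule Lim_null_comparison)
  moreover have "isCont dUl (fst (snd z0))"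
    using dUl_cont by (simp add: continuous_on_eq_continuous_at)
  then have "((\<lambda>z. dUl (fst (snd z))) \<longlongrightarrow> dUl (fst (snd z0))) (at z0 within Mi)"
    by (rule isCont_tendsto_compose) (rule lims(3))
  ultimately have "((\<lambda>z. (f z + dUl (fst (snd z))) - dUl (fst (snd z))) \<longlongrightarrow> 0 - dUl (fst (snd z0))) (at z0 within Mi)"
    by (rule tendsto_diff)
  then show ?thesis by (simp add: f_def)
qed

text \<open>The inverse metric tends to the identity while the scaled force stays bounded, so the
  metric disappears in the limit.\<close>

lemma scaled_acceleration_tendsto:
  assumes z0: "z0 \<in> bM"
  shows "((\<lambda>z. fst z powr (1 - real l) *\<^sub>R snd (X (mcgehee_map l z))) \<longlongrightarrow> - dUl (fst (snd z0))) (at z0 within Mi)"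
proof -
  define f where "f = (\<lambda>(r, q, y). r powr (1 - real l) *\<^sub>R momentum_force (r *\<^sub>R q) (r powr (real l / 2) *\<^sub>R (y :: real^'n)))"
  define x where "x z = fst z *\<^sub>R fst (snd z)" for z :: "real \<times> (real^'n) \<times> (real^'n)"
  define L where "L = - dUl (fst (snd z0))"
  have f: "(f \<longlongrightarrow> L) (at z0 within Mi)"
    unfolding f_def L_def by (rule scaled_force_tendsto[OF z0])
  have MiM: "Mi \<subseteq> M" by (auto simp: mcgehee_interior_eq)
  have x0: "(x \<longlongrightarrow> 0) (at z0 within Mi)"
    unfolding x_def by (rule tendsto_near_boundary(1)[OF z0 MiM])
  have eq: "fst z powr (1 - real l) *\<^sub>R snd (X (mcgehee_map l z)) = matrix_inv (g (x z)) *v f z" for z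
    by (cases z) (simp add: mcgehee_map_def acceleration f_def x_def
        linear_scale[OF matrix_vector_mul_linear])
  have "((\<lambda>z. matrix_inv (g (x z)) *v f z - f z) \<longlongrightarrow> 0) (at z0 within Mi)"
  proof (rule tendstoI)
    fix e :: real assume e: "e > 0"
    define b where "b = norm L + 1"
    have b: "b > 0" by (simp add: b_def add_nonneg_pos)
    \<comment> \<open>With \<open>norm (f z) < b\<close> the error is at most
      \<open>2 * e' * b <= e / 2\<close>; the bound 1/2 is what \<open>matrix_inv_bounds\<close>
      asks for.\<close>
    define e' where "e' = min (1/2) (e / (4 * b))"
    have e': "e' > 0" "e' \<le> 1/2" "2 * e' * b < e"
    proof -
      show "e' > 0" "e' \<le> 1/2" using e b by (auto simp: e'_def)
      have "e' * (4 * b) \<le> e" using b by (simp add: e'_def pos_le_divide_eq[symmetric])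
      then show "2 * e' * b < e" using e by (simp add: algebra_simps)
    qed
    have "\<forall>\<^sub>F z in at z0 within Mi. norm (f z) < b"
      using tendsto_norm[OF f] by (rule order_tendstoD) (simp add: b_def)
    moreover have "\<forall>\<^sub>F z in at z0 within Mi. \<forall>u. norm (g (x z) *v u - u) \<le> e' * norm u"
      by (rule eventually_compose_filterlim[OF g_near_identity[OF e'(1)] x0])
    moreover have "\<forall>\<^sub>F z in at z0 within Mi. x z \<in> E"
      using rE_pos by (intro eventually_compose_filterlim[OF _ x0] eventually_nhds_in_open) auto
    ultimately show "\<forall>\<^sub>F z in at z0 within Mi. dist (matrix_inv (g (x z)) *v f z - f z) 0 < e"
    proof eventually_elim
      case (elim z)
      have "norm (matrix_inv (g (x z)) *v f z - f z) \<le> 2 * e' * norm (f z)"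
        by (rule matrix_inv_bounds(2)) (use elim e' in auto)
      also have "\<dots> \<le> 2 * e' * b" using elim e' by (intro mult_left_mono) auto
      finally show ?case using e'(3) by simp
    qed
  qed
  from tendsto_add[OF this f] show ?thesis
    unfolding eq L_def by simp
qed

text \<open>The boundary field involves neither the metric nor \<open>\<mu>\<close>, only the
  leading term of \<open>U\<close>; the energy equation and the equilibrium on the boundary are both
  read off from it.\<close>

lemma field_boundary:
  assumes q: "norm q = 1"
  shows "Xt (0, q, y) = (0, y - (q \<bullet> y) *\<^sub>R q, - dUl q - (real l / 2 * (q \<bullet> y)) *\<^sub>R y)"
proof (rule mcgehee_field_boundary[OF rE_pos])
  let ?z = "(0, q, y) :: real \<times> (real^'n) \<times> (real^'n)"
  show z: "?z \<in> bM" using q by (simp add: mcgehee_boundary_def)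
  have MiM: "Mi \<subseteq> M" by (auto simp: mcgehee_interior_eq)
  note lims = tendsto_near_boundary[OF z MiM, unfolded fst_conv snd_conv]
  have "((\<lambda>z. (fst z * (fst (snd z) \<bullet> snd (snd z)), snd (snd z) - (fst (snd z) \<bullet> snd (snd z)) *\<^sub>R fst (snd z),
      fst z powr (1 - real l) *\<^sub>R snd (X (mcgehee_map l z)) - (real l / 2 * (fst (snd z) \<bullet> snd (snd z))) *\<^sub>R snd (snd z)))
    \<longlongrightarrow> (0 * (q \<bullet> y), y - (q \<bullet> y) *\<^sub>R q, - dUl q - (real l / 2 * (q \<bullet> y)) *\<^sub>R y)) (at ?z within Mi)"
    by (intro tendsto_intros lims scaled_acceleration_tendsto[OF z, unfolded fst_conv snd_conv])
  then show "(mcgehee_interior_field l g U \<mu> \<longlongrightarrow> (0, y - (q \<bullet> y) *\<^sub>R q, - dUl q - (real l / 2 * (q \<bullet> y)) *\<^sub>R y)) (at ?z within Mi)"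
    by (simp add: mcgehee_interior_field_def case_prod_unfold)
qed

text \<open>The blown-up potential. Division by zero would give 0 at \<open>r = 0\<close>, so the
  limit \<open>Ul q\<close> is put there explicitly.\<close>

definition V :: "real \<Rightarrow> real^'n \<Rightarrow> real" where
  "V r q = (if r = 0 then Ul q else U (r *\<^sub>R q) / r ^ l)"

lemma V_cont: "continuous_on M (\<lambda>z. V (fst z) (fst (snd z)))"
  unfolding continuous_on_eq_continuous_within
proof
  fix z0 assume z0: "z0 \<in> M"
  consider "z0 \<in> bM" | "z0 \<in> Mi" using mcgehee_space_cases[OF z0] by blast
  then show "continuous (at z0 within M) (\<lambda>z. V (fst z) (fst (snd z)))"
  proof cases
    case 1
    note lims = tendsto_near_boundary[OF 1 order_refl]
    obtain C where ev: "\<forall>\<^sub>F x in nhds 0. \<bar>U x - Ul x\<bar> \<le> C * norm x ^ (l + 1)"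
      using U_exp by blast
    have "\<forall>\<^sub>F z in at z0 within M. z \<in> M" by (simp add: eventually_at_filter)
    with eventually_compose_filterlim[OF ev lims(1)]
    have "\<forall>\<^sub>F z in at z0 within M. norm (V (fst z) (fst (snd z)) - Ul (fst (snd z))) \<le> C * fst z"
    proof eventually_elim
      case (elim z)
      define r q where "r = fst z" and "q = fst (snd z)"
      have r: "0 \<le> r" "norm q = 1" using elim by (auto simp: mcgehee_space_def r_def q_def)
      have "\<bar>V r q - Ul q\<bar> \<le> C * r"
      proof (cases "r = 0")
        case False
        \<comment> \<open>By homogeneity the difference is the Taylor remainder of order
          \<open>l + 1\<close> divided by \<open>r ^ l\<close>.\<close>
        have "\<bar>U (r *\<^sub>R q) / r ^ l - Ul q\<bar> = \<bar>U (r *\<^sub>R q) - Ul (r *\<^sub>R q)\<bar> / r ^ l"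
        proof -
          have "U (r *\<^sub>R q) / r ^ l - Ul q = (U (r *\<^sub>R q) - Ul (r *\<^sub>R q)) / r ^ l"
            using False by (simp add: Ul_hom diff_divide_distrib)
          then show ?thesis using r by (simp add: abs_divide)
        qed
        also have "\<dots> \<le> C * r ^ (l + 1) / r ^ l"
          using elim r by (intro divide_right_mono) (auto simp: r_def q_def)
        also have "\<dots> = C * r" using False by simp
        finally show ?thesis using False by (simp add: V_def)
      qed (simp add: V_def)
      then show ?case by (simp add: r_def q_def)
    qed
    moreover have "((\<lambda>z. C * fst z) \<longlongrightarrow> 0) (at z0 within M)"
      using tendsto_mult_left[OF lims(2), of C] by simp
    ultimately have "((\<lambda>z. V (fst z) (fst (snd z)) - Ul (fst (snd z))) \<longlongrightarrow> 0) (at z0 within M)"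
      by (rule Lim_null_comparison)
    moreover have "isCont Ul (fst (snd z0))"
      using Ul_deriv has_derivative_continuous by blast
    then have "((\<lambda>z. Ul (fst (snd z))) \<longlongrightarrow> Ul (fst (snd z0))) (at z0 within M)"
      by (rule isCont_tendsto_compose) (rule lims(3))
    ultimately have "((\<lambda>z. (V (fst z) (fst (snd z)) - Ul (fst (snd z))) + Ul (fst (snd z))) \<longlongrightarrow> 0 + Ul (fst (snd z0))) (at z0 within M)"
      by (rule tendsto_add)
    moreover have "V (fst z0) (fst (snd z0)) = Ul (fst (snd z0))"
      using 1 by (auto simp: mcgehee_boundary_def V_def)
    ultimately show ?thesis by (simp add: continuous_within)
  next
    case 2
    then have r: "fst z0 > 0" and x: "fst z0 *\<^sub>R fst (snd z0) \<in> E"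
      by (auto simp: mcgehee_interior_def)
    have "isCont U (fst z0 *\<^sub>R fst (snd z0))"
      using U_diff[OF x] by (rule differentiable_imp_continuous_within)
    then have "isCont (\<lambda>z. U (fst z *\<^sub>R fst (snd z))) z0"
      using isCont_o2[of z0 "\<lambda>z. fst z *\<^sub>R fst (snd z)" U] by (simp add: continuous_intros)
    then have "isCont (\<lambda>z. U (fst z *\<^sub>R fst (snd z)) / fst z ^ l) z0"
      using r by (intro continuous_intros) auto
    moreover have "\<forall>\<^sub>F z in nhds z0. U (fst z *\<^sub>R fst (snd z)) / fst z ^ l = V (fst z) (fst (snd z))"
    proof -
      have "\<forall>\<^sub>F z in nhds z0. z \<in> {0<..} \<times> UNIV"
        using r by (intro eventually_nhds_in_open open_Times) (auto simp: mem_Times_iff)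
      then show ?thesis by eventually_elim (auto simp: V_def)
    qed
    ultimately have "isCont (\<lambda>z. V (fst z) (fst (snd z))) z0"
      by (simp add: isCont_cong)
    then show ?thesis by (rule continuous_at_imp_continuous_at_within)
  qed
qed

text \<open>A formula for \<open>Ht\<close> on all of \<open>M\<close>; its continuity is what
  identifies the \<open>Lim\<close> in the definition of \<open>Ht\<close>.\<close>

definition Htf :: "real \<times> (real^'n) \<times> (real^'n) \<Rightarrow> real" where
  "Htf z = 1/2 * (snd (snd z) \<bullet> (g (fst z *\<^sub>R fst (snd z)) *v snd (snd z))) + V (fst z) (fst (snd z))"

lemma g_form_cont: "continuous_on M (\<lambda>z. snd (snd z) \<bullet> (g (fst z *\<^sub>R fst (snd z)) *v snd (snd z)))"
proof -
  have "continuous_on E (\<lambda>x. g x $ i $ j)" for i j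
    using g_diff differentiable_imp_continuous_within continuous_at_imp_continuous_on by blast
  moreover have "continuous_on M (\<lambda>z. fst z *\<^sub>R fst (snd z))" by (intro continuous_intros)
  moreover have "(\<lambda>z. fst z *\<^sub>R fst (snd z)) ` M \<subseteq> E" by (auto simp: mcgehee_space_def)
  ultimately have gij: "continuous_on M (\<lambda>z. g (fst z *\<^sub>R fst (snd z)) $ i $ j)" for i j
    using continuous_on_compose2 by blast
  have y: "continuous_on M (\<lambda>z. snd (snd z) $ i)" for i by (intro continuous_intros)
  show ?thesis
    unfolding inner_vec_def matrix_vector_mult_def inner_real_def vec_lambda_beta
    by (intro continuous_on_sum continuous_on_mult gij y)
qed

lemma Htf_cont: "continuous_on M Htf"
  unfolding Htf_def by (intro continuous_intros g_form_cont V_cont)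

lemma scaled_energy:
  assumes "z \<in> Mi"
  shows "H (mcgehee_map l z) / fst z ^ l = Htf z"
proof -
  obtain r q y where z: "z = (r, q, y)" "r > 0" using assms by (auto simp: mcgehee_interior_def)
  \<comment> \<open>The factor \<open>r^(l/2)\<close> enters the quadratic kinetic form twice, which
    gives the \<open>r ^ l\<close> that is divided out.\<close>
  have "r powr (real l / 2) * r powr (real l / 2) = r ^ l"
    using z by (simp add: powr_realpow flip: powr_add)
  then have "1/2 * ((r powr (real l / 2) *\<^sub>R y) \<bullet> (g (r *\<^sub>R q) *v (r powr (real l / 2) *\<^sub>R y)))
      = r ^ l * (1/2 * (y \<bullet> (g (r *\<^sub>R q) *v y)))"
    by (simp add: linear_scale[OF matrix_vector_mul_linear])
  then show ?thesis
    using z(2) by (simp add: energy_def mcgehee_map_def z(1) Htf_def V_def add_divide_distrib)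
qed

lemma energy_eq: "z \<in> M \<Longrightarrow> Ht z = Htf z"
proof -
  assume z: "z \<in> M"
  then consider "z \<in> bM" | "z \<in> Mi" using mcgehee_space_cases by blast
  then show ?thesis
  proof cases
    case 1
    have "(Htf \<longlongrightarrow> Htf z) (at z within M)"
      using Htf_cont z by (simp add: continuous_on_def)
    then have "(Htf \<longlongrightarrow> Htf z) (at z within Mi)"
      by (rule tendsto_within_subset) (auto simp: mcgehee_interior_eq)
    then have "((\<lambda>z. H (mcgehee_map l z) / fst z ^ l) \<longlongrightarrow> Htf z) (at z within Mi)"
      by (rule Lim_transform_within[OF _ zero_less_one]) (simp add: scaled_energy)
    then show ?thesis by (rule mcgehee_energy_boundary[OF rE_pos 1])
  next
    case 2
    then show ?thesis using mcgehee_energy_interior[OF 2] scaled_energy[OF 2] by simp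
  qed
qed

lemma Ht_cont: "continuous_on M Ht"
  using Htf_cont energy_eq by (simp cong: continuous_on_cong)

lemma energy_boundary: "norm q = 1 \<Longrightarrow> Ht (0, q, y) = 1/2 * norm y ^ 2 + Ul q"
  using energy_eq[of "(0, q, y)"] rE_pos
  by (simp add: mcgehee_space_def Htf_def V_def g_0 power2_norm_eq_inner)

lemma energy_sign:
  assumes "z \<in> Mi"
  shows "Ht z \<le> 0 \<longleftrightarrow> H (mcgehee_map l z) \<le> 0" "Ht z < 0 \<longleftrightarrow> H (mcgehee_map l z) < 0"
proof -
  have p: "fst z ^ l > 0" using assms by (auto simp: mcgehee_interior_def)
  show "Ht z \<le> 0 \<longleftrightarrow> H (mcgehee_map l z) \<le> 0" "Ht z < 0 \<longleftrightarrow> H (mcgehee_map l z) < 0"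
    unfolding mcgehee_energy_interior[OF assms] by (simp_all add: pos_divide_le_eq[OF p] pos_divide_less_eq[OF p])
qed

section \<open>Invariant sets of the McGehee flow\<close>

lemma radial_component:
  assumes "z \<in> M"
  shows "fst (Xt z) = fst z * (fst (snd z) \<bullet> snd (snd z))"
  using mcgehee_space_cases[OF assms]
proof
  assume "z \<in> bM"
  then show ?thesis by (auto simp: mcgehee_boundary_def field_boundary)
next
  assume "z \<in> Mi"
  then show ?thesis
    by (simp add: mcgehee_field_interior mcgehee_interior_field_def case_prod_unfold)
qed

lemma boundary_invariant:
  assumes \<gamma>: "integral_curve Xt M I \<gamma>" and t0: "t0 \<in> I" "\<gamma> t0 \<in> bM" and t: "t \<in> I"
  shows "\<gamma> t \<in> bM"
proof -
  have I: "open I" "is_interval I" and deriv: "\<And>t. t \<in> I \<Longrightarrow> (\<gamma> has_vector_derivative Xt (\<gamma> t)) (at t)"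
    and M: "\<And>t. t \<in> I \<Longrightarrow> \<gamma> t \<in> M"
    using \<gamma> by (auto simp: integral_curve_def)
  define k where "k t = fst (snd (\<gamma> t)) \<bullet> snd (snd (\<gamma> t))" for t
  have \<gamma>_cont: "continuous_on I \<gamma>"
    using deriv has_vector_derivative_continuous continuous_at_imp_continuous_on by blast
  have "fst (\<gamma> t) = 0"
  proof (rule scalar_linear_ode_zero[where f = "\<lambda>t. fst (\<gamma> t)" and k = k, OF I t0(1) _ _ _ t])
    show "((\<lambda>t. fst (\<gamma> t)) has_real_derivative k t * fst (\<gamma> t)) (at t)" if "t \<in> I" for t
      using bounded_linear.has_vector_derivative[OF bounded_linear_fst deriv[OF that]]
        radial_component[OF M[OF that]]
      by (simp add: k_def has_real_derivative_iff_has_vector_derivative mult.commute)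
    show "continuous_on I k" unfolding k_def by (intro continuous_intros \<gamma>_cont)
  qed (use t0 in \<open>auto simp: mcgehee_boundary_def\<close>)
  then show ?thesis using M[OF t] by (auto simp: mcgehee_space_def mcgehee_boundary_def)
qed

lemma boundary_energy_invariant:
  assumes \<gamma>: "integral_curve Xt M I \<gamma>" and t0: "t0 \<in> I" "\<gamma> t0 \<in> bM" "Ht (\<gamma> t0) \<le> 0" and t: "t \<in> I"
  shows "Ht (\<gamma> t) \<le> 0"
proof (rule ccontr)
  assume pos: "\<not> Ht (\<gamma> t) \<le> 0"
  have I: "open I" "is_interval I" and deriv: "\<And>t. t \<in> I \<Longrightarrow> (\<gamma> has_vector_derivative Xt (\<gamma> t)) (at t)"
    using \<gamma> by (auto simp: integral_curve_def)
  have bM: "\<gamma> t \<in> bM" if "t \<in> I" for t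
    using boundary_invariant[OF \<gamma> t0(1,2) that] .
  define q y where "q t = fst (snd (\<gamma> t))" and "y t = snd (snd (\<gamma> t))" for t
  have \<gamma>_eq: "\<gamma> t = (0, q t, y t)" "norm (q t) = 1" if "t \<in> I" for t
    using bM[OF that] by (auto simp: mcgehee_boundary_def q_def y_def)
  define e where "e t = 1/2 * (y t \<bullet> y t) + Ul (q t)" for t
  have e: "Ht (\<gamma> t) = e t" if "t \<in> I" for t
    using \<gamma>_eq[OF that] energy_boundary by (simp add: e_def power2_norm_eq_inner)
  have e': "(e has_real_derivative (- real l * (q t \<bullet> y t)) * e t) (at t)" if "t \<in> I" for t
  proof -
    have \<gamma>': "(\<gamma> has_vector_derivative (0, y t - (q t \<bullet> y t) *\<^sub>R q t, - dUl (q t) - (real l / 2 * (q t \<bullet> y t)) *\<^sub>R y t)) (at t)"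
      using deriv[OF that] \<gamma>_eq[OF that] field_boundary by simp
    note s' = bounded_linear.has_vector_derivative[OF bounded_linear_snd \<gamma>', unfolded snd_conv]
    have q': "(q has_vector_derivative y t - (q t \<bullet> y t) *\<^sub>R q t) (at t)"
      using bounded_linear.has_vector_derivative[OF bounded_linear_fst s'] unfolding q_def[abs_def] by simp
    have y': "(y has_vector_derivative - dUl (q t) - (real l / 2 * (q t \<bullet> y t)) *\<^sub>R y t) (at t)"
      using bounded_linear.has_vector_derivative[OF bounded_linear_snd s'] unfolding y_def[abs_def] by simp
    have "((\<lambda>t. Ul (q t)) has_real_derivative dUl (q t) \<bullet> (y t - (q t \<bullet> y t) *\<^sub>R q t)) (at t)"
      using vector_derivative_diff_chain_within[OF q' has_derivative_at_withinI[OF Ul_deriv]]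
      by (simp add: has_real_derivative_iff_has_vector_derivative o_def)
    moreover have "((\<lambda>t. y t \<bullet> y t) has_real_derivative
        y t \<bullet> (- dUl (q t) - (real l / 2 * (q t \<bullet> y t)) *\<^sub>R y t) + (- dUl (q t) - (real l / 2 * (q t \<bullet> y t)) *\<^sub>R y t) \<bullet> y t) (at t)"
      using bounded_bilinear.has_vector_derivative[OF bounded_bilinear_inner y' y']
      by (simp add: has_real_derivative_iff_has_vector_derivative)
    ultimately have "(e has_real_derivative 1/2 * (y t \<bullet> (- dUl (q t) - (real l / 2 * (q t \<bullet> y t)) *\<^sub>R y t)
        + (- dUl (q t) - (real l / 2 * (q t \<bullet> y t)) *\<^sub>R y t) \<bullet> y t) + dUl (q t) \<bullet> (y t - (q t \<bullet> y t) *\<^sub>R q t)) (at t)"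
      unfolding e_def by (intro DERIV_add DERIV_cmult)
    \<comment> \<open>The terms \<open>dUl q \<bullet> y\<close> cancel, and Euler's identity turns
      the radial one into \<open>- l (q \<bullet> y) Ul q\<close>, with the same factor as the
      kinetic part.\<close>
    moreover have "1/2 * (y t \<bullet> (- dUl (q t) - (real l / 2 * (q t \<bullet> y t)) *\<^sub>R y t)
        + (- dUl (q t) - (real l / 2 * (q t \<bullet> y t)) *\<^sub>R y t) \<bullet> y t) + dUl (q t) \<bullet> (y t - (q t \<bullet> y t) *\<^sub>R q t)
        = (- real l * (q t \<bullet> y t)) * e t"
      by (simp add: e_def inner_diff_left inner_diff_right euler_identity inner_commute[of "y t" "dUl (q t)"] algebra_simps)
    ultimately show ?thesis by simp
  qed
  have cont: "continuous_on I e"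
    using e' DERIV_isCont continuous_at_imp_continuous_on by blast
  \<comment> \<open>The equation propagates zeros rather than signs: the energy would take the value
    zero between \<open>t0\<close> and \<open>t\<close> and would then vanish throughout.\<close>
  have "connected (e ` I)"
    using I(2) cont connected_continuous_image is_interval_connected by blast
  moreover have "e t0 \<in> e ` I" "e t0 \<le> 0" "e t \<in> e ` I" "0 \<le> e t"
    using t0 t e pos by auto
  ultimately have "0 \<in> e ` I" unfolding connected_iff_interval by blast
  then obtain t1 where t1: "t1 \<in> I" "e t1 = 0" by auto
  have "continuous_on I \<gamma>"
    using deriv has_vector_derivative_continuous continuous_at_imp_continuous_on by blast
  then have "continuous_on I (\<lambda>t. - real l * (q t \<bullet> y t))"
    unfolding q_def y_def by (intro continuous_intros)
  then have "e t = 0" using scalar_linear_ode_zero[where f = e, OF I t1 e' _ t] by blast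
  then show False using pos e[OF t] by simp
qed

lemma interior_invariant:
  assumes \<gamma>: "integral_curve Xt M I \<gamma>" and t0: "t0 \<in> I" "\<gamma> t0 \<in> Mi" and t: "t \<in> I"
  shows "\<gamma> t \<in> Mi"
proof -
  have "\<gamma> t \<in> M" using \<gamma> t by (auto simp: integral_curve_def)
  \<comment> \<open>Read backwards: a boundary point at time \<open>t\<close> would force one at
    time \<open>t0\<close>.\<close>
  moreover have "\<gamma> t \<notin> bM"
    using boundary_invariant[OF \<gamma> t _ t0(1)] t0(2) by (auto simp: mcgehee_interior_eq)
  ultimately show ?thesis by (simp add: mcgehee_interior_eq)
qed

lemma interior_push:
  assumes \<gamma>: "integral_curve Xt M I \<gamma>" and int: "\<gamma> t \<in> Mi" and t: "t \<in> I"
  shows "((\<lambda>t. mcgehee_map l (\<gamma> t)) has_vector_derivative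
    fst (\<gamma> t) powr (1 - real l / 2) *\<^sub>R X (mcgehee_map l (\<gamma> t))) (at t)"
  using mcgehee_push[where \<gamma> = \<gamma> and t = t, OF _ int] \<gamma> t mcgehee_field_interior[OF int]
  by (auto simp: integral_curve_def)

text \<open>\<open>Ht\<close> is \<open>H\<close> divided by \<open>r ^ l\<close>, with
  \<open>r\<close> varying along the curve, so \<open>H\<close> is compared instead, along the
  projected curve turned into an Euler-Lagrange curve by a change of time.\<close>

lemma interior_energy_invariant:
  assumes \<gamma>: "integral_curve Xt M I \<gamma>" and t0: "t0 \<in> I" "\<gamma> t0 \<in> Mi" and t: "t \<in> I"
  shows "H (mcgehee_map l (\<gamma> t)) = H (mcgehee_map l (\<gamma> t0))"
proof -
  have int: "\<gamma> t \<in> Mi" if "t \<in> I" for t using interior_invariant[OF \<gamma> t0 that] .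
  have I: "open I" "is_interval I" "I \<noteq> {}" and deriv: "\<And>t. t \<in> I \<Longrightarrow> (\<gamma> has_vector_derivative Xt (\<gamma> t)) (at t)"
    using \<gamma> by (auto simp: integral_curve_def)
  define c where "c t = fst (\<gamma> t) powr (1 - real l / 2)" for t
  have pos: "fst (\<gamma> t) > 0" if "t \<in> I" for t using int[OF that] by (auto simp: mcgehee_interior_def)
  have "continuous_on I \<gamma>"
    using deriv has_vector_derivative_continuous continuous_at_imp_continuous_on by blast
  then have c: "continuous_on I c"
    unfolding c_def using pos by (intro continuous_intros) force+
  have "c t > 0" if "t \<in> I" for t
    using pos[OF that] by (simp add: c_def)
  then obtain s J \<delta> where J: "open J" "is_interval J" "J \<noteq> {}" "s ` I = J"
    and \<delta>s: "\<forall>t\<in>I. (s has_real_derivative c t) (at t) \<and> \<delta> (s t) = mcgehee_map l (\<gamma> t)"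
    and \<delta>': "\<forall>u\<in>J. (\<delta> has_vector_derivative X (\<delta> u)) (at u)"
    using time_change[OF I c, of "\<lambda>t. mcgehee_map l (\<gamma> t)" X] interior_push[OF \<gamma> int] unfolding c_def by blast
  have "\<delta> u \<in> E \<times> UNIV" if u: "u \<in> J" for u
  proof -
    obtain t where "t \<in> I" "u = s t" using J(4) u by blast
    then show ?thesis using \<delta>s mcgehee_map_interior(2)[OF int] by (simp add: mem_Times_iff)
  qed
  then have "\<delta> ` J \<subseteq> E \<times> UNIV" by (rule image_subsetI)
  then have "integral_curve X (E \<times> UNIV) J \<delta>"
    unfolding integral_curve_def using J(1-3) \<delta>' by blast
  then have "H (\<delta> (s t)) = H (\<delta> (s t0))"
    by (rule energy_constant) (use J(4) t t0 in auto)
  then show ?thesis using \<delta>s t t0 by simp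
qed

lemma sublevel_invariant:
  assumes \<gamma>: "integral_curve Xt M I \<gamma>" and t0: "t0 \<in> I" "Ht (\<gamma> t0) \<le> 0" and t: "t \<in> I"
  shows "Ht (\<gamma> t) \<le> 0"
proof -
  have "\<gamma> t0 \<in> M" using \<gamma> t0 by (auto simp: integral_curve_def)
  from mcgehee_space_cases[OF this] show ?thesis
  proof
    assume "\<gamma> t0 \<in> bM"
    then show ?thesis using boundary_energy_invariant[OF \<gamma>] t0 t by blast
  next
    assume int: "\<gamma> t0 \<in> Mi"
    then show ?thesis
      using interior_energy_invariant[OF \<gamma> t0(1) int t] interior_invariant[OF \<gamma> t0(1) int t] t0(2)
      by (simp add: energy_sign)
  qed
qed

end

subsection \<open>The blow-down map on the subcritical region\<close>

lemma continuous_on_mcgehee_map: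
  assumes "l > 0" "S \<subseteq> mcgehee_space r\<^sub>E"
  shows "continuous_on S (mcgehee_map l)"
proof -
  \<comment> \<open>Continuity of \<open>r powr (l / 2)\<close> at \<open>r = 0\<close> relies on
    the exponent being positive.\<close>
  have "continuous_on S (\<lambda>z. (fst z *\<^sub>R fst (snd z), fst z powr (real l / 2) *\<^sub>R snd (snd z)))"
    using assms by (intro continuous_intros continuous_on_powr') (auto simp: mcgehee_space_def)
  then show ?thesis by (simp add: mcgehee_map_def case_prod_unfold)
qed

lemma continuous_on_mcgehee_inverse:
  assumes "\<And>w. w \<in> S \<Longrightarrow> fst w \<noteq> 0"
  shows "continuous_on S (mcgehee_inverse l)"
proof -
  have "continuous_on S (\<lambda>w. (norm (fst w), fst w /\<^sub>R norm (fst w), norm (fst w) powr - (real l / 2) *\<^sub>R snd w))"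
    using assms by (intro continuous_intros) auto
  then show ?thesis by (simp add: mcgehee_inverse_def case_prod_unfold)
qed

lemma real_analytic_mcgehee_map:
  fixes S :: "(real \<times> (real^'n) \<times> (real^'n)) set"
  assumes "S \<subseteq> mcgehee_interior r\<^sub>E"
  shows "real_analytic_on (mcgehee_map l) S"
proof (rule real_analytic_onI)
  fix a i :: "real \<times> (real^'n) \<times> (real^'n)" and j :: "(real^'n) \<times> (real^'n)"
  assume a: "a \<in> S"
  have fst: "analytic_germ (\<lambda>z. fst z) a"
    using analytic_germ_inner[of "(1, 0, 0)" a] by (simp add: inner_prod_def)
  have q: "analytic_germ (\<lambda>z. fst (snd z) \<bullet> fst j) a"
    using analytic_germ_inner[of "(0, fst j, 0)" a] by (simp add: inner_prod_def)
  have y: "analytic_germ (\<lambda>z. snd (snd z) \<bullet> snd j) a"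
    using analytic_germ_inner[of "(0, 0, snd j)" a] by (simp add: inner_prod_def)
  have "fst a > 0" using a assms by (auto simp: mcgehee_interior_def)
  then have "analytic_germ (\<lambda>z. fst z * (fst (snd z) \<bullet> fst j) + fst z powr (real l / 2) * (snd (snd z) \<bullet> snd j)) a"
    by (intro analytic_germ_add analytic_germ_mult analytic_germ_powr fst q y)
  then show "analytic_germ (\<lambda>z. mcgehee_map l z \<bullet> j) a"
    by (simp add: mcgehee_map_def case_prod_unfold inner_prod_def)
qed

lemma real_analytic_mcgehee_inverse:
  fixes S :: "((real^'n) \<times> (real^'n)) set"
  assumes "\<And>w. w \<in> S \<Longrightarrow> fst w \<noteq> 0"
  shows "real_analytic_on (mcgehee_inverse l) S"
proof (rule real_analytic_onI)
  fix a :: "(real^'n) \<times> (real^'n)" and i :: "real \<times> (real^'n) \<times> (real^'n)"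
  assume "a \<in> S"
  then have a: "fst a \<bullet> fst a > 0" using assms by simp
  have x: "analytic_germ (\<lambda>w. fst w \<bullet> b) a" for b
    using analytic_germ_inner[of "(b, 0)" a] by (simp add: inner_prod_def)
  have v: "analytic_germ (\<lambda>w. snd w \<bullet> b) a" for b
    using analytic_germ_inner[of "(0, b)" a] by (simp add: inner_prod_def)
  \<comment> \<open>\<open>norm x powr p\<close> is a power of the polynomial
    \<open>x \<bullet> x\<close>, which is positive where \<open>x\<close> is non-zero.\<close>
  have "analytic_germ (\<lambda>w. \<Sum>b\<in>Basis. (fst w \<bullet> b) * (fst w \<bullet> b)) a"
    by (intro analytic_germ_sum analytic_germ_mult x) simp
  then have "analytic_germ (\<lambda>w. fst w \<bullet> fst w) a"
    by (simp flip: euclidean_inner)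
  then have "analytic_germ (\<lambda>w. (fst w \<bullet> fst w) powr (p / 2)) a" for p
    using a by (rule analytic_germ_powr)
  moreover have "(w \<bullet> w) powr (p / 2) = norm w powr p" for w :: "real^'n" and p
    by (simp add: norm_eq_sqrt_inner powr_half_sqrt[symmetric] powr_powr)
  ultimately have n: "analytic_germ (\<lambda>w. norm (fst w) powr p) a" for p
    by simp
  have n1: "norm w = norm w powr 1" "inverse (norm w) = norm w powr - 1" for w :: "real^'n"
    by (simp_all add: powr_minus)
  have "analytic_germ (\<lambda>w. norm (fst w) powr 1 * fst i + (norm (fst w) powr - 1 * (fst w \<bullet> fst (snd i))
      + norm (fst w) powr - (real l / 2) * (snd w \<bullet> snd (snd i)))) a"
    by (intro analytic_germ_add analytic_germ_mult n x v analytic_germ_const)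
  moreover have "mcgehee_inverse l w \<bullet> i = norm (fst w) powr 1 * fst i + (norm (fst w) powr - 1 * (fst w \<bullet> fst (snd i))
      + norm (fst w) powr - (real l / 2) * (snd w \<bullet> snd (snd i)))" for w
    unfolding n1[symmetric] by (simp add: mcgehee_inverse_def case_prod_unfold inner_prod_def)
  ultimately show "analytic_germ (\<lambda>w. mcgehee_inverse l w \<bullet> i) a" by simp
qed

lemma image_meetsE:
  assumes "f ` I \<inter> A \<noteq> {}"
  obtains t where "t \<in> I" "f t \<in> A"
  using assms by blast

lemma orbitsI: "maximal_integral_curve X S I \<gamma> \<Longrightarrow> \<gamma> ` I \<subseteq> A \<Longrightarrow> \<gamma> ` I \<in> orbits X S A"
  unfolding orbits_def by blast

lemma orbitsE:
  assumes "C \<in> orbits X S A"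
  obtains I \<gamma> where "C = \<gamma> ` I" "maximal_integral_curve X S I \<gamma>" "\<gamma> ` I \<subseteq> A"
  using assms unfolding orbits_def by blast

lemma orbits_mono: "A \<subseteq> B \<Longrightarrow> C \<in> orbits Y T A \<Longrightarrow> C \<in> orbits Y T B"
  unfolding orbits_def by blast

lemma maximal_on_UNIV: "integral_curve X S UNIV \<gamma> \<Longrightarrow> maximal_integral_curve X S UNIV \<gamma>"
  by (auto simp: maximal_integral_curve_def)

lemma equilibrium_maximal:
  assumes "X z = 0" "z \<in> S"
  shows "maximal_integral_curve X S UNIV (\<lambda>_. z)"
  using assms by (intro maximal_on_UNIV) (auto simp: integral_curve_def)

text \<open>All that is kept of the failure of a strict minimum is one direction in which the
  leading term is not positive; it is what makes the boundary part non-empty.\<close>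

locale em_system_nonmin = em_system r\<^sub>E g U \<mu> l Ul dUl
  for r\<^sub>E and g :: "real^'n \<Rightarrow> real^'n^'n" and U \<mu> l Ul dUl +
  assumes nonpos_direction: "\<exists>q. norm q = 1 \<and> Ul q \<le> 0"
begin

abbreviation "\<pi> \<equiv> mcgehee_map l :: real \<times> (real^'n) \<times> (real^'n) \<Rightarrow> (real^'n) \<times> (real^'n)"
abbreviation "TE \<equiv> E \<times> (UNIV :: (real^'n) set)"
abbreviation "Sub \<equiv> {z \<in> M. Ht z \<le> 0}"
abbreviation "SubH \<equiv> {w \<in> TE. H w \<le> 0}"
abbreviation "bM_le0 \<equiv> {z \<in> bM. Ht z \<le> 0}"

lemma boundary_subset: "bM \<subseteq> M"
  using rE_pos by (auto simp: mcgehee_space_def mcgehee_boundary_def)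

lemma map_boundary: "z \<in> bM \<Longrightarrow> \<pi> z = 0"
  using l_ge by (auto simp: mcgehee_boundary_def mcgehee_map_def zero_prod_def)

lemma energy_origin: "H 0 = 0"
  by (simp add: energy_def zero_prod_def U_0 matrix_vector_mult_def inner_vec_def)

lemma energy_over_origin: "H (0, v) = 1/2 * norm v ^ 2"
  by (simp add: energy_def g_0 U_0 power2_norm_eq_inner)

lemma Sub_interior: "Sub - bM_le0 = {z \<in> Mi. Ht z \<le> 0}"
  by (auto simp: mcgehee_interior_eq)

lemma SubH_fst:
  assumes "w \<in> SubH - {0}"
  shows "fst w \<noteq> 0" "norm (fst w) < r\<^sub>E"
proof -
  obtain x v where w: "w = (x, v)" by (cases w)
  show "norm (fst w) < r\<^sub>E" using assms by (simp add: w)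
  show "fst w \<noteq> 0"
  proof
    assume "fst w = 0"
    then have "norm v ^ 2 \<le> 0" using assms energy_over_origin[of v] by (simp add: w)
    then show False using assms \<open>fst w = 0\<close> by (simp add: w zero_prod_def)
  qed
qed

lemma map_Sub_interior:
  assumes "z \<in> Sub - bM_le0"
  shows "\<pi> z \<in> SubH - {0}"
proof -
  have z: "z \<in> Mi" "Ht z \<le> 0" using assms unfolding Sub_interior by auto
  have "\<pi> z \<in> TE" using mcgehee_map_interior(2)[OF z(1)] by (simp add: mem_Times_iff)
  moreover have "\<pi> z \<noteq> 0" using mcgehee_map_interior(1)[OF z(1)] by (metis fst_zero)
  moreover have "H (\<pi> z) \<le> 0" using energy_sign(1)[OF z(1)] z(2) by simp
  ultimately show ?thesis by simp
qed

lemma inverse_SubH: "w \<in> SubH - {0} \<Longrightarrow> mcgehee_inverse l w \<in> Sub - bM_le0"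
  unfolding Sub_interior
  using SubH_fst[of w] mcgehee_inverse_in_interior[of w r\<^sub>E l] energy_sign(1)[of "mcgehee_inverse l w"]
  by (simp add: mcgehee_map_inverse)

lemma map_homeomorphism: "homeomorphism (Sub - bM_le0) (SubH - {0}) \<pi> (mcgehee_inverse l)"
proof (rule homeomorphismI)
  show "continuous_on (Sub - bM_le0) \<pi>"
    using l_ge by (intro continuous_on_mcgehee_map[of _ _ r\<^sub>E]) auto
  show "continuous_on (SubH - {0}) (mcgehee_inverse l)"
    by (rule continuous_on_mcgehee_inverse) (rule SubH_fst(1))
  show "\<pi> ` (Sub - bM_le0) \<subseteq> SubH - {0}"
    by (rule image_subsetI) (rule map_Sub_interior)
  show "mcgehee_inverse l ` (SubH - {0}) \<subseteq> Sub - bM_le0"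
    by (rule image_subsetI) (rule inverse_SubH)
  show "mcgehee_inverse l (\<pi> z) = z" if "z \<in> Sub - bM_le0" for z
    using that unfolding Sub_interior by (auto intro: mcgehee_inverse_map)
  show "\<pi> (mcgehee_inverse l w) = w" if "w \<in> SubH - {0}" for w
    using SubH_fst(1)[OF that] by (rule mcgehee_map_inverse)
qed

lemma SubH_punctured_invariant:
  assumes \<delta>: "integral_curve X TE J \<delta>" and ne: "\<delta> ` J \<inter> (SubH - {0}) \<noteq> {}"
  shows "\<delta> ` J \<subseteq> SubH - {0}"
proof -
  obtain t0 where "t0 \<in> J" "\<delta> t0 \<in> SubH - {0}" using ne by (rule image_meetsE)
  then have t0: "t0 \<in> J" "H (\<delta> t0) \<le> 0" "\<delta> t0 \<noteq> 0" by simp_all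
  have "\<delta> t \<in> SubH - {0}" if t: "t \<in> J" for t
  proof -
    \<comment> \<open>The two times change roles: a zero at \<open>t\<close> would force one at
      \<open>t0\<close>.\<close>
    have "\<delta> t \<noteq> 0" using origin_isolated_orbit[OF \<delta> t _ t0(1)] t0(3) by blast
    moreover have "H (\<delta> t) \<le> 0" using energy_constant[OF \<delta> t t0(1)] t0(2) by simp
    moreover have "\<delta> t \<in> TE" using \<delta> t unfolding integral_curve_def by blast
    ultimately show ?thesis by simp
  qed
  then show ?thesis by (rule image_subsetI)
qed

lemma Sub_interior_invariant:
  assumes \<gamma>: "integral_curve Xt M I \<gamma>" and ne: "\<gamma> ` I \<inter> (Sub - bM_le0) \<noteq> {}"
  shows "\<gamma> ` I \<subseteq> Sub - bM_le0"
proof -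
  obtain t0 where "t0 \<in> I" "\<gamma> t0 \<in> Sub - bM_le0" using ne by (rule image_meetsE)
  then have t0: "t0 \<in> I" "\<gamma> t0 \<in> Mi" "Ht (\<gamma> t0) \<le> 0" unfolding Sub_interior by simp_all
  have "\<gamma> t \<in> Sub - bM_le0" if t: "t \<in> I" for t
    unfolding Sub_interior
    using interior_invariant[OF \<gamma> t0(1,2) t] sublevel_invariant[OF \<gamma> t0(1,3) t] by simp
  then show ?thesis by (rule image_subsetI)
qed

text \<open>On these punctured regions \<open>r\<close> is positive, so the density of the time
  change is positive and continuous in both directions.\<close>

sublocale conj: time_changed_conjugacy Xt M "Sub - bM_le0" X TE "SubH - {0}" \<pi> "mcgehee_inverse l"
  "\<lambda>z. fst z powr (1 - real l / 2)"
proof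
  show "homeomorphism (Sub - bM_le0) (SubH - {0}) \<pi> (mcgehee_inverse l)" by (rule map_homeomorphism)
  have pos: "fst z > 0" if "z \<in> Sub - bM_le0" for z
    using that unfolding Sub_interior by (auto simp: mcgehee_interior_def)
  show "fst z powr (1 - real l / 2) > 0" if "z \<in> Sub - bM_le0" for z
    using pos[OF that] by simp
  show "continuous_on (Sub - bM_le0) (\<lambda>z. fst z powr (1 - real l / 2))"
    by (intro continuous_intros ballI pos[THEN less_imp_neq[THEN not_sym]])
  show "((\<lambda>t. \<pi> (\<gamma> t)) has_vector_derivative fst (\<gamma> t) powr (1 - real l / 2) *\<^sub>R X (\<pi> (\<gamma> t))) (at t)"
    if \<gamma>: "integral_curve Xt M I \<gamma>" "\<gamma> ` I \<subseteq> Sub - bM_le0" "t \<in> I" for I \<gamma> t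
  proof -
    have "\<gamma> t \<in> Sub - bM_le0" by (rule subsetD[OF \<gamma>(2) imageI[OF \<gamma>(3)]])
    then have "\<gamma> t \<in> Mi" unfolding Sub_interior by simp
    then show ?thesis using interior_push[OF \<gamma>(1)] \<gamma>(3) by simp
  qed
  show "((\<lambda>t. mcgehee_inverse l (\<delta> t)) has_vector_derivative
      (1 / fst (mcgehee_inverse l (\<delta> t)) powr (1 - real l / 2)) *\<^sub>R Xt (mcgehee_inverse l (\<delta> t))) (at t)"
    if \<delta>: "integral_curve X TE J \<delta>" "\<delta> ` J \<subseteq> SubH - {0}" "t \<in> J" for J \<delta> t
  proof -
    have "\<delta> t \<in> SubH - {0}" by (rule subsetD[OF \<delta>(2) imageI[OF \<delta>(3)]])
    note dom = SubH_fst[OF this]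
    have "(\<delta> has_vector_derivative X (\<delta> t)) (at t)" using \<delta>(1,3) by (simp add: integral_curve_def)
    from mcgehee_pull[OF this dom, of l] show ?thesis
      using mcgehee_field_interior[OF mcgehee_inverse_in_interior[OF dom]] by simp
  qed
qed (use Sub_interior_invariant SubH_punctured_invariant in auto)

text \<open>A minimiser \<open>q\<close> of \<open>Ul\<close> on the sphere is a critical point of \<open>Ul - m \<parallel>\<cdot>\<parallel>\<^sup>l\<close>, where
  \<open>m = Ul q\<close>, so \<open>(0, q, sqrt (- 2 m) q)\<close> is an equilibrium; it represents the orbit \<open>0\<close>.\<close>

lemma boundary_equilibrium: "\<exists>z\<in>bM. Xt z = 0 \<and> Ht z = 0"
proof -
  obtain q0 :: "real^'n" where q0: "norm q0 = 1" "Ul q0 \<le> 0" using nonpos_direction by blast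
  then have "sphere (0::real^'n) 1 \<noteq> {}" by auto
  then obtain q where q: "norm q = 1" and min: "\<And>q'. norm q' = 1 \<Longrightarrow> Ul q \<le> Ul q'"
    using continuous_attains_inf[OF compact_sphere _ Ul_cont, of 0 1] by auto
  define m where "m = Ul q"
  have m: "m \<le> 0" using min[OF q0(1)] q0(2) by (simp add: m_def)
  define f where "f x = Ul x - m * norm x ^ l" for x
  have f0: "f q = 0" by (simp add: f_def m_def q)
  have f_nonneg: "0 \<le> f x" for x
  proof (cases "x = 0")
    case True
    then show ?thesis using Ul_hom[of 0 0] l_ge by (simp add: f_def power_0_left)
  next
    case False
    have "Ul x = norm x ^ l * Ul (x /\<^sub>R norm x)"
      using Ul_hom[of "norm x" "x /\<^sub>R norm x"] False by simp
    moreover have "norm x ^ l * m \<le> norm x ^ l * Ul (x /\<^sub>R norm x)"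
      unfolding m_def using False by (intro mult_left_mono min) auto
    ultimately show ?thesis by (simp add: f_def mult.commute)
  qed
  have "q \<noteq> 0" using q by auto
  then have "(norm has_derivative (\<lambda>h. h \<bullet> sgn q)) (at q)" by (rule has_derivative_norm)
  from has_derivative_power[OF this, of l]
  have "((\<lambda>x. norm x ^ l) has_derivative (\<lambda>h. real l * (h \<bullet> q))) (at q)"
    by (simp add: q sgn_div_norm)
  then have "(f has_derivative (\<lambda>h. dUl q \<bullet> h - m * (real l * (h \<bullet> q)))) (at q)"
    unfolding f_def by (intro has_derivative_diff Ul_deriv has_derivative_mult_right)
  then have "(\<lambda>h. dUl q \<bullet> h - m * (real l * (h \<bullet> q))) = (\<lambda>h. 0)"
    by (rule has_derivative_local_min) (simp add: f0 f_nonneg)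
  then have "dUl q \<bullet> h = (m * real l) *\<^sub>R q \<bullet> h" for h
    by (auto dest!: fun_cong[where x = h] simp: inner_commute)
  then have dUl: "dUl q = (m * real l) *\<^sub>R q" by (metis vector_eq_rdot)
  define k where "k = sqrt (- 2 * m)"
  have k: "k * k = - 2 * m" using m by (simp add: k_def)
  have qq: "q \<bullet> q = 1" using q by (simp add: norm_eq_1)
  have "Xt (0, q, k *\<^sub>R q) = (0, 0, - ((m * real l) *\<^sub>R q) - (real l / 2 * (k * k)) *\<^sub>R q)"
    by (simp add: field_boundary[OF q] qq dUl)
  also have "\<dots> = 0" by (simp add: k zero_prod_def flip: scaleR_minus_left scaleR_left_diff_distrib)
  finally have "Xt (0, q, k *\<^sub>R q) = 0" .
  moreover have "Ht (0, q, k *\<^sub>R q) = 0"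
    using k q by (simp add: energy_boundary[OF q] m_def power2_eq_square)
  ultimately show ?thesis
    using q by (intro bexI[of _ "(0, q, k *\<^sub>R q)"]) (auto simp: mcgehee_boundary_def)
qed

lemma boundary_le0_nonempty: "bM_le0 \<noteq> {}"
proof -
  obtain z where "z \<in> bM" "Ht z = 0" using boundary_equilibrium by blast
  then have "z \<in> bM_le0" by simp
  then show ?thesis by (metis empty_iff)
qed

lemma image_Sub: "\<pi> ` Sub = SubH"
proof
  have "\<pi> z \<in> SubH" if "z \<in> Sub" for z
  proof (cases "z \<in> bM")
    case True
    then show ?thesis using map_boundary energy_origin rE_pos by (simp add: mem_Times_iff)
  next
    case False
    then show ?thesis using map_Sub_interior[of z] that by simp
  qed
  then show "\<pi> ` Sub \<subseteq> SubH" by (rule image_subsetI)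
  show "SubH \<subseteq> \<pi> ` Sub"
  proof
    fix w assume w: "w \<in> SubH"
    show "w \<in> \<pi> ` Sub"
    proof (cases "w = 0")
      case True
      obtain z where "z \<in> bM" "Ht z \<le> 0" using boundary_le0_nonempty by blast
      then show ?thesis using True map_boundary boundary_subset by (intro image_eqI[of _ _ z]) auto
    next
      case False
      then have w': "w \<in> SubH - {0}" using w by simp
      show ?thesis
        using inverse_SubH[OF w'] mcgehee_map_inverse[OF SubH_fst(1)[OF w']]
        by (intro image_eqI[of _ _ "mcgehee_inverse l w"]) simp_all
    qed
  qed
qed

lemma fibre_origin: "{z \<in> Sub. \<pi> z = 0} = bM_le0"
proof -
  have "\<pi> z \<noteq> 0" if "z \<in> Sub - bM_le0" for z using map_Sub_interior[OF that] by simp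
  then show ?thesis using map_boundary boundary_subset by auto
qed

text \<open>Both sides are subspaces of Euclidean spaces, so compact preimages of compact sets are
  enough. Homogeneity in \<open>y\<close> reduces the lower bound for the kinetic form to unit
  vectors, where compactness supplies it.\<close>

lemma Sub_proper: "proper_map (top_of_set Sub) (top_of_set SubH) \<pi>"
proof (rule compact_imp_proper_map)
  show "k_space (top_of_set SubH)"
    by (intro metrizable_imp_k_space metrizable_space_subtopology metrizable_space_euclidean)
  show "kc_space (top_of_set SubH)"
    by (intro Hausdorff_imp_kc_space Hausdorff_space_subtopology Hausdorff_space_euclidean)
  show "\<pi> \<in> topspace (top_of_set Sub) \<rightarrow> topspace (top_of_set SubH)"
    using image_Sub by auto
  have \<pi>_cont: "continuous_on M \<pi>"
    using l_ge by (intro continuous_on_mcgehee_map[of _ _ r\<^sub>E]) auto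
  then have "continuous_on Sub \<pi>" by (rule continuous_on_subset) auto
  then show "continuous_map (top_of_set Sub) (top_of_set SubH) \<pi> \<or> kc_space (top_of_set Sub)"
    using image_Sub by (simp add: continuous_map_in_subtopology flip: image_subset_iff_funcset)
  fix K assume "compactin (top_of_set SubH) K"
  then have K: "compact K" "K \<subseteq> SubH" by (auto simp: compactin_subtopology)
  \<comment> \<open>A compact \<open>K\<close> keeps \<open>norm x\<close>, hence \<open>r\<close>,
    below some \<open>\<rho> < r\<^sub>E\<close>; near the rim of the ball nothing bounds the metric
    from below.\<close>
  obtain \<rho> where \<rho>: "\<rho> < r\<^sub>E" "\<And>w. w \<in> K \<Longrightarrow> norm (fst w) \<le> \<rho>"
  proof (cases "K = {}")
    case True
    then show ?thesis using that[of 0] rE_pos by simp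
  next
    case False
    have "continuous_on K (\<lambda>w. norm (fst w))" by (intro continuous_intros)
    then obtain w0 where "w0 \<in> K" "\<And>w. w \<in> K \<Longrightarrow> norm (fst w) \<le> norm (fst w0)"
      using continuous_attains_sup[OF K(1) False] by blast
    moreover from this(1) have "norm (fst w0) < r\<^sub>E" using K(2) by auto
    ultimately show ?thesis using that by blast
  qed
  define Q where "Q = {0..\<rho>} \<times> sphere (0::real^'n) 1 \<times> sphere (0::real^'n) 1"
  have QM: "Q \<subseteq> M" using \<rho>(1) by (auto simp: Q_def mcgehee_space_def)
  have Q: "compact Q" unfolding Q_def by (intro compact_Times compact_Icc compact_sphere)
  define G where "G z = snd (snd z) \<bullet> (g (fst z *\<^sub>R fst (snd z)) *v snd (snd z))" for z
  have G_cont: "continuous_on Q G" unfolding G_def by (rule continuous_on_subset[OF g_form_cont QM])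
  have G_pos: "0 < G z" if z: "z \<in> Q" for z
  proof -
    have "fst z *\<^sub>R fst (snd z) \<in> E" using z \<rho>(1) by (auto simp: Q_def)
    moreover have "snd (snd z) \<noteq> 0" using z by (auto simp: Q_def)
    ultimately show ?thesis unfolding G_def by (rule g_posdef)
  qed
  obtain c where c: "c > 0" "\<And>z. z \<in> Q \<Longrightarrow> c \<le> G z"
  proof (cases "Q = {}")
    case True
    then show ?thesis using that[of 1] by simp
  next
    case False
    then obtain z0 where "z0 \<in> Q" "\<And>z. z \<in> Q \<Longrightarrow> G z0 \<le> G z"
      using continuous_attains_inf[OF Q False G_cont] by blast
    then show ?thesis using that[of "G z0"] G_pos by blast
  qed
  have "compact ((\<lambda>z. V (fst z) (fst (snd z))) ` Q)" (is "compact ?VQ")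
    by (rule compact_continuous_image[OF continuous_on_subset[OF V_cont QM] Q])
  from compact_imp_bounded[OF this] obtain B where "\<forall>x\<in>?VQ. norm x \<le> B"
    unfolding bounded_iff by (rule exE)
  then have B: "\<And>z. z \<in> Q \<Longrightarrow> \<bar>V (fst z) (fst (snd z))\<bar> \<le> B"
    by simp
  \<comment> \<open>Non-positive energy gives
    \<open>1/2 * c * norm y ^ 2 <= - V <= B\<close>.\<close>
  define R where "R = sqrt (2 * B / c)"
  define T where "T = {0..\<rho>} \<times> sphere (0::real^'n) 1 \<times> cball (0::real^'n) R"
  have T: "compact T" unfolding T_def by (intro compact_Times compact_Icc compact_sphere compact_cball)
  have TM: "T \<subseteq> M" using \<rho>(1) by (auto simp: T_def mcgehee_space_def)
  have in_T: "z \<in> T" if z: "z \<in> Sub" "\<pi> z \<in> K" for z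
  proof -
    obtain r q y where zeq: "z = (r, q, y)" by (cases z)
    have q: "norm q = 1" "0 \<le> r" using z(1) by (auto simp: zeq mcgehee_space_def)
    then have r: "r \<le> \<rho>" using \<rho>(2)[OF z(2)] by (simp add: zeq mcgehee_map_def)
    have "norm y \<le> R"
    proof (cases "y = 0")
      case True
      \<comment> \<open>Any point of \<open>Q\<close> shows \<open>0 <= B\<close>; here
        \<open>q\<close> doubles as the unit vector in the last component.\<close>
      have "(r, q, q) \<in> Q" using q r by (simp add: Q_def)
      then have "0 \<le> B" using B by force
      then show ?thesis using True c(1) by (simp add: R_def)
    next
      case False
      define u where "u = y /\<^sub>R norm y"
      have u: "(r, q, u) \<in> Q" "y = norm y *\<^sub>R u" using q r False by (auto simp: Q_def u_def)
      have "y \<bullet> (g (r *\<^sub>R q) *v y) = norm y ^ 2 * G (r, q, u)"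
        using arg_cong[OF u(2), of "\<lambda>y. y \<bullet> (g (r *\<^sub>R q) *v y)"]
        by (simp add: G_def linear_scale[OF matrix_vector_mul_linear] power2_eq_square)
      moreover have "norm y ^ 2 * c \<le> norm y ^ 2 * G (r, q, u)"
        using c(2)[OF u(1)] by (intro mult_left_mono) auto
      moreover have "Htf z \<le> 0" using z(1) energy_eq[of z] by simp
      then have "1/2 * (y \<bullet> (g (r *\<^sub>R q) *v y)) + V r q \<le> 0" by (simp add: Htf_def zeq)
      moreover have "- B \<le> V r q" using B[OF u(1)] by simp
      ultimately have "norm y ^ 2 * c \<le> 2 * B" by linarith
      then have "norm y ^ 2 \<le> 2 * B / c" using c(1) by (simp add: pos_le_divide_eq)
      then show ?thesis unfolding R_def by (rule real_le_rsqrt)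
    qed
    then show ?thesis using q r by (simp add: T_def zeq)
  qed
  \<comment> \<open>Both conditions are closed inside the compact \<open>T\<close>, and the whole
    preimage lies in \<open>T\<close>.\<close>
  have "closed (T \<inter> Ht -` {..0})"
    using T TM Ht_cont by (intro continuous_closed_preimage) (auto intro: continuous_on_subset compact_imp_closed)
  moreover have "closed (T \<inter> \<pi> -` K)"
    using T TM \<pi>_cont K(1) by (intro continuous_closed_preimage) (auto intro: continuous_on_subset compact_imp_closed)
  ultimately have "compact (T \<inter> ((T \<inter> Ht -` {..0}) \<inter> (T \<inter> \<pi> -` K)))"
    by (intro compact_Int_closed[OF T closed_Int])
  moreover have "T \<inter> ((T \<inter> Ht -` {..0}) \<inter> (T \<inter> \<pi> -` K)) = {z \<in> Sub. \<pi> z \<in> K}"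
    using in_T TM by auto
  ultimately show "compactin (top_of_set Sub) {z \<in> topspace (top_of_set Sub). \<pi> z \<in> K}"
    by (auto simp: compactin_subtopology)
qed

lemma negative_region_analytic_diffeo:
  "real_analytic_diffeo ({z \<in> M. Ht z < 0} - (bM_le0 - {z \<in> bM. Ht z = 0})) {w \<in> TE. H w < 0} \<pi>"
proof -
  define S where "S = {z \<in> Mi. Ht z < 0}"
  define T where "T = {w \<in> TE. H w < 0}"
  \<comment> \<open>Removing the boundary points of negative energy leaves interior points only,
    where real powers of \<open>r\<close> are analytic.\<close>
  have S_eq: "{z \<in> M. Ht z < 0} - (bM_le0 - {z \<in> bM. Ht z = 0}) = S"
    by (auto simp: S_def mcgehee_interior_eq)
  have T_sub: "T \<subseteq> SubH - {0}" using energy_origin by (auto simp: T_def)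
  have inj: "inj_on \<pi> Mi"
    by (rule inj_on_inverseI[where g = "mcgehee_inverse l"]) (rule mcgehee_inverse_map)
  have S_sub: "S \<subseteq> Mi" by (auto simp: S_def)
  have img: "\<pi> ` S = T"
  proof
    show "\<pi> ` S \<subseteq> T"
    proof (rule image_subsetI)
      fix z assume "z \<in> S"
      then have z: "z \<in> Mi" "Ht z < 0" by (auto simp: S_def)
      then show "\<pi> z \<in> T"
        using mcgehee_map_interior(2)[OF z(1)] energy_sign(2)[OF z(1)] by (simp add: T_def mem_Times_iff)
    qed
    show "T \<subseteq> \<pi> ` S"
    proof
      fix w assume w: "w \<in> T"
      then have dom: "fst w \<noteq> 0" "norm (fst w) < r\<^sub>E" using SubH_fst T_sub by blast+
      have "mcgehee_inverse l w \<in> S"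
        using mcgehee_inverse_in_interior[OF dom] energy_sign(2)[of "mcgehee_inverse l w"] w dom
        by (simp add: S_def T_def mcgehee_map_inverse)
      then show "w \<in> \<pi> ` S" using mcgehee_map_inverse[OF dom(1)] by (metis imageI)
    qed
  qed
  have "real_analytic_on (the_inv_into S \<pi>) T"
  proof (rule real_analytic_on_cong)
    show "real_analytic_on (mcgehee_inverse l) T"
      using SubH_fst T_sub by (intro real_analytic_mcgehee_inverse) blast
    fix w assume "w \<in> T"
    then obtain z where z: "z \<in> S" "w = \<pi> z" using img by blast
    then show "mcgehee_inverse l w = the_inv_into S \<pi> w"
      using the_inv_into_f_f[OF inj_on_subset[OF inj S_sub] z(1)]
        mcgehee_inverse_map[OF subsetD[OF S_sub z(1)], of l] by simp
  qed
  then show ?thesis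
    unfolding real_analytic_diffeo_def S_eq T_def[symmetric]
    using img inj_on_subset[OF inj S_sub] real_analytic_mcgehee_map[OF S_sub] by (simp add: bij_betw_def)
qed

section \<open>Correspondence of maximal orbits\<close>

lemma origin_maximal: "maximal_integral_curve X TE UNIV (\<lambda>_. 0)"
  using rE_pos by (intro equilibrium_maximal field_at_origin) (simp add: mem_Times_iff)

lemma boundary_orbit_or_interior:
  assumes \<gamma>: "maximal_integral_curve Xt M I \<gamma>" "\<gamma> ` I \<subseteq> Sub"
  shows "\<gamma> ` I \<subseteq> bM \<or> \<gamma> ` I \<subseteq> Sub - bM_le0"
proof (cases "\<gamma> ` I \<inter> bM = {}")
  case True
  then show ?thesis using \<gamma>(2) by blast
next
  case False
  then obtain t0 where "t0 \<in> I" "\<gamma> t0 \<in> bM" by blast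
  moreover have "integral_curve Xt M I \<gamma>" using \<gamma>(1) by (simp add: maximal_integral_curve_def)
  ultimately show ?thesis using boundary_invariant by blast
qed

lemma maps_orbits: "maps_orbits_oriented Xt M Sub X TE \<pi>"
  unfolding maps_orbits_oriented_def
proof (intro allI impI, elim conjE)
  fix I \<gamma> assume \<gamma>: "maximal_integral_curve Xt M I \<gamma>" "\<gamma> ` I \<subseteq> Sub"
  from boundary_orbit_or_interior[OF this]
  show "\<exists>J \<delta> s. maximal_integral_curve X TE J \<delta> \<and> strict_mono_on I s \<and> s ` I = J \<and> (\<forall>t\<in>I. \<pi> (\<gamma> t) = \<delta> (s t))"
  proof
    assume "\<gamma> ` I \<subseteq> Sub - bM_le0"
    from conj.maximal_image[OF \<gamma>(1) this] show ?thesis by blast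
  next
    assume bM: "\<gamma> ` I \<subseteq> bM"
    \<comment> \<open>The image is the constant curve at the origin, whose maximal interval is the
      whole line, so \<open>I\<close> has to be stretched onto it.\<close>
    have "open I" "is_interval I" "I \<noteq> {}"
      using \<gamma>(1) by (auto simp: maximal_integral_curve_def integral_curve_def)
    then obtain s :: "real \<Rightarrow> real" where "strict_mono_on I s" "s ` I = UNIV"
      using open_interval_stretch_to_line by blast
    moreover have "\<forall>t\<in>I. \<pi> (\<gamma> t) = 0" using bM map_boundary by blast
    ultimately show ?thesis using origin_maximal by (intro exI[of _ UNIV] exI[of _ "\<lambda>_. 0"] exI[of _ s]) simp
  qed
qed

lemma orbits_Sub: "(\<lambda>C. \<pi> ` C) ` orbits Xt M Sub = orbits X TE SubH"
proof
  have origin: "{0} \<in> orbits X TE SubH"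
    using orbitsI[OF origin_maximal, of SubH] energy_origin rE_pos by (simp add: mem_Times_iff)
  show "(\<lambda>C. \<pi> ` C) ` orbits Xt M Sub \<subseteq> orbits X TE SubH"
  proof (rule image_subsetI)
    fix C assume "C \<in> orbits Xt M Sub"
    then obtain I \<gamma> where C: "C = \<gamma> ` I" "maximal_integral_curve Xt M I \<gamma>" "\<gamma> ` I \<subseteq> Sub"
      by (rule orbitsE)
    from boundary_orbit_or_interior[OF C(2,3)]
    show "\<pi> ` C \<in> orbits X TE SubH"
    proof
      assume bM: "\<gamma> ` I \<subseteq> bM"
      have "\<pi> (\<gamma> t) = 0" if "t \<in> I" for t
        by (rule map_boundary) (rule subsetD[OF bM imageI[OF that]])
      then have "\<pi> ` C = (\<lambda>_. 0) ` I"
        unfolding C(1) image_image by (rule image_cong[OF refl])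
      moreover have "I \<noteq> {}" using C(2) by (simp add: maximal_integral_curve_def integral_curve_def)
      ultimately have "\<pi> ` C = {0}" by (simp add: image_constant_conv)
      then show ?thesis using origin by simp
    next
      assume "\<gamma> ` I \<subseteq> Sub - bM_le0"
      then have "C \<in> orbits Xt M (Sub - bM_le0)" unfolding C(1) by (rule orbitsI[OF C(2)])
      then have "\<pi> ` C \<in> orbits X TE (SubH - {0})" by (rule conj.orbit_image)
      then show ?thesis by (rule orbits_mono[OF Diff_subset])
    qed
  qed
  show "orbits X TE SubH \<subseteq> (\<lambda>C. \<pi> ` C) ` orbits Xt M Sub"
  proof
    fix D assume "D \<in> orbits X TE SubH"
    then obtain J \<delta> where D: "D = \<delta> ` J" "maximal_integral_curve X TE J \<delta>" "\<delta> ` J \<subseteq> SubH"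
      by (rule orbitsE)
    show "D \<in> (\<lambda>C. \<pi> ` C) ` orbits Xt M Sub"
    proof (cases "0 \<in> D")
      case True
      then obtain t0 where "t0 \<in> J" "\<delta> t0 = 0" using D(1) by auto
      moreover have "integral_curve X TE J \<delta>" using D(2) by (simp add: maximal_integral_curve_def)
      ultimately have "\<delta> t = 0" if "t \<in> J" for t
        using origin_isolated_orbit that by metis
      then have "D \<subseteq> {0}" unfolding D(1) by (intro image_subsetI) simp
      then have D0: "D = {0}" using True by blast
      \<comment> \<open>Any maximal boundary curve in the region would be a preimage; the
        equilibrium supplies an explicit one, maximal because it is defined for all times.\<close>
      obtain z where z: "z \<in> bM" "Xt z = 0" "Ht z = 0" using boundary_equilibrium by blast
      have "maximal_integral_curve Xt M UNIV (\<lambda>_. z)"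
        using z boundary_subset by (intro equilibrium_maximal) auto
      then have "{z} \<in> orbits Xt M Sub"
        using orbitsI[of Xt M UNIV "\<lambda>_. z" Sub] z boundary_subset by auto
      moreover have "D = \<pi> ` {z}" using D0 map_boundary[OF z(1)] by simp
      ultimately show ?thesis by (rule image_eqI[rotated])
    next
      case False
      have "\<delta> ` J \<subseteq> SubH - {0}"
        by (rule subset_Diff_insert[THEN iffD2]) (use False D(1,3) in simp)
      then have "D \<in> orbits X TE (SubH - {0})" unfolding D(1) by (rule orbitsI[OF D(2)])
      then obtain C where C: "C \<in> orbits Xt M (Sub - bM_le0)" "D = \<pi> ` C"
        unfolding conj.orbits_image[symmetric] by (rule imageE)
      from orbits_mono[OF Diff_subset C(1)] show ?thesis unfolding C(2) by (rule imageI)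
    qed
  qed
qed

lemma Sub_invariant: "flow_invariant Xt M Sub"
  unfolding flow_invariant_def
proof (intro conjI allI impI, blast, elim conjE)
  fix I \<gamma> assume "maximal_integral_curve Xt M I \<gamma>" and ne: "\<gamma> ` I \<inter> Sub \<noteq> {}"
  then have \<gamma>: "integral_curve Xt M I \<gamma>" by (simp add: maximal_integral_curve_def)
  obtain t0 where "t0 \<in> I" "\<gamma> t0 \<in> Sub" using ne by (rule image_meetsE)
  then have t0: "t0 \<in> I" "Ht (\<gamma> t0) \<le> 0" by simp_all
  have "\<gamma> t \<in> Sub" if "t \<in> I" for t
    using sublevel_invariant[OF \<gamma> t0 that] \<gamma> that unfolding integral_curve_def by blast
  then show "\<gamma> ` I \<subseteq> Sub" by (rule image_subsetI)
qed

lemma SubH_invariant: "flow_invariant X TE SubH"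
  unfolding flow_invariant_def
proof (intro conjI allI impI, blast, elim conjE)
  fix J \<delta> assume "maximal_integral_curve X TE J \<delta>" and ne: "\<delta> ` J \<inter> SubH \<noteq> {}"
  then have \<delta>: "integral_curve X TE J \<delta>" by (simp add: maximal_integral_curve_def)
  obtain t0 where "t0 \<in> J" "\<delta> t0 \<in> SubH" using ne by (rule image_meetsE)
  then have t0: "t0 \<in> J" "H (\<delta> t0) \<le> 0" by simp_all
  have "\<delta> t \<in> SubH" if "t \<in> J" for t
    using energy_constant[OF \<delta> that t0(1)] t0(2) \<delta> that unfolding integral_curve_def by auto
  then show "\<delta> ` J \<subseteq> SubH" by (rule image_subsetI)
qed

lemma blow_up:
  "\<pi> ` Sub = SubH \<and> continuous_on Sub \<pi> \<and> proper_map (top_of_set Sub) (top_of_set SubH) \<pi> \<and>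
   {z \<in> Sub. \<pi> z = (0, 0)} = bM_le0 \<and> bM_le0 \<noteq> {} \<and>
   (\<exists>\<rho>. homeomorphism (Sub - bM_le0) (SubH - {(0, 0)}) \<pi> \<rho>) \<and>
   real_analytic_diffeo ({z \<in> M. Ht z < 0} - (bM_le0 - {z \<in> bM. Ht z = 0})) {w \<in> TE. H w < 0} \<pi> \<and>
   (flow_invariant Xt M Sub \<and> flow_invariant X TE SubH \<and>
    maps_orbits_oriented Xt M Sub X TE \<pi> \<and>
    (\<lambda>C. \<pi> ` C) ` orbits Xt M Sub = orbits X TE SubH \<and>
    topological_equivalence Xt M (Sub - bM_le0) X TE (SubH - {(0, 0)}) \<pi>)"
proof (intro conjI)
  show "\<exists>\<rho>. homeomorphism (Sub - bM_le0) (SubH - {(0, 0)}) \<pi> \<rho>"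
    using map_homeomorphism unfolding zero_prod_def by blast
  show "continuous_on Sub \<pi>"
    using l_ge by (intro continuous_on_mcgehee_map[of _ _ r\<^sub>E]) auto
  show "{z \<in> Sub. \<pi> z = (0, 0)} = bM_le0"
    using fibre_origin unfolding zero_prod_def .
  show "topological_equivalence Xt M (Sub - bM_le0) X TE (SubH - {(0, 0)}) \<pi>"
    using conj.topological_equivalence unfolding zero_prod_def .
qed (fact image_Sub Sub_proper boundary_le0_nonempty negative_region_analytic_diffeo Sub_invariant
    SubH_invariant maps_orbits orbits_Sub)+

end

subsection \<open>From analytic data to the blow-up\<close>

lemma real_analytic_on_imp_differentiable:
  fixes f :: "'a::euclidean_space \<Rightarrow> real"
  assumes "real_analytic_on f S" "open S" "a \<in> S"
  shows "f differentiable (at a)"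
proof -
  obtain P P' A \<rho> where e: "homogeneous_expansion f a P P' A \<rho>"
    using real_analytic_on_imp_homogeneous_expansion[OF assms] by blast
  obtain C \<delta> D where "0 < \<delta>" and D: "\<forall>h. norm h < \<delta> \<longrightarrow> \<bar>f (a + h)\<bar> \<le> C * norm h ^ 0 \<and>
    (f has_derivative D h) (at (a + h)) \<and> (\<forall>v. \<bar>D h v\<bar> \<le> C * norm h ^ (0 - 1) * norm v)"
    using homogeneous_expansion_bounds[OF e, of 0] by auto
  then have "(f has_derivative D 0) (at (a + 0))" by (metis norm_zero)
  then show ?thesis unfolding differentiable_def by auto
qed

text \<open>Used with the order \<open>l + 1\<close> for the remainder of \<open>U\<close>, 2 for
  \<open>U\<close>, 0 for the metric, and an order of at least \<open>1 + l / 2\<close> for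
  \<open>\<mu>\<close>.\<close>

lemma homogeneous_expansion_partial_bounds:
  fixes f :: "real^'n \<Rightarrow> real"
  assumes e: "homogeneous_expansion f 0 P P' A \<rho>" and P0: "\<And>k h. k < m \<Longrightarrow> P k h = 0"
  shows "\<exists>C. \<forall>\<^sub>F x in nhds 0. \<bar>f x\<bar> \<le> C * norm x ^ m \<and> f differentiable (at x) \<and>
    (\<forall>i. \<bar>partial i f x\<bar> \<le> C * norm x ^ (m - 1))"
proof -
  obtain C \<delta> D where \<delta>: "0 < \<delta>" and D: "\<forall>h. norm h < \<delta> \<longrightarrow> \<bar>f (0 + h)\<bar> \<le> C * norm h ^ m \<and>
    (f has_derivative D h) (at (0 + h)) \<and> (\<forall>v. \<bar>D h v\<bar> \<le> C * norm h ^ (m - 1) * norm v)"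
    using homogeneous_expansion_bounds[OF e P0] by blast
  have "\<forall>\<^sub>F x :: real^'n in nhds 0. x \<in> ball 0 \<delta>"
    using \<delta> by (intro eventually_nhds_in_open) auto
  then have "\<forall>\<^sub>F x in nhds 0. \<bar>f x\<bar> \<le> C * norm x ^ m \<and> f differentiable (at x) \<and>
    (\<forall>i. \<bar>partial i f x\<bar> \<le> C * norm x ^ (m - 1))"
  proof eventually_elim
    case (elim x)
    have f: "\<bar>f x\<bar> \<le> C * norm x ^ m" and d: "(f has_derivative D x) (at x)"
      and b: "\<And>v. \<bar>D x v\<bar> \<le> C * norm x ^ (m - 1) * norm v"
      using D elim by simp_all
    have "\<bar>partial i f x\<bar> \<le> C * norm x ^ (m - 1)" for i
      using b[of "axis i 1"] by (simp add: partial_eq[OF d])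
    then show ?case using f d unfolding differentiable_def by blast
  qed
  then show ?thesis by blast
qed

lemma eventually_uniform_bound:
  fixes f :: "'i::finite \<Rightarrow> 'x \<Rightarrow> real"
  assumes "\<And>i. \<exists>C. \<forall>\<^sub>F x in F. f i x \<le> C * b x" and b: "\<And>x. 0 \<le> b x"
  shows "\<exists>C. \<forall>\<^sub>F x in F. \<forall>i. f i x \<le> C * b x"
proof -
  obtain C where C: "\<And>i. \<forall>\<^sub>F x in F. f i x \<le> C i * b x"
    using assms(1) by metis
  have "\<forall>\<^sub>F x in F. \<forall>i. f i x \<le> C i * b x"
    using C by (rule eventually_all_finite)
  then have "\<forall>\<^sub>F x in F. \<forall>i. f i x \<le> (\<Sum>i\<in>UNIV. \<bar>C i\<bar>) * b x"
  proof eventually_elim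
    case (elim x)
    show ?case
    proof
      fix i
      have "C i \<le> (\<Sum>i\<in>UNIV. \<bar>C i\<bar>)"
        using member_le_sum[of i UNIV "\<lambda>i. \<bar>C i\<bar>"] by simp
      then show "f i x \<le> (\<Sum>i\<in>UNIV. \<bar>C i\<bar>) * b x"
        using elim mult_right_mono[OF _ b] order_trans by blast
    qed
  qed
  then show ?thesis by blast
qed

text \<open>On the unit interval a larger exponent gives a smaller power. At \<open>x = 0\<close>
  both sides vanish because \<open>k\<close> is positive.\<close>

lemma power_le_powr:
  fixes x :: real
  assumes "0 \<le> x" "x \<le> 1" "a \<le> real k" "0 < k"
  shows "x ^ k \<le> x powr a"
proof (cases "x = 0")
  case False
  then show ?thesis
    using assms powr_mono'[of a "real k" x] by (simp add: powr_realpow)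
qed (use assms in \<open>simp add: power_0_left\<close>)

text \<open>That the restriction is well-defined and surjective is the equation for its image. What
  remains is to derive the assumptions of \<open>em_system_nonmin\<close> from analyticity, with the
  homogeneous polynomial of degree \<open>l\<close> in the expansion of \<open>U\<close> as leading
  term.\<close>

theorem proposition2p6:
  fixes r\<^sub>E :: real
    and g :: "real^'n \<Rightarrow> real^'n^'n"
    and U :: "real^'n \<Rightarrow> real"
    and \<mu> :: "real^'n \<Rightarrow> real^'n"
    and l d :: nat
    and E :: "(real^'n) set"
    and TE :: "((real^'n) \<times> (real^'n)) set"
    and X :: "(real^'n) \<times> (real^'n) \<Rightarrow> (real^'n) \<times> (real^'n)"
    and H :: "(real^'n) \<times> (real^'n) \<Rightarrow> real"
    and M bM bM0 bM_le0 bM_lt0 :: "(real \<times> (real^'n) \<times> (real^'n)) set"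
    and \<pi> :: "real \<times> (real^'n) \<times> (real^'n) \<Rightarrow> (real^'n) \<times> (real^'n)"
    and Xt :: "real \<times> (real^'n) \<times> (real^'n) \<Rightarrow> real \<times> (real^'n) \<times> (real^'n)"
    and Ht :: "real \<times> (real^'n) \<times> (real^'n) \<Rightarrow> real"
  assumes rE_pos: "r\<^sub>E > 0"
    and E_def: "E = ball 0 r\<^sub>E"
    and TE_def: "TE = E \<times> UNIV"
    and g_analytic: "real_analytic_on g E"
    and g_sym: "\<And>x. x \<in> E \<Longrightarrow> transpose (g x) = g x"
    and g_posdef: "\<And>x v. x \<in> E \<Longrightarrow> v \<noteq> 0 \<Longrightarrow> v \<bullet> (g x *v v) > 0"
    and g_0: "g 0 = mat 1"
    and U_analytic: "real_analytic_on U E"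
    and U_0: "U 0 = 0"
    and dU_0: "(U has_derivative (\<lambda>_. 0)) (at 0)"
    and U_germ: "\<not> (\<forall>\<^sub>F x in nhds 0. U x = 0)"
    and mu_analytic: "real_analytic_on \<mu> E"
    and l_def: "l = (LEAST k. \<exists>x. taylor_term U k x \<noteq> 0)"
    and d_def: "d = (LEAST k. \<exists>i x. taylor_term (\<lambda>y. \<mu> y $ i) k x \<noteq> 0)"
    and weak_magnetism: "(\<forall>x\<in>E. \<mu> x = 0) \<or> real d - real l / 2 \<ge> 1"
    and not_strict_min: "\<not> (\<forall>\<^sub>F x in at 0. U 0 < U x)"
    and X_def: "X = EL_field g U \<mu>"
    and H_def: "H = energy g U"
    and M_def: "M = mcgehee_space r\<^sub>E"
    and bM_def: "bM = mcgehee_boundary"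
    and pi_def: "\<pi> = mcgehee_map l"
    and Xt_def: "Xt = mcgehee_field r\<^sub>E l g U \<mu>"
    and Ht_def: "Ht = mcgehee_energy r\<^sub>E l g U"
    and bM0_def: "bM0 = {z \<in> bM. Ht z = 0}"
    and bM_le0_def: "bM_le0 = {z \<in> bM. Ht z \<le> 0}"
    and bM_lt0_def: "bM_lt0 = bM_le0 - bM0"
  shows
    "\<pi> ` {z \<in> M. Ht z \<le> 0} = {w \<in> TE. H w \<le> 0} \<and>
     continuous_on {z \<in> M. Ht z \<le> 0} \<pi> \<and>
     proper_map (top_of_set {z \<in> M. Ht z \<le> 0}) (top_of_set {w \<in> TE. H w \<le> 0}) \<pi> \<and>
     {z \<in> {z \<in> M. Ht z \<le> 0}. \<pi> z = (0, 0)} = bM_le0 \<and> bM_le0 \<noteq> {} \<and>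
     (\<exists>\<rho>. homeomorphism ({z \<in> M. Ht z \<le> 0} - bM_le0) ({w \<in> TE. H w \<le> 0} - {(0, 0)}) \<pi> \<rho>) \<and>
     real_analytic_diffeo ({z \<in> M. Ht z < 0} - bM_lt0) {w \<in> TE. H w < 0} \<pi> \<and>
     (flow_invariant Xt M {z \<in> M. Ht z \<le> 0} \<and>
      flow_invariant X TE {w \<in> TE. H w \<le> 0} \<and>
      maps_orbits_oriented Xt M {z \<in> M. Ht z \<le> 0} X TE \<pi> \<and>
      (\<lambda>C. \<pi> ` C) ` orbits Xt M {z \<in> M. Ht z \<le> 0} = orbits X TE {w \<in> TE. H w \<le> 0} \<and>
      topological_equivalence Xt M ({z \<in> M. Ht z \<le> 0} - bM_le0)
        X TE ({w \<in> TE. H w \<le> 0} - {(0, 0)}) \<pi>)"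
proof -
  have E: "open E" "0 \<in> E" using rE_pos by (auto simp: E_def)
  obtain P P' A \<rho> where e: "homogeneous_expansion U 0 P P' A \<rho>"
    using real_analytic_on_imp_homogeneous_expansion[OF U_analytic E] by blast
  have \<rho>: "\<rho> > 0" and P_deriv: "\<And>k h. (P k has_derivative P' k h) (at h)"
    and P'_cont: "\<And>k v. continuous_on UNIV (\<lambda>h. P' k h v)"
    and hom: "\<And>k t h. P k (t *\<^sub>R h) = t ^ k * P k h"
    and sums: "\<And>h. norm h < \<rho> \<Longrightarrow> (\<lambda>k. P k h) sums U (0 + h)"
    using e by (auto simp: homogeneous_expansion_def)
  have taylor: "taylor_term U k x = P k x" for k x
    by (rule taylor_term_eq_homogeneous_term[OF e])
  \<comment> \<open>Without a non-zero Taylor term the \<open>LEAST\<close> defining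
    \<open>l\<close> would be unspecified; the non-zero germ rules this out.\<close>
  have ex: "\<exists>k x. taylor_term U k x \<noteq> 0"
  proof (rule ccontr)
    assume "\<not> (\<exists>k x. taylor_term U k x \<noteq> 0)"
    then have P0: "P k h = 0" for k h by (simp add: taylor)
    have "\<forall>\<^sub>F x :: real^'n in nhds 0. x \<in> ball 0 \<rho>"
      using \<rho> by (intro eventually_nhds_in_open) auto
    then have "\<forall>\<^sub>F x in nhds 0. U x = 0"
    proof eventually_elim
      case (elim x)
      then show ?case using sums[of x] by (simp add: P0 sums_iff)
    qed
    then show False using U_germ by simp
  qed
  then have l_ex: "\<exists>x. taylor_term U l x \<noteq> 0"
    unfolding l_def by (rule LeastI_ex)
  have P_below: "P k h = 0" if "k < l" for k h
    using not_less_Least[of k "\<lambda>k. \<exists>x. taylor_term U k x \<noteq> 0"] that unfolding l_def by (simp add: taylor)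
  \<comment> \<open>Orders 0 and 1 drop out because \<open>U\<close> and its derivative vanish at
    the origin, whence \<open>l >= 2\<close>.\<close>
  have "taylor_term U 0 x = 0" for x
    by (simp add: taylor_term_def U_0)
  moreover have "taylor_term U 1 x = 0" for x
  proof -
    have "((\<lambda>t. U (t *\<^sub>R x)) has_derivative (\<lambda>h. 0)) (at 0)"
      using has_derivative_compose[of "\<lambda>t. t *\<^sub>R x" "\<lambda>t. t *\<^sub>R x" 0 UNIV U "\<lambda>_. 0"] dU_0
      by (simp add: has_derivative_scaleR_left)
    then have "((\<lambda>t. U (t *\<^sub>R x)) has_real_derivative 0) (at 0)"
      unfolding has_field_derivative_def by (rule has_derivative_eq_rhs) auto
    then show ?thesis by (simp add: taylor_term_def DERIV_imp_deriv)
  qed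
  ultimately have l_ge: "2 \<le> l"
    using l_ex by (metis One_nat_def Suc_1 less_2_cases not_less)

  define dUl where "dUl x = (\<chi> i. P' l x (axis i 1))" for x
  have dUl: "P' l x v = dUl x \<bullet> v" for x v
  proof -
    have "(P l has_derivative (\<lambda>v. \<Sum>k\<in>UNIV. v $ k * partial k (P l) x)) (at x)"
      using P_deriv by (intro has_derivative_partials) (auto simp: differentiable_def)
    from fun_cong[OF has_derivative_unique[OF P_deriv this], of v]
    have "P' l x v = (\<Sum>k\<in>UNIV. v $ k * partial k (P l) x)" .
    also have "\<dots> = dUl x \<bullet> v"
      by (simp add: dUl_def inner_vec_def partial_eq[OF P_deriv] mult.commute)
    finally show ?thesis .
  qed
  have U_exp: "\<exists>C. \<forall>\<^sub>F x in nhds 0. \<bar>U x - P l x\<bar> \<le> C * norm x ^ (l + 1) \<and>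
      (\<forall>i. \<bar>partial i U x - dUl x $ i\<bar> \<le> C * norm x ^ l)"
  proof -
    \<comment> \<open>The terms below \<open>l\<close> and the removed one all vanish, so the
      remainder has order \<open>l + 1\<close> and its derivative order \<open>l\<close>.\<close>
    have "(P(l := \<lambda>_. 0)) k h = 0" if "k < l + 1" for k h
      using P_below[of k h] that by (cases "k = l") auto
    from homogeneous_expansion_partial_bounds[OF homogeneous_expansion_remove_term[OF e, of l] this]
    obtain C where C: "\<forall>\<^sub>F x in nhds 0. \<bar>U x - P l (x - 0)\<bar> \<le> C * norm x ^ (l + 1) \<and>
      (\<lambda>x. U x - P l (x - 0)) differentiable (at x) \<and>
      (\<forall>i. \<bar>partial i (\<lambda>x. U x - P l (x - 0)) x\<bar> \<le> C * norm x ^ (l + 1 - 1))"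
      by blast
    have "\<forall>\<^sub>F x in nhds 0. \<bar>U x - P l x\<bar> \<le> C * norm x ^ (l + 1) \<and>
      (\<forall>i. \<bar>partial i U x - dUl x $ i\<bar> \<le> C * norm x ^ l)"
      using C
    proof eventually_elim
      case (elim x)
      then obtain D where D: "((\<lambda>x. U x - P l x) has_derivative D) (at x)"
        unfolding differentiable_def by auto
      have "((\<lambda>x. (U x - P l x) + P l x) has_derivative (\<lambda>v. D v + P' l x v)) (at x)"
        by (intro has_derivative_add D P_deriv)
      then have "(U has_derivative (\<lambda>v. D v + P' l x v)) (at x)" by simp
      then have "partial i U x - dUl x $ i = partial i (\<lambda>x. U x - P l x) x" for i
        by (simp add: partial_eq partial_eq[OF D] dUl_def)
      then show ?case using elim by simp
    qed
    then show ?thesis by blast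
  qed
  have U_exp': "\<exists>C. \<forall>\<^sub>F x in nhds 0. \<bar>U x - P l x\<bar> \<le> C * norm x ^ (l + 1)"
    and dU_exp: "\<exists>C. \<forall>\<^sub>F x in nhds 0. \<forall>i. \<bar>partial i U x - dUl x $ i\<bar> \<le> C * norm x ^ l"
    using U_exp by (force elim: eventually_mono)+
  have dU_bound: "\<exists>C. \<forall>\<^sub>F x in nhds 0. \<forall>i. \<bar>partial i U x\<bar> \<le> C * norm x"
  proof -
    have "P k h = 0" if "k < 2" for k h using P_below l_ge that by simp
    from homogeneous_expansion_partial_bounds[OF e this]
    obtain C where "\<forall>\<^sub>F x in nhds 0. \<bar>U x\<bar> \<le> C * norm x ^ 2 \<and> U differentiable (at x) \<and>
      (\<forall>i. \<bar>partial i U x\<bar> \<le> C * norm x ^ (2 - 1))" by blast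
    then have "\<forall>\<^sub>F x in nhds 0. \<forall>i. \<bar>partial i U x\<bar> \<le> C * norm x"
      by eventually_elim simp
    then show ?thesis by blast
  qed

  have g_entry: "real_analytic_on (\<lambda>x. g x $ i $ j) E" for i j
    by (rule real_analytic_on_bounded_linear[OF _ g_analytic])
      (intro bounded_linear_compose[OF bounded_linear_vec_nth bounded_linear_vec_nth])
  have g_bound: "\<exists>C. \<forall>\<^sub>F x in nhds 0. \<forall>i j k. \<bar>partial k (\<lambda>y. g y $ i $ j) x\<bar> \<le> C"
  proof -
    \<comment> \<open>Triples of indices form a finite type, so one uniform bound can cover all
      entries and directions.\<close>
    have "\<exists>C. \<forall>\<^sub>F x in nhds 0. \<bar>partial (snd (snd p)) (\<lambda>y. g y $ fst p $ fst (snd p)) x\<bar> \<le> C * 1"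
      for p :: "'n \<times> 'n \<times> 'n"
    proof -
      obtain Q Q' B \<sigma> where "homogeneous_expansion (\<lambda>y. g y $ fst p $ fst (snd p)) 0 Q Q' B \<sigma>"
        using real_analytic_on_imp_homogeneous_expansion[OF g_entry E] by blast
      \<comment> \<open>Order 0 with \<open>0 - 1 = 0\<close> in the exponent says that the first
        derivatives are bounded near the origin.\<close>
      from homogeneous_expansion_partial_bounds[OF this, of 0]
      obtain C where "\<forall>\<^sub>F x in nhds 0. \<bar>g x $ fst p $ fst (snd p)\<bar> \<le> C * norm x ^ 0 \<and>
        (\<lambda>y. g y $ fst p $ fst (snd p)) differentiable (at x) \<and>
        (\<forall>i. \<bar>partial i (\<lambda>y. g y $ fst p $ fst (snd p)) x\<bar> \<le> C * norm x ^ (0 - 1))"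
        by auto
      then have "\<forall>\<^sub>F x in nhds 0. \<bar>partial (snd (snd p)) (\<lambda>y. g y $ fst p $ fst (snd p)) x\<bar> \<le> C * 1"
        by eventually_elim simp
      then show ?thesis by blast
    qed
    from eventually_uniform_bound[where b = "\<lambda>_. 1"
        and f = "\<lambda>p x. \<bar>partial (snd (snd p)) (\<lambda>y. g y $ fst p $ fst (snd p)) x\<bar>", OF this]
    obtain C where "\<forall>\<^sub>F x in nhds 0. \<forall>p :: 'n \<times> 'n \<times> 'n.
        \<bar>partial (snd (snd p)) (\<lambda>y. g y $ fst p $ fst (snd p)) x\<bar> \<le> C * 1" by auto
    then have "\<forall>\<^sub>F x in nhds 0. \<forall>i j k. \<bar>partial k (\<lambda>y. g y $ i $ j) x\<bar> \<le> C"
      by eventually_elim simp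
    then show ?thesis by blast
  qed

  have mu_entry: "\<exists>C. \<forall>\<^sub>F x in nhds 0. \<bar>partial i (\<lambda>y. \<mu> y $ j) x\<bar> \<le> C * norm x powr (real l / 2)" for i j
  proof (cases "\<forall>x\<in>E. \<mu> x = 0")
    case True
    have "\<forall>\<^sub>F x in nhds 0. x \<in> E" using E by (rule eventually_nhds_in_open)
    then have "\<forall>\<^sub>F x in nhds 0. \<bar>partial i (\<lambda>y. \<mu> y $ j) x\<bar> \<le> 0 * norm x powr (real l / 2)"
    proof eventually_elim
      case (elim x)
      have "((\<lambda>y. \<mu> y $ j) has_derivative (\<lambda>_. 0)) (at x)"
        by (rule has_derivative_transform_within_open[OF has_derivative_const[of 0] E(1) elim]) (simp add: True)
      then show ?case by (simp add: partial_eq)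
    qed
    then show ?thesis by blast
  next
    case False
    then have "1 \<le> real d - real l / 2" using weak_magnetism by blast
    then have d: "1 + real l / 2 \<le> real d" by linarith
    have "real_analytic_on (\<lambda>x. \<mu> x $ j) E"
      by (rule real_analytic_on_bounded_linear[OF bounded_linear_vec_nth mu_analytic])
    then obtain Q Q' B \<sigma> where Q: "homogeneous_expansion (\<lambda>y. \<mu> y $ j) 0 Q Q' B \<sigma>"
      using real_analytic_on_imp_homogeneous_expansion[OF _ E] by blast
    \<comment> \<open>If some Taylor term of \<open>\<mu>\<close> is non-zero, then \<open>d\<close>
      is a true minimum. The other case is settled without an identity theorem: there all terms
      vanish and any large order will do, such as \<open>l + 1 >= 1 + l / 2\<close>.\<close>
    have "\<exists>m. 1 + real l / 2 \<le> real m \<and> (\<forall>k<m. \<forall>h. Q k h = 0)"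
    proof (cases "\<exists>k i x. taylor_term (\<lambda>y. \<mu> y $ i) k x \<noteq> 0")
      case True
      have "Q k h = 0" if "k < d" for k h
        using not_less_Least[of k "\<lambda>k. \<exists>i x. taylor_term (\<lambda>y. \<mu> y $ i) k x \<noteq> 0"] that
        unfolding d_def by (simp add: taylor_term_eq_homogeneous_term[OF Q, symmetric])
      then show ?thesis using d by blast
    next
      case False
      then have "Q k h = 0" for k h
        by (simp add: taylor_term_eq_homogeneous_term[OF Q, symmetric])
      then show ?thesis by (intro exI[of _ "l + 1"]) simp
    qed
    then obtain m where m: "1 + real l / 2 \<le> real m" "\<And>k h. k < m \<Longrightarrow> Q k h = 0" by blast
    obtain C where C: "\<forall>\<^sub>F x in nhds 0. \<bar>\<mu> x $ j\<bar> \<le> C * norm x ^ m \<and> (\<lambda>y. \<mu> y $ j) differentiable (at x) \<and>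
        (\<forall>i. \<bar>partial i (\<lambda>y. \<mu> y $ j) x\<bar> \<le> C * norm x ^ (m - 1))"
      using homogeneous_expansion_partial_bounds[OF Q m(2)] by blast
    have "\<forall>\<^sub>F x :: real^'n in nhds 0. x \<in> ball 0 1" by (rule eventually_nhds_in_open) auto
    with C have "\<forall>\<^sub>F x in nhds 0. \<bar>partial i (\<lambda>y. \<mu> y $ j) x\<bar> \<le> \<bar>C\<bar> * norm x powr (real l / 2)"
    proof eventually_elim
      case (elim x)
      have "norm x ^ (m - 1) \<le> norm x powr (real l / 2)"
        using elim m(1) l_ge by (intro power_le_powr) auto
      then have "\<bar>C\<bar> * norm x ^ (m - 1) \<le> \<bar>C\<bar> * norm x powr (real l / 2)"
        by (intro mult_left_mono) auto
      moreover have "C * norm x ^ (m - 1) \<le> \<bar>C\<bar> * norm x ^ (m - 1)"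
        by (intro mult_right_mono) auto
      ultimately show ?case using elim by (meson order_trans)
    qed
    then show ?thesis by blast
  qed
  have mu_bound: "\<exists>C. \<forall>\<^sub>F x in nhds 0. \<forall>i j. \<bar>partial i (\<lambda>y. \<mu> y $ j) x\<bar> \<le> C * norm x powr (real l / 2)"
  proof -
    have "\<exists>C. \<forall>\<^sub>F x in nhds 0. \<bar>partial (fst p) (\<lambda>y. \<mu> y $ snd p) x\<bar> \<le> C * norm x powr (real l / 2)"
      for p :: "'n \<times> 'n"
      by (rule mu_entry)
    from eventually_uniform_bound[where b = "\<lambda>x. norm x powr (real l / 2)"
        and f = "\<lambda>p x. \<bar>partial (fst p) (\<lambda>y. \<mu> y $ snd p) x\<bar>", OF this]
    obtain C where "\<forall>\<^sub>F x in nhds 0. \<forall>p :: 'n \<times> 'n. \<bar>partial (fst p) (\<lambda>y. \<mu> y $ snd p) x\<bar> \<le> C * norm x powr (real l / 2)"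
      by auto
    then have "\<forall>\<^sub>F x in nhds 0. \<forall>i j. \<bar>partial i (\<lambda>y. \<mu> y $ j) x\<bar> \<le> C * norm x powr (real l / 2)"
      by eventually_elim simp
    then show ?thesis by blast
  qed

  \<comment> \<open>Otherwise \<open>P l\<close> has a positive minimum \<open>c\<close> on the
    sphere, and \<open>U x >= c * norm x ^ l - C * norm x ^ (l + 1)\<close> makes the origin a
    strict minimum.\<close>
  have nonpos: "\<exists>q. norm q = 1 \<and> P l q \<le> 0"
  proof (rule ccontr)
    assume "\<not> (\<exists>q. norm q = 1 \<and> P l q \<le> 0)"
    then have pos: "0 < P l q" if "norm q = 1" for q using that by (meson not_le)
    have "(axis undefined 1 :: real^'n) \<in> sphere 0 1" by simp
    then have "sphere (0::real^'n) 1 \<noteq> {}" by (metis empty_iff)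
    moreover have "continuous_on (sphere 0 1) (P l)"
      using has_derivative_continuous[OF P_deriv] by (intro continuous_at_imp_continuous_on) blast
    ultimately obtain q where q: "norm q = 1" "\<And>q'. norm q' = 1 \<Longrightarrow> P l q \<le> P l q'"
      using continuous_attains_inf[OF compact_sphere, of 0 1 "P l"] by (metis mem_sphere_0)
    define c where "c = P l q"
    have c: "c > 0" using pos[OF q(1)] by (simp add: c_def)
    obtain C where C: "\<forall>\<^sub>F x in nhds 0. \<bar>U x - P l x\<bar> \<le> C * norm x ^ (l + 1)" using U_exp' by blast
    \<comment> \<open>Chosen so that \<open>(\<bar>C\<bar> + 1) * norm x < c\<close> inside the
      ball; the summand 1 keeps the denominator positive when \<open>C = 0\<close>.\<close>
    define \<delta> where "\<delta> = c / (\<bar>C\<bar> + 1)"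
    have \<delta>: "\<delta> > 0" using c by (simp add: \<delta>_def)
    have "\<forall>\<^sub>F x :: real^'n in nhds 0. x \<in> ball 0 \<delta>"
      using \<delta> by (intro eventually_nhds_in_open) auto
    with C have "\<forall>\<^sub>F x in nhds 0. x \<noteq> 0 \<longrightarrow> U 0 < U x"
    proof eventually_elim
      case (elim x)
      show ?case
      proof
        assume x: "x \<noteq> 0"
        have "norm x ^ l * c \<le> norm x ^ l * P l (x /\<^sub>R norm x)"
          unfolding c_def using x by (intro mult_left_mono q(2)) auto
        also have "\<dots> = P l x" using hom[of l "norm x" "x /\<^sub>R norm x"] x by simp
        finally have 1: "norm x ^ l * c \<le> P l x" .
        have "(\<bar>C\<bar> + 1) * norm x < c"
          using elim(2) by (simp add: \<delta>_def pos_less_divide_eq mult.commute)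
        then have "C * norm x < c"
          using norm_ge_zero[of x] mult_right_mono[of C "\<bar>C\<bar> + 1" "norm x"] by linarith
        then have "norm x ^ l * (C * norm x) < norm x ^ l * c"
          using x by (intro mult_strict_left_mono) auto
        then have "C * norm x ^ (l + 1) < norm x ^ l * c" by (simp add: mult_ac)
        then show "U 0 < U x" using 1 elim(1) U_0 by linarith
      qed
    qed
    then show False using not_strict_min by (simp add: eventually_at_filter)
  qed

  have "em_system_nonmin r\<^sub>E g U \<mu> l (P l) dUl"
  proof
    show "continuous_on UNIV dUl"
      unfolding dUl_def by (intro continuous_on_vec_lambda P'_cont)
    show "(P l has_derivative (\<lambda>v. dUl x \<bullet> v)) (at x)" for x
      using P_deriv[of l x] by (simp add: dUl[symmetric])
  qed (use rE_pos l_ge g_sym g_posdef g_0 U_0 g_bound dU_bound U_exp' dU_exp hom mu_bound nonpos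
      real_analytic_on_imp_differentiable[OF g_entry E(1)] real_analytic_on_imp_differentiable[OF U_analytic E(1)]
      in \<open>simp_all add: E_def\<close>)
  from em_system_nonmin.blow_up[OF this] show ?thesis
    unfolding bM_lt0_def bM0_def bM_le0_def Ht_def Xt_def pi_def bM_def M_def H_def X_def TE_def E_def .
qed

end
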